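(* Let $(\Omega,d,\mu)$ be a connected metric space equipped with a separable, non-atomic Borel probability measure $\mu$, such that for every $f\in Lip(\Omega)$ and every $c\in\mathbb{R}$ one has $|\nabla f(x)|=0$ for $\mu$-a.e. $x$ in $\{f=c\}$, and suppose $(\Omega,d,\mu)$ admits a convex isoperimetric estimator $I$. Let $X$ be a rearrangement-invariant (r.i.) space on $\Omega$. Assume that $\underline{\alpha}_X>0$, or that there is $c>0$ such that $$\int_t^{1/2}\frac{ds}{I(s)}\le c\,\frac{t}{I(t)},\qquad 0<t<1/2.$$ Then there is a constant $C>0$ such that for all $g\in Lip(\Omega)$ $$\inf_{c\in\mathbb{R}}\left\|(g-c)_\mu^*(t)\frac{I(t)}{t}\right\|_{\bar X}\le C\,\big\||\nabla g|\big\|_X.$$ Moreover, if $Y$ is a quasi-Banach rearrangement-invariant (q.r.i.) space on $(0,1)$ for which there is a constant $C_0>0$ with $\|Q_If\|_Y\le C_0\|f\|_{\bar X}$ for all $f\in\bar X$, then there is a constant $C'>0$ such that for all $\mu$-measurable functions $g$ on $\Omega$ $$\|g_\mu^*\|_Y\le C'\left\|g_\mu^*(t)\frac{I(t)}{t}\right\|_{\bar X}.$$ In particular, there are constants $C',C''>0$ such that for all $g\in Lip(\Omega)$ $$\inf_{c\in\mathbb{R}}\|(g-c)_\mu^*\|_Y\le C'\inf_{c\in\mathbb{R}}\left\|(g-c)_\mu^*(t)\frac{I(t)}{t}\right\|_{\bar X}\le C''\big\||\nabla g|\big\|_X.$$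
   Context: $Lip(\Omega)$ is the set of real-valued Lipschitz functions on $\Omega$, and $|\nabla f(x)|=\limsup_{d(x,y)\to0}\frac{|f(x)-f(y)|}{d(x,y)}$. The Minkowski content of a Borel set $A$ is $\mu^+(A)=\liminf_{h\to0^+}\frac{\mu(A_h)-\mu(A)}{h}$, $A_h=\{x:d(x,A)<h\}$. $(\Omega,d,\mu)$ admits the convex isoperimetric estimator $I$ if $I:[0,1]\to[0,\infty)$ is continuous, convex on $[0,1/2]$, increasing on $(0,1/2)$, symmetric about $1/2$, $I(0)=0$, $I(t)>0$ on $(0,1)$, and $\mu^+(A)\ge I(\mu(A))$ for all Borel sets $A\subset\Omega$. The decreasing rearrangement of a measurable a.e. finite $u$ on $\Omega$ is $u_\mu^*(s)=\inf\{t\ge0:\mu\{|u|>t\}\le s\}$, $0<s<1$; for functions on $(0,1)$, $f^*$ denotes the decreasing rearrangement with respect to Lebesgue measure. An r.i. space is a Banach function space $X$ such that if $f\in X$ and $g$ is measurable with $g^*_\mu=f^*_\mu$, then $g\in X$ and $\|g\|_X=\|f\|_X$; a q.r.i. space is defined in the same way with the triangle inequality weakened to $\|x+y\|\le C(\|x\|+\|y\|)$ (complete quasi-normed). For an r.i. space $X$ on $\Omega$, $\bar X$ denotes its representation space, the r.i. space on $(0,1)$ (Lebesgue measure) with $\|f\|_X=\|f_\mu^*\|_{\bar X}$ for all $f\in X$. The lower Boyd index is $\underline{\alpha}_X=\sup_{0<s<1}\frac{\ln h_X(s)}{\ln s}$, where $h_X(s)$ is the norm on $\bar X$ of the operator $E_s$,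 $E_sf(t)=f^*(t/s)$ for $0<t<\min(s,1)$ and $E_sf(t)=0$ for $s<t<1$. The isoperimetric Hardy operator is $Q_If(t)=\int_t^{1/2}f(s)\frac{ds}{I(s)}$ for $0<t<1/2$, regarded as a function on $(0,1)$ by setting it equal to $0$ on $[1/2,1)$. *)

theory Defs
  imports "HOL-Probability.Probability"
begin

section \<open>Metric measure spaces\<close>

definition Lip :: "('a::metric_space \<Rightarrow> real) set" where
  "Lip = {f. \<exists>L. L-lipschitz_on UNIV f}"

text \<open>The modulus of the gradient. For Lipschitz functions the upper limit is finite, so the
  conversion to \<^typ>\<open>real\<close> loses nothing. At an isolated point it is \<open>0\<close>.\<close>

definition grad_modulus :: "('a::metric_space \<Rightarrow> real) \<Rightarrow> 'a \<Rightarrow> real" where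
  "grad_modulus f x = enn2real (Limsup (at x) (\<lambda>y. ennreal (\<bar>f x - f y\<bar> / dist x y)))"

text \<open>The set of points at distance less than \<open>h\<close> from \<open>A\<close>. The library has
  \<open>infdist x {} = 0\<close>, whereas here the empty set is at infinite distance from every point.\<close>

definition enlargement :: "'a::metric_space set \<Rightarrow> real \<Rightarrow> 'a set" where
  "enlargement A h = {x. A \<noteq> {} \<and> infdist x A < h}"

definition minkowski_content :: "'a::metric_space measure \<Rightarrow> 'a set \<Rightarrow> ereal" where
  "minkowski_content M A =
     Liminf (at_right 0) (\<lambda>h. ereal ((measure M (enlargement A h) - measure M A) / h))"

definition convex_isoperimetric_estimator ::
    "'a::metric_space measure \<Rightarrow> (real \<Rightarrow> real) \<Rightarrow> bool" where
  "convex_isoperimetric_estimator M I \<longleftrightarrow>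
     (\<forall>t\<in>{0..1}. 0 \<le> I t) \<and>
     continuous_on {0..1} I \<and>
     convex_on {0..1/2} I \<and>
     mono_on {0<..<1/2} I \<and>
     (\<forall>t\<in>{0..1}. I (1 - t) = I t) \<and>
     I 0 = 0 \<and>
     (\<forall>t\<in>{0<..<1}. 0 < I t) \<and>
     (\<forall>A\<in>sets borel. minkowski_content M A \<ge> ereal (I (measure M A)))"

text \<open>Separability of the measure algebra under the pseudometric given by the measure of the
  symmetric difference.\<close>

definition separable_measure :: "'a measure \<Rightarrow> bool" where
  "separable_measure M \<longleftrightarrow>
     (\<exists>D. countable D \<and> D \<subseteq> sets M \<and>
        (\<forall>A\<in>sets M. \<forall>e>0. \<exists>B\<in>D. measure M ((A - B) \<union> (B - A)) < e))"

definition nonatomic_measure :: "'a measure \<Rightarrow> bool" where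
  "nonatomic_measure M \<longleftrightarrow>
     (\<forall>A\<in>sets M. 0 < measure M A \<longrightarrow>
        (\<exists>B\<in>sets M. B \<subseteq> A \<and> 0 < measure M B \<and> measure M B < measure M A))"


section \<open>Rearrangement-invariant spaces\<close>

text \<open>Meaningful for a measurable \<open>u\<close> on a probability space and \<open>0 < s < 1\<close>; then the set
  below is nonempty.\<close>

definition rearrangement :: "'a measure \<Rightarrow> ('a \<Rightarrow> real) \<Rightarrow> real \<Rightarrow> real" where
  "rearrangement M u s = Inf {t. 0 \<le> t \<and> measure M {x \<in> space M. t < \<bar>u x\<bar>} \<le> s}"

abbreviation leb01 :: "real measure" where
  "leb01 \<equiv> lebesgue_on {0<..<1}"

text \<open>A function space is given by its (quasi-)norm on all measurable functions, with value
  \<open>\<infinity>\<close> exactly outside the space.\<close>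

type_synonym 'a fnorm = "('a \<Rightarrow> real) \<Rightarrow> ennreal"

definition fspace :: "'a measure \<Rightarrow> 'a fnorm \<Rightarrow> ('a \<Rightarrow> real) set" where
  "fspace M N = {f \<in> borel_measurable M. N f < \<infinity>}"

definition lattice_quasinorm :: "'a measure \<Rightarrow> real \<Rightarrow> 'a fnorm \<Rightarrow> bool" where
  "lattice_quasinorm M C N \<longleftrightarrow>
     (\<forall>f\<in>borel_measurable M. N f = 0 \<longleftrightarrow> (AE x in M. f x = 0)) \<and>
     (\<forall>f\<in>borel_measurable M. \<forall>a. N (\<lambda>x. a * f x) = ennreal \<bar>a\<bar> * N f) \<and>
     (\<forall>f\<in>borel_measurable M. \<forall>g\<in>borel_measurable M.
        N (\<lambda>x. f x + g x) \<le> ennreal C * (N f + N g)) \<and>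
     (\<forall>f\<in>borel_measurable M. \<forall>g\<in>borel_measurable M.
        (AE x in M. \<bar>f x\<bar> \<le> \<bar>g x\<bar>) \<longrightarrow> N f \<le> N g) \<and>
     (\<forall>E\<in>sets M. emeasure M E < \<infinity> \<longrightarrow> N (indicator E) < \<infinity>)"

text \<open>Banach function spaces in the sense of Bennett and Sharpley: in addition to the above with
  \<open>C = 1\<close>, the Fatou property and the local embedding into \<open>L\<^sup>1\<close>. Completeness is a consequence.\<close>

definition banach_function_space :: "'a measure \<Rightarrow> 'a fnorm \<Rightarrow> bool" where
  "banach_function_space M N \<longleftrightarrow>
     lattice_quasinorm M 1 N \<and>
     (\<forall>F f. (\<forall>n::nat. F n \<in> borel_measurable M) \<and> f \<in> borel_measurable M \<and>
        (AE x in M. (\<forall>n. 0 \<le> F n x \<and> F n x \<le> F (Suc n) x) \<and> (\<lambda>n. F n x) \<longlonglongrightarrow> f x)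
        \<longrightarrow> (\<lambda>n. N (F n)) \<longlonglongrightarrow> N f) \<and>
     (\<forall>E\<in>sets M. emeasure M E < \<infinity> \<longrightarrow>
        (\<exists>C::real. \<forall>f\<in>borel_measurable M.
           (\<integral>\<^sup>+x\<in>E. ennreal \<bar>f x\<bar> \<partial>M) \<le> ennreal C * N f))"

text \<open>The embedding into \<open>L\<^sup>1\<close> is not required here, as it fails for
  the spaces \<open>L\<^sup>p\<close> with \<open>p < 1\<close>, and neither is the Fatou property, so that completeness has to be
  demanded.\<close>

definition quasi_banach_function_space :: "'a measure \<Rightarrow> 'a fnorm \<Rightarrow> bool" where
  "quasi_banach_function_space M N \<longleftrightarrow>
     (\<exists>C. lattice_quasinorm M C N) \<and>
     (\<forall>F. (\<forall>n::nat. F n \<in> fspace M N) \<and>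
        (\<forall>e>0. \<exists>n0. \<forall>m\<ge>n0. \<forall>n\<ge>n0. N (\<lambda>x. F m x - F n x) < e)
        \<longrightarrow> (\<exists>f\<in>fspace M N. (\<lambda>n. N (\<lambda>x. F n x - f x)) \<longlonglongrightarrow> 0))"

definition rearrangement_invariant :: "'a measure \<Rightarrow> 'a fnorm \<Rightarrow> bool" where
  "rearrangement_invariant M N \<longleftrightarrow>
     (\<forall>f\<in>fspace M N. \<forall>g\<in>borel_measurable M.
        (\<forall>s\<in>{0<..<1}. rearrangement M g s = rearrangement M f s)
        \<longrightarrow> g \<in> fspace M N \<and> N g = N f)"

definition ri_space :: "'a measure \<Rightarrow> 'a fnorm \<Rightarrow> bool" where
  "ri_space M N \<longleftrightarrow> banach_function_space M N \<and> rearrangement_invariant M N"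

definition qri_space :: "'a measure \<Rightarrow> 'a fnorm \<Rightarrow> bool" where
  "qri_space M N \<longleftrightarrow> quasi_banach_function_space M N \<and> rearrangement_invariant M N"

text \<open>On a non-atomic probability space this determines \<open>Xbar\<close> on all measurable functions: every
  rearrangement on the unit interval is that of some \<open>f\<close>, and the Fatou property settles the
  functions outside the space.\<close>

definition representation_space :: "'a measure \<Rightarrow> 'a fnorm \<Rightarrow> real fnorm \<Rightarrow> bool" where
  "representation_space M X Xbar \<longleftrightarrow>
     ri_space leb01 Xbar \<and> (\<forall>f\<in>fspace M X. X f = Xbar (rearrangement M f))"


section \<open>Boyd index and isoperimetric Hardy operator\<close>

definition dilation :: "real \<Rightarrow> (real \<Rightarrow> real) \<Rightarrow> real \<Rightarrow> real" where
  "dilation s f t = (if 0 < t \<and> t < min s 1 then rearrangement leb01 f (t / s) else 0)"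

definition dilation_norm :: "real fnorm \<Rightarrow> real \<Rightarrow> ennreal" where
  "dilation_norm Xbar s = (SUP f\<in>{f \<in> fspace leb01 Xbar. Xbar f \<le> 1}. Xbar (dilation s f))"

text \<open>For \<open>0 < s < 1\<close> the dilation norm lies in \<open>(0,1]\<close>, so the conversion to \<^typ>\<open>real\<close> is
  harmless.\<close>

definition lower_boyd_index :: "real fnorm \<Rightarrow> ereal" where
  "lower_boyd_index Xbar =
     (SUP s\<in>{0<..<1}. ereal (ln (enn2real (dilation_norm Xbar s)) / ln s))"

definition hardy_op :: "(real \<Rightarrow> real) \<Rightarrow> (real \<Rightarrow> real) \<Rightarrow> real \<Rightarrow> real" where
  "hardy_op I f t =
     (if 0 < t \<and> t < 1/2 then (LINT s:{t..1/2}|lebesgue. f s / I s) else 0)"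

end

theory Submission
  imports Defs
begin

text \<open>Let \<open>w = \<bar>g - m\<bar>\<close> for a median \<open>m\<close> of a Lipschitz function \<open>g\<close>, let \<open>\<nu> s\<close> be the measure of
  \<open>{w > s}\<close>, let \<open>\<phi> = \<bar>\<nabla>g\<bar>\<close>, and let \<open>J t = I (min t (1/2))\<close>.

  The isoperimetric inequality holds for the superlevel sets of \<open>w\<close> in the form that
  their content is at least \<open>c\<^sub>0 J (\<nu> s)\<close>; sets of more than half measure do no harm, because one of
  the two sides of the median is a large set of at most half measure
  (\<open>median_content_lower_bound\<close>). The coarea inequality of Bobkov and Houdre, applied to truncations
  of \<open>w\<close>, turns this into \<open>\<integral>\<^sub>a\<^sup>b c\<^sub>0 J (\<nu> s) ds \<le> \<integral> \<phi> d\<mu>\<close>, the integral on the right being over \<open>{a < w < b}\<close>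
  (\<open>coarea_strip\<close>), and then the same with arbitrary weights on the levels \<open>s\<close>
  (\<open>weighted_level_integral_le\<close>). This is the symmetrization inequality for \<open>- (w\<^sup>*)' J\<close> against \<open>\<phi>\<close>,
  written without derivatives.

  The function to be estimated is \<open>w\<^sup>* t J t / t\<close>. By the layer cake formula its integral over a set \<open>E\<close> is
  an integral over the levels, with a weight depending on \<open>\<nu> s\<close>. Under the integral condition the
  weight is bounded and has integral at most a constant times \<open>\<bar>E\<bar>\<close>, and this gives majorization
  by \<open>\<phi>\<^sup>*\<close>. For a positive Boyd index some
  dilation has norm less than \<open>1\<close>; the weight is bounded by a geometric series,
  which gives majorization by the sum of the dilates of \<open>\<phi>\<^sup>*\<close> by powers, and these have
  geometrically decreasing norms. In both cases the theorem of Hardy, Littlewood, Polya and Calderon,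
  that majorization implies an inequality of norms in every r.i. space with the Fatou property
  (\<open>ri_norm_majorization\<close>), finishes the argument. It is derived from the finite theorem, where
  majorization is realized by successive transfers between two positions, and
  from approximation by dyadic step functions.

  For the second part, the isoperimetric Hardy operator applied to \<open>g\<^sup>* s I s / s\<close> is the integral of \<open>g\<^sup>* s / s\<close>
  over \<open>[t, 1/2]\<close>, which is at least \<open>g\<^sup>*(2 t) / 2\<close> for \<open>t < 1/4\<close>, and the loss of the factor \<open>2\<close> in the
  argument is made up for by adding four translates, at the cost of the constant of the
  quasi-norm.\<close>

section \<open>The unit interval and the decreasing rearrangement\<close>

lemma prob_space_leb01: "prob_space leb01"
  by (rule prob_spaceI) (simp add: emeasure_restrict_space space_restrict_space)

lemma borel_measurable_leb01I:
  assumes "f \<in> measurable (restrict_space borel {0<..<1}) N"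
  shows "f \<in> measurable leb01 N"
proof (rule measurableI)
  show "f x \<in> space N" if "x \<in> space leb01" for x
    using measurable_space[OF assms, of x] that by (simp add: space_restrict_space)
  fix A assume "A \<in> sets N"
  then have "f -` A \<inter> {0<..<1} \<in> sets (restrict_space borel {0<..<1::real})"
    using measurable_sets[OF assms, of A] by (simp add: space_restrict_space)
  then obtain B where B: "B \<in> sets borel" "f -` A \<inter> {0<..<1} = {0<..<1} \<inter> B"
    by (auto simp: sets_restrict_space)
  then have "B \<in> sets lebesgue" by simp
  then show "f -` A \<inter> space leb01 \<in> sets leb01"
    using B(2) by (simp add: sets_restrict_space space_restrict_space)
qed

lemma id_measurable_leb01: "(\<lambda>x. x) \<in> borel_measurable leb01"
  by (intro borel_measurable_leb01I measurable_restrict_space1) simp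

lemma antimono_measurable_leb01:
  fixes f :: "real \<Rightarrow> real"
  assumes "\<And>x y. 0 < x \<Longrightarrow> x \<le> y \<Longrightarrow> y < 1 \<Longrightarrow> f y \<le> f x"
  shows "f \<in> borel_measurable leb01"
proof -
  have "mono_on {0<..<1} (\<lambda>x. - f x)"
    using assms by (auto intro!: mono_onI)
  then have "(\<lambda>x. - f x) \<in> borel_measurable (restrict_space borel {0<..<1})"
    by (rule borel_measurable_mono_on_fnc)
  then have "(\<lambda>x. - f x) \<in> borel_measurable leb01"
    by (rule borel_measurable_leb01I)
  from borel_measurable_uminus[OF this] show ?thesis by simp
qed

lemma emeasure_leb01:
  assumes "A \<in> sets borel" "A \<subseteq> {0<..<1}"
  shows "emeasure leb01 A = emeasure lborel A"
  using assms by (simp add: emeasure_restrict_space)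

lemma measure_leb01:
  assumes "A \<in> sets borel" "A \<subseteq> {0<..<1}"
  shows "measure leb01 A = measure lborel A"
  using emeasure_leb01[OF assms] by (simp add: measure_def)

lemma nn_integral_leb01:
  assumes [measurable]: "f \<in> borel_measurable borel"
  shows "(\<integral>\<^sup>+x. f x \<partial>leb01) = (\<integral>\<^sup>+x. f x * indicator {0<..<1} x \<partial>lborel)"
  by (subst nn_integral_restrict_space) (simp_all add: nn_integral_completion)

lemma measure_leb01_lessThan:
  assumes "0 \<le> a"
  shows "measure leb01 {x. 0 < x \<and> x < 1 \<and> x < a} = min a 1"
proof -
  have "{x. 0 < x \<and> x < 1 \<and> x < a} = {0<..<min a 1}" by auto
  then show ?thesis
    using measure_leb01[of "{0<..<min a 1}"] assms
    by (simp add: greaterThanLessThan_subseteq_greaterThanLessThan)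
qed

definition dist_fun :: "'a measure \<Rightarrow> ('a \<Rightarrow> real) \<Rightarrow> real \<Rightarrow> real" where
  "dist_fun M u \<tau> = measure M {x \<in> space M. \<tau> < \<bar>u x\<bar>}"

context prob_space
begin

lemma dist_fun_bounds: "0 \<le> dist_fun M u \<tau>" "dist_fun M u \<tau> \<le> 1"
  by (simp_all add: dist_fun_def)

lemma dist_fun_antimono:
  assumes [measurable]: "u \<in> borel_measurable M" and "\<sigma> \<le> \<tau>"
  shows "dist_fun M u \<tau> \<le> dist_fun M u \<sigma>"
  unfolding dist_fun_def using assms(2) by (intro finite_measure_mono) auto

lemma dist_fun_right_limit:
  assumes [measurable]: "u \<in> borel_measurable M" and less: "s < dist_fun M u \<tau>"
  obtains \<sigma> where "\<tau> < \<sigma>" "s < dist_fun M u \<sigma>"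
proof -
  let ?A = "\<lambda>n::nat. {x \<in> space M. \<tau> + 1 / Suc n < \<bar>u x\<bar>}"
  have "(\<lambda>n. measure M (?A n)) \<longlonglongrightarrow> measure M (\<Union>n. ?A n)"
  proof (rule finite_Lim_measure_incseq)
    show "incseq ?A"
    proof (rule incseq_SucI, safe)
      fix n x assume "\<tau> + 1 / Suc n < \<bar>u x\<bar>"
      moreover have "1 / real (Suc (Suc n)) \<le> 1 / Suc n" by (simp add: field_simps)
      ultimately show "\<tau> + 1 / Suc (Suc n) < \<bar>u x\<bar>" by linarith
    qed
  qed auto
  moreover have "(\<Union>n. ?A n) = {x \<in> space M. \<tau> < \<bar>u x\<bar>}"
  proof safe
    fix x n assume "\<tau> + 1 / Suc n < \<bar>u x\<bar>"
    moreover have "0 < 1 / real (Suc n)" by simp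
    ultimately show "\<tau> < \<bar>u x\<bar>" by linarith
  next
    fix x assume "x \<in> space M" "\<tau> < \<bar>u x\<bar>"
    moreover from this obtain n where "inverse (real (Suc n)) < \<bar>u x\<bar> - \<tau>"
      using reals_Archimedean[of "\<bar>u x\<bar> - \<tau>"] by auto
    ultimately show "x \<in> (\<Union>n. ?A n)"
      by (auto intro!: exI[of _ n] simp: inverse_eq_divide algebra_simps)
  qed
  ultimately have "(\<lambda>n. dist_fun M u (\<tau> + 1 / Suc n)) \<longlonglongrightarrow> dist_fun M u \<tau>"
    by (simp add: dist_fun_def)
  then have "eventually (\<lambda>n. s < dist_fun M u (\<tau> + 1 / Suc n)) sequentially"
    using less by (rule order_tendstoD)
  then obtain n where "s < dist_fun M u (\<tau> + 1 / Suc n)"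
    by (auto simp: eventually_sequentially)
  then show ?thesis by (intro that[of "\<tau> + 1 / Suc n"]) auto
qed

lemma rearrangement_set_nonempty:
  assumes [measurable]: "u \<in> borel_measurable M" and s: "0 < s"
  obtains t where "0 \<le> t" "dist_fun M u t \<le> s"
proof -
  let ?A = "\<lambda>n::nat. {x \<in> space M. real n < \<bar>u x\<bar>}"
  have "(\<lambda>n. measure M (?A n)) \<longlonglongrightarrow> measure M (\<Inter>n. ?A n)"
    by (rule finite_Lim_measure_decseq) (auto simp: decseq_def)
  moreover have "(\<Inter>n. ?A n) = {}"
    by (auto simp: not_less) (meson less_asym reals_Archimedean2)
  ultimately have "(\<lambda>n. dist_fun M u (real n)) \<longlonglongrightarrow> 0"
    by (simp add: dist_fun_def)
  then have "eventually (\<lambda>n. dist_fun M u (real n) < s) sequentially"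
    using s by (rule order_tendstoD)
  then obtain n where "dist_fun M u (real n) < s"
    by (auto simp: eventually_sequentially)
  then show ?thesis by (intro that[of "real n"]) auto
qed

text \<open>The Galois connection between distribution function and rearrangement. It rests on the
  right continuity of the distribution function. Monotonicity, right continuity and the law of
  the rearrangement are all read off from it.\<close>

lemma less_rearrangement_iff:
  assumes u: "u \<in> borel_measurable M" and s: "0 < s" and \<tau>: "0 \<le> \<tau>"
  shows "\<tau> < rearrangement M u s \<longleftrightarrow> s < dist_fun M u \<tau>"
proof -
  let ?S = "{t. 0 \<le> t \<and> dist_fun M u t \<le> s}"
  have eq: "rearrangement M u s = Inf ?S"
    by (simp add: rearrangement_def dist_fun_def)
  have ne: "?S \<noteq> {}"
    using rearrangement_set_nonempty[OF u s] by blast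
  have bdd: "bdd_below ?S" by (auto intro!: bdd_belowI[of _ 0])
  show ?thesis
  proof
    assume "\<tau> < rearrangement M u s"
    then have "\<tau> \<notin> ?S" using cInf_lower[OF _ bdd, of \<tau>] eq by auto
    then show "s < dist_fun M u \<tau>" using \<tau> by auto
  next
    assume "s < dist_fun M u \<tau>"
    then obtain \<sigma> where \<sigma>: "\<tau> < \<sigma>" "s < dist_fun M u \<sigma>"
      using dist_fun_right_limit[OF u] by blast
    have "\<sigma> \<le> t" if "t \<in> ?S" for t
    proof (rule ccontr)
      assume "\<not> \<sigma> \<le> t"
      then have "dist_fun M u \<sigma> \<le> dist_fun M u t" using dist_fun_antimono[OF u] by simp
      then show False using that \<sigma> by simp
    qed
    then have "\<sigma> \<le> Inf ?S" using ne by (intro cInf_greatest) auto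
    then show "\<tau> < rearrangement M u s" using \<sigma> eq by simp
  qed
qed

lemma rearrangement_nonneg:
  assumes "u \<in> borel_measurable M" "0 < s"
  shows "0 \<le> rearrangement M u s"
proof -
  obtain t where "0 \<le> t" "dist_fun M u t \<le> s"
    using rearrangement_set_nonempty[OF assms] by blast
  then have "0 \<le> Inf {t. 0 \<le> t \<and> dist_fun M u t \<le> s}"
    by (intro cInf_greatest) auto
  then show ?thesis by (simp add: rearrangement_def dist_fun_def)
qed

text \<open>A rearrangement is determined by its strict lower bounds, and these are what the Galois
  connection provides. Every computation of a rearrangement below goes this way.\<close>

lemma rearrangement_eqI:
  assumes u: "u \<in> borel_measurable M" and s: "0 < s" and "0 \<le> a"
    and "\<And>\<tau>. 0 \<le> \<tau> \<Longrightarrow> s < dist_fun M u \<tau> \<longleftrightarrow> \<tau> < a"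
  shows "rearrangement M u s = a"
proof (rule antisym)
  let ?r = "rearrangement M u s"
  have r: "0 \<le> ?r" by (rule rearrangement_nonneg[OF u s])
  show "?r \<le> a"
    using less_rearrangement_iff[OF u s \<open>0 \<le> a\<close>] assms(4)[OF \<open>0 \<le> a\<close>] by linarith
  show "a \<le> ?r"
    using less_rearrangement_iff[OF u s r] assms(4)[OF r] by linarith
qed

lemma rearrangement_antimono:
  assumes u: "u \<in> borel_measurable M" and s: "0 < s" "s \<le> t"
  shows "rearrangement M u t \<le> rearrangement M u s"
proof (rule ccontr)
  assume "\<not> rearrangement M u t \<le> rearrangement M u s"
  then have *: "rearrangement M u s < rearrangement M u t" by simp
  have r: "0 \<le> rearrangement M u s" using rearrangement_nonneg[OF u] s by simp
  have "\<not> s < dist_fun M u (rearrangement M u s)"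
    using less_rearrangement_iff[OF u s(1) r] by simp
  moreover have "t < dist_fun M u (rearrangement M u s)"
    using less_rearrangement_iff[OF u _ r, of t] s * by simp
  ultimately show False using s by simp
qed

lemma rearrangement_ge_1:
  assumes u: "u \<in> borel_measurable M" and s: "1 \<le> s"
  shows "rearrangement M u s = 0"
proof (rule rearrangement_eqI[OF u])
  fix \<tau> :: real assume "0 \<le> \<tau>"
  then show "(s < dist_fun M u \<tau>) = (\<tau> < 0)"
    using dist_fun_bounds(2)[of u \<tau>] s by linarith
qed (use s in simp_all)

lemma rearrangement_measurable:
  assumes u: "u \<in> borel_measurable M"
  shows "rearrangement M u \<in> borel_measurable leb01"
  by (rule antimono_measurable_leb01) (rule rearrangement_antimono[OF u])

lemma rearrangement_mono_dist:
  assumes u: "u \<in> borel_measurable M" and N: "prob_space N" and v: "v \<in> borel_measurable N"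
    and s: "0 < s" and le: "\<And>\<tau>. 0 \<le> \<tau> \<Longrightarrow> dist_fun M u \<tau> \<le> dist_fun N v \<tau>"
  shows "rearrangement M u s \<le> rearrangement N v s"
proof (rule ccontr)
  let ?b = "rearrangement N v s"
  assume "\<not> ?thesis"
  then have *: "?b < rearrangement M u s" by simp
  have b: "0 \<le> ?b" using prob_space.rearrangement_nonneg[OF N v s] .
  have "s < dist_fun M u ?b" using * less_rearrangement_iff[OF u s b] by simp
  also have "\<dots> \<le> dist_fun N v ?b" using le b by simp
  finally show False using prob_space.less_rearrangement_iff[OF N v s b] by simp
qed

lemma dist_fun_rearrangement:
  assumes u: "u \<in> borel_measurable M" and \<tau>: "0 \<le> \<tau>"
  shows "dist_fun leb01 (rearrangement M u) \<tau> = dist_fun M u \<tau>"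
proof -
  let ?d = "dist_fun M u \<tau>"
  have "(x \<in> space leb01 \<and> \<tau> < \<bar>rearrangement M u x\<bar>) \<longleftrightarrow> (0 < x \<and> x < 1 \<and> x < ?d)" for x
  proof (cases "0 < x")
    case True
    have "\<bar>rearrangement M u x\<bar> = rearrangement M u x"
      using rearrangement_nonneg[OF u True] by (rule abs_of_nonneg)
    moreover have "x \<in> space leb01 \<longleftrightarrow> x < 1"
      using True by (simp add: space_restrict_space)
    ultimately show ?thesis
      using less_rearrangement_iff[OF u True \<tau>] True by metis
  qed (simp add: space_restrict_space)
  then have "dist_fun leb01 (rearrangement M u) \<tau> = measure leb01 {x. 0 < x \<and> x < 1 \<and> x < ?d}"
    unfolding dist_fun_def[of leb01] by presburger
  also have "\<dots> = min ?d 1"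
    by (rule measure_leb01_lessThan) (rule dist_fun_bounds)
  also have "\<dots> = ?d"
    by (rule min_absorb1) (rule dist_fun_bounds)
  finally show ?thesis .
qed

lemma rearrangement_rearrangement:
  assumes u: "u \<in> borel_measurable M" and s: "0 < s"
  shows "rearrangement leb01 (rearrangement M u) s = rearrangement M u s"
proof -
  have iff: "s < dist_fun leb01 (rearrangement M u) \<tau> \<longleftrightarrow> \<tau> < rearrangement M u s" if "0 \<le> \<tau>" for \<tau>
    using dist_fun_rearrangement[OF u that] less_rearrangement_iff[OF u s that] by metis
  show ?thesis
    by (rule prob_space.rearrangement_eqI[of leb01 "rearrangement M u" s "rearrangement M u s",
          OF prob_space_leb01 rearrangement_measurable[OF u] s rearrangement_nonneg[OF u s] iff])
qed

text \<open>By the Galois connection the two laws give the same mass to every half line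
  \<open>{x<..}\<close>.\<close>

lemma distr_rearrangement:
  assumes u [measurable]: "u \<in> borel_measurable M"
  shows "distr leb01 borel (rearrangement M u) = distr M borel (\<lambda>x. \<bar>u x\<bar>)"
proof (rule measure_eqI_lessThan)
  interpret L: prob_space leb01 by (rule prob_space_leb01)
  have [measurable]: "rearrangement M u \<in> borel_measurable leb01"
    by (rule rearrangement_measurable[OF u])
  show "emeasure (distr leb01 borel (rearrangement M u)) {x<..} < \<infinity>" for x
    by (subst emeasure_distr) (simp_all add: L.emeasure_eq_measure)
  show "emeasure (distr leb01 borel (rearrangement M u)) {x<..} =
      emeasure (distr M borel (\<lambda>x. \<bar>u x\<bar>)) {x<..}" for x
  proof (cases "0 \<le> x")
    case True
    have "rearrangement M u -` {x<..} \<inter> space leb01 = {t \<in> space leb01. x < \<bar>rearrangement M u t\<bar>}"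
      by (auto simp: space_restrict_space rearrangement_nonneg[OF u])
    then have "emeasure (distr leb01 borel (rearrangement M u)) {x<..} =
        emeasure leb01 {t \<in> space leb01. x < \<bar>rearrangement M u t\<bar>}"
      by (simp add: emeasure_distr)
    also have "\<dots> = emeasure M {t \<in> space M. x < \<bar>u t\<bar>}"
      using dist_fun_rearrangement[OF u True] by (simp add: dist_fun_def L.emeasure_eq_measure emeasure_eq_measure)
    also have "\<dots> = emeasure (distr M borel (\<lambda>x. \<bar>u x\<bar>)) {x<..}"
      by (auto simp: emeasure_distr intro!: arg_cong[where f="emeasure M"])
    finally show ?thesis .
  next
    case False
    have "x < rearrangement M u t" if "0 < t" for t
      using rearrangement_nonneg[OF u that] False by linarith
    then have 1: "rearrangement M u -` {x<..} \<inter> space leb01 = space leb01"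
      by (auto simp: space_restrict_space)
    have "x < \<bar>u t\<bar>" for t using False by linarith
    then have 2: "(\<lambda>x. \<bar>u x\<bar>) -` {x<..} \<inter> space M = space M" by auto
    have "emeasure (distr leb01 borel (rearrangement M u)) {x<..} = 1"
      by (subst emeasure_distr) (simp_all only: 1 L.emeasure_space_1 rearrangement_measurable[OF u]
        greaterThan_borel)
    moreover have "emeasure (distr M borel (\<lambda>x. \<bar>u x\<bar>)) {x<..} = 1"
      by (subst emeasure_distr) (simp_all add: 2 emeasure_space_1)
    ultimately show ?thesis by (rule trans[OF _ sym])
  qed
qed (rule sets_distr)+

lemma nn_integral_rearrangement:
  assumes u [measurable]: "u \<in> borel_measurable M" and p [measurable]: "p \<in> borel_measurable borel"
  shows "(\<integral>\<^sup>+t. p (rearrangement M u t) \<partial>leb01) = (\<integral>\<^sup>+x. p \<bar>u x\<bar> \<partial>M)"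
proof -
  have [measurable]: "rearrangement M u \<in> borel_measurable leb01"
    by (rule rearrangement_measurable[OF u])
  have "(\<integral>\<^sup>+t. p (rearrangement M u t) \<partial>leb01) = (\<integral>\<^sup>+y. p y \<partial>distr leb01 borel (rearrangement M u))"
    by (simp add: nn_integral_distr)
  also have "\<dots> = (\<integral>\<^sup>+y. p y \<partial>distr M borel (\<lambda>x. \<bar>u x\<bar>))"
    by (simp add: distr_rearrangement[OF u])
  also have "\<dots> = (\<integral>\<^sup>+x. p \<bar>u x\<bar> \<partial>M)" by (simp add: nn_integral_distr)
  finally show ?thesis .
qed

lemma rearrangement_right_limit:
  assumes u: "u \<in> borel_measurable M" and s: "0 < s"
  shows "(rearrangement M u \<longlongrightarrow> rearrangement M u s) (at_right s)"
proof (rule order_tendstoI)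
  fix a assume a: "a < rearrangement M u s"
  show "eventually (\<lambda>t. a < rearrangement M u t) (at_right s)"
  proof (cases "0 \<le> a")
    case True
    with a have "s < dist_fun M u a" using less_rearrangement_iff[OF u s] by simp
    then have "eventually (\<lambda>t. t < dist_fun M u a) (at_right s)"
      by (auto simp: eventually_at_right[of s "s + 1"])
    moreover have "eventually (\<lambda>t. s < t) (at_right s)" by (simp add: eventually_at_right_less)
    ultimately show ?thesis
    proof eventually_elim
      case (elim t)
      then show ?case using less_rearrangement_iff[OF u _ True, of t] s by simp
    qed
  next
    case False
    have "eventually (\<lambda>t. s < t) (at_right s)" by (simp add: eventually_at_right_less)
    then show ?thesis
    proof eventually_elim
      case (elim t)
      then show ?case using rearrangement_nonneg[OF u, of t] s False by linarith
    qed
  qed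
next
  fix a assume a: "rearrangement M u s < a"
  have "eventually (\<lambda>t. s < t) (at_right s)" by (simp add: eventually_at_right_less)
  then show "eventually (\<lambda>t. rearrangement M u t < a) (at_right s)"
  proof eventually_elim
    case (elim t)
    then show ?case using rearrangement_antimono[OF u s, of t] a by linarith
  qed
qed

end

lemma rearrangement_cmult:
  assumes M: "prob_space M" and u [measurable]: "u \<in> borel_measurable M" and s: "0 < s" and a: "0 < a"
  shows "rearrangement M (\<lambda>x. a * u x) s = a * rearrangement M u s"
proof (rule prob_space.rearrangement_eqI[OF M _ s])
  show "0 \<le> a * rearrangement M u s" using a prob_space.rearrangement_nonneg[OF M u s] by simp
  fix \<tau> :: real assume \<tau>: "0 \<le> \<tau>"
  have "dist_fun M (\<lambda>x. a * u x) \<tau> = dist_fun M u (\<tau> / a)"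
    using a by (simp add: dist_fun_def abs_mult field_simps)
  then show "(s < dist_fun M (\<lambda>x. a * u x) \<tau>) = (\<tau> < a * rearrangement M u s)"
    using prob_space.less_rearrangement_iff[OF M u s, of "\<tau> / a"] a \<tau> by (simp add: field_simps)
qed simp

section \<open>Majorization in rearrangement-invariant spaces\<close>

lemma lattice_quasinorm_mono:
  assumes "lattice_quasinorm leb01 C N" "f \<in> borel_measurable leb01" "g \<in> borel_measurable leb01"
    and "\<And>x. 0 < x \<Longrightarrow> x < 1 \<Longrightarrow> \<bar>f x\<bar> \<le> \<bar>g x\<bar>"
  shows "N f \<le> N g"
proof -
  have "AE x in leb01. \<bar>f x\<bar> \<le> \<bar>g x\<bar>"
    using assms(4) by (intro AE_I2) (simp add: space_restrict_space)
  then show ?thesis using assms(1-3) unfolding lattice_quasinorm_def by blast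
qed

lemma lattice_quasinorm_cong:
  assumes "lattice_quasinorm leb01 C N" "f \<in> borel_measurable leb01" "g \<in> borel_measurable leb01"
    and "\<And>x. 0 < x \<Longrightarrow> x < 1 \<Longrightarrow> f x = g x"
  shows "N f = N g"
  using assms by (intro antisym lattice_quasinorm_mono[OF assms(1)]) auto

lemma lattice_quasinorm_cmult:
  assumes "lattice_quasinorm M C N" "f \<in> borel_measurable M"
  shows "N (\<lambda>x. a * f x) = ennreal \<bar>a\<bar> * N f"
  using assms unfolding lattice_quasinorm_def by blast

lemma lattice_quasinorm_add:
  assumes "lattice_quasinorm M C N" "f \<in> borel_measurable M" "g \<in> borel_measurable M"
  shows "N (\<lambda>x. f x + g x) \<le> ennreal C * (N f + N g)"
  using assms unfolding lattice_quasinorm_def by blast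

text \<open>Invariance is only demanded for functions in the space. It extends to all measurable
  functions, because a function has the same rearrangement as its rearrangement.\<close>

lemma rearrangement_invariant_norm_eq:
  assumes N: "rearrangement_invariant leb01 N" and f: "f \<in> borel_measurable leb01"
  shows "N (rearrangement leb01 f) = N f"
proof -
  interpret L: prob_space leb01 by (rule prob_space_leb01)
  let ?f = "rearrangement leb01 f"
  have m: "?f \<in> borel_measurable leb01" by (rule L.rearrangement_measurable[OF f])
  have eq: "rearrangement leb01 ?f s = rearrangement leb01 f s" if "s \<in> {0<..<1}" for s
    using L.rearrangement_rearrangement[OF f] that by simp
  show ?thesis
  proof (cases "N f < \<infinity> \<or> N ?f < \<infinity>")
    case True
    then show ?thesis
    proof
      assume "N f < \<infinity>"
      then show ?thesis using N f m eq unfolding rearrangement_invariant_def fspace_def by blast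
    next
      assume "N ?f < \<infinity>"
      then have "?f \<in> fspace leb01 N" using m by (simp add: fspace_def)
      then have "N f = N ?f" using N f eq unfolding rearrangement_invariant_def by metis
      then show ?thesis by simp
    qed
  next
    case False
    then have "N f = \<infinity>" "N ?f = \<infinity>" by (simp_all add: less_top[symmetric])
    then show ?thesis by simp
  qed
qed

lemma norm_mono_dist_fun:
  assumes lq: "lattice_quasinorm leb01 C N" and N: "rearrangement_invariant leb01 N"
    and f: "f \<in> borel_measurable leb01" and g: "g \<in> borel_measurable leb01"
    and le: "\<And>\<tau>. 0 \<le> \<tau> \<Longrightarrow> dist_fun leb01 f \<tau> \<le> dist_fun leb01 g \<tau>"
  shows "N f \<le> N g"
proof -
  interpret L: prob_space leb01 by (rule prob_space_leb01)
  have "N (rearrangement leb01 f) \<le> N (rearrangement leb01 g)"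
  proof (rule lattice_quasinorm_mono[OF lq L.rearrangement_measurable[OF f] L.rearrangement_measurable[OF g]])
    fix x :: real assume x: "0 < x"
    have "rearrangement leb01 f x \<le> rearrangement leb01 g x"
      by (rule L.rearrangement_mono_dist[OF f prob_space_leb01 g x le])
    then show "\<bar>rearrangement leb01 f x\<bar> \<le> \<bar>rearrangement leb01 g x\<bar>"
      using L.rearrangement_nonneg[OF f x] by linarith
  qed
  then show ?thesis by (simp add: rearrangement_invariant_norm_eq[OF N] f g)
qed

definition step_fun :: "nat \<Rightarrow> (nat \<Rightarrow> real) \<Rightarrow> real \<Rightarrow> real" where
  "step_fun n b t = b (nat \<lfloor>t * real n\<rfloor>)"

lemma step_index_less:
  assumes "0 < t" "t < 1" "0 < n"
  shows "nat \<lfloor>t * real n\<rfloor> < n"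
proof -
  have "t * real n < 1 * real n" using assms by (intro mult_strict_right_mono) auto
  then have "\<lfloor>t * real n\<rfloor> < int n" by (simp add: floor_less_iff)
  then show ?thesis using assms by linarith
qed

lemma step_index_eq_iff:
  assumes "0 < t" "0 < n"
  shows "nat \<lfloor>t * real n\<rfloor> = i \<longleftrightarrow> real i / n \<le> t \<and> t < (real i + 1) / n"
proof -
  have "0 \<le> t * real n" using assms by simp
  then have "nat \<lfloor>t * real n\<rfloor> = i \<longleftrightarrow> \<lfloor>t * real n\<rfloor> = int i" by (simp add: nat_eq_iff)
  also have "\<dots> \<longleftrightarrow> real i \<le> t * real n \<and> t * real n < real i + 1"
    by (simp add: floor_eq_iff)
  finally show ?thesis using assms by (simp add: field_simps)
qed

lemma step_index_less_iff:
  assumes "0 < t" "0 < n"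
  shows "nat \<lfloor>t * real n\<rfloor> < i \<longleftrightarrow> t < real i / n"
proof -
  have "0 \<le> t * real n" using assms by simp
  then have "nat \<lfloor>t * real n\<rfloor> < i \<longleftrightarrow> \<lfloor>t * real n\<rfloor> < int i" by linarith
  also have "\<dots> \<longleftrightarrow> t * real n < real i" by (simp add: floor_less_iff)
  finally show ?thesis using assms by (simp add: field_simps)
qed

lemma step_index_measurable:
  "(\<lambda>t::real. nat \<lfloor>t * real n\<rfloor>) \<in> measurable leb01 (count_space UNIV)"
proof -
  have "(\<lambda>t::real. nat \<lfloor>t * real n\<rfloor>) \<in> measurable borel (count_space UNIV)" by measurable
  from measurable_compose[OF id_measurable_leb01 this] show ?thesis .
qed

lemma step_fun_measurable: "step_fun n b \<in> borel_measurable leb01"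
  unfolding step_fun_def[abs_def]
  by (rule measurable_compose[OF step_index_measurable]) simp

lemma nn_integral_step:
  fixes h :: "nat \<Rightarrow> ennreal"
  assumes n: "0 < n"
  shows "(\<integral>\<^sup>+t. h (nat \<lfloor>t * real n\<rfloor>) \<partial>leb01) = ennreal (1 / n) * (\<Sum>i<n. h i)"
proof -
  let ?I = "\<lambda>i. {t \<in> space leb01. nat \<lfloor>t * real n\<rfloor> = i}"
  have I: "?I i \<in> sets leb01" for i
    using measurable_sets[OF step_index_measurable[of n], of "{i}"] by (simp add: vimage_def Int_def conj_commute)
  have e: "emeasure leb01 (?I i) = ennreal (1 / n)" if "i < n" for i
  proof -
    have le: "(real i + 1) / n \<le> 1" using that n by (simp add: field_simps)
    have len: "(real i + 1) / n - real i / n = 1 / n" by (simp add: diff_divide_distrib[symmetric])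
    show ?thesis
    proof (cases "i = 0")
      case True
      have "?I i = {0<..<1 / real n}"
      proof (rule set_eqI)
        fix t :: real
        show "t \<in> ?I i \<longleftrightarrow> t \<in> {0<..<1 / real n}"
          using step_index_eq_iff[OF _ n, of t i] True le
          by (cases "0 < t") (auto simp: space_restrict_space)
      qed
      then show ?thesis using le True emeasure_leb01[of "{0<..<1 / real n}"]
        by (simp add: greaterThanLessThan_subseteq_greaterThanLessThan)
    next
      case False
      then have "0 < real i / n" using n by simp
      have "?I i = {real i / n ..< (real i + 1) / n}"
      proof (rule set_eqI)
        fix t :: real
        have "t < 1" if "t < (real i + 1) / n" using that le by (rule less_le_trans)
        moreover have "0 < t" if "real i / n \<le> t" using \<open>0 < real i / n\<close> that by (rule less_le_trans)
        moreover have "t \<in> ?I i \<longleftrightarrow> 0 < t \<and> t < 1 \<and> nat \<lfloor>t * real n\<rfloor> = i"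
          by (auto simp: space_restrict_space)
        ultimately show "t \<in> ?I i \<longleftrightarrow> t \<in> {real i / n ..< (real i + 1) / n}"
          unfolding atLeastLessThan_iff using step_index_eq_iff[OF _ n, of t i] by metis
      qed
      moreover have "{real i / n ..< (real i + 1) / n} \<subseteq> {0<..<1}"
        using \<open>0 < real i / n\<close> le by (meson atLeastLessThan_iff greaterThanLessThan_iff less_le_trans subsetI)
      moreover have "real i / n \<le> (real i + 1) / n" by (simp add: divide_right_mono)
      ultimately show ?thesis using len by (simp add: emeasure_leb01)
    qed
  qed
  have "(\<integral>\<^sup>+t. h (nat \<lfloor>t * real n\<rfloor>) \<partial>leb01) = (\<integral>\<^sup>+t. (\<Sum>i<n. h i * indicator (?I i) t) \<partial>leb01)"
  proof (rule nn_integral_cong)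
    fix t assume t: "t \<in> space leb01"
    then have "nat \<lfloor>t * real n\<rfloor> < n" using n by (auto simp: space_restrict_space step_index_less)
    moreover have "(\<Sum>i<n. h i * indicator (?I i) t) = (\<Sum>i<n. if nat \<lfloor>t * real n\<rfloor> = i then h i else 0)"
      using t by (intro sum.cong) auto
    ultimately show "h (nat \<lfloor>t * real n\<rfloor>) = (\<Sum>i<n. h i * indicator (?I i) t)" by simp
  qed
  also have "\<dots> = (\<Sum>i<n. \<integral>\<^sup>+t. h i * indicator (?I i) t \<partial>leb01)"
    by (intro nn_integral_sum borel_measurable_times_ennreal borel_measurable_const borel_measurable_indicator I)
  also have "\<dots> = (\<Sum>i<n. h i * emeasure leb01 (?I i))"
    using I by (simp add: nn_integral_cmult_indicator)
  also have "\<dots> = (\<Sum>i<n. h i * ennreal (1 / n))" using e by (intro sum.cong) auto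
  finally show ?thesis by (simp add: sum_distrib_right[symmetric] mult.commute)
qed

lemma dist_fun_step:
  assumes n: "0 < n"
  shows "dist_fun leb01 (step_fun n b) \<tau> = card {i. i < n \<and> \<tau> < \<bar>b i\<bar>} / n"
proof -
  interpret L: prob_space leb01 by (rule prob_space_leb01)
  let ?h = "\<lambda>i. indicator {i. \<tau> < \<bar>b i\<bar>} i :: ennreal"
  have [measurable]: "step_fun n b \<in> borel_measurable leb01" by (rule step_fun_measurable)
  have "emeasure leb01 {t \<in> space leb01. \<tau> < \<bar>step_fun n b t\<bar>}
      = (\<integral>\<^sup>+t. indicator {t \<in> space leb01. \<tau> < \<bar>step_fun n b t\<bar>} t \<partial>leb01)"
    by (rule nn_integral_indicator[symmetric]) measurable
  also have "\<dots> = (\<integral>\<^sup>+t. ?h (nat \<lfloor>t * real n\<rfloor>) \<partial>leb01)"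
    by (intro nn_integral_cong) (auto simp: step_fun_def indicator_def)
  also have "\<dots> = ennreal (1 / n) * (\<Sum>i<n. ?h i)" by (rule nn_integral_step[OF n])
  also have "(\<Sum>i<n. ?h i) = of_nat (card {i. i < n \<and> \<tau> < \<bar>b i\<bar>})"
  proof -
    have "(\<Sum>i<n. ?h i) = (\<Sum>i\<in>{i. i < n \<and> \<tau> < \<bar>b i\<bar>}. 1)"
      by (intro sum.mono_neutral_cong_right) (auto simp: indicator_def)
    then show ?thesis by simp
  qed
  also have "ennreal (1 / n) * of_nat (card {i. i < n \<and> \<tau> < \<bar>b i\<bar>})
      = ennreal (card {i. i < n \<and> \<tau> < \<bar>b i\<bar>} / n)"
    by (simp add: ennreal_of_nat_eq_real_of_nat ennreal_mult[symmetric])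
  finally show ?thesis
    by (simp add: dist_fun_def L.emeasure_eq_measure)
qed

lemma norm_step_fun_permute:
  assumes lq: "lattice_quasinorm leb01 C N" and N: "rearrangement_invariant leb01 N"
    and n: "0 < n" and p: "bij_betw p {..<n} {..<n}"
  shows "N (step_fun n (\<lambda>i. b (p i))) \<le> N (step_fun n b)"
proof (rule norm_mono_dist_fun[OF lq N step_fun_measurable step_fun_measurable])
  fix \<tau> :: real
  have "card {i. i < n \<and> \<tau> < \<bar>b (p i)\<bar>} \<le> card {i. i < n \<and> \<tau> < \<bar>b i\<bar>}"
  proof (rule card_inj_on_le[of p])
    show "inj_on p {i. i < n \<and> \<tau> < \<bar>b (p i)\<bar>}"
      by (rule inj_on_subset[OF bij_betw_imp_inj_on[OF p]]) auto
    show "p ` {i. i < n \<and> \<tau> < \<bar>b (p i)\<bar>} \<subseteq> {i. i < n \<and> \<tau> < \<bar>b i\<bar>}"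
      using bij_betw_apply[OF p] by auto
  qed auto
  then show "dist_fun leb01 (step_fun n (\<lambda>i. b (p i))) \<tau> \<le> dist_fun leb01 (step_fun n b) \<tau>"
    using n by (simp add: dist_fun_step divide_right_mono)
qed

text \<open>The theorem of Hardy, Littlewood and Polya for finite sequences. As long as some entry of
  \<open>a\<close> exceeds that of \<open>b\<close>, mass can be moved in \<open>b\<close> from an earlier position to this one. Such a
  transfer is a convex combination of the identity and a transposition, so it does not increase
  an invariant norm, and it creates a new position at which the two sequences agree.\<close>

lemma norm_step_fun_majorization:
  assumes lq: "lattice_quasinorm leb01 1 N" and N: "rearrangement_invariant leb01 N"
    and n: "0 < n"
    and a0: "\<And>i. i < n \<Longrightarrow> 0 \<le> a i" and a_anti: "\<And>i j. i \<le> j \<Longrightarrow> j < n \<Longrightarrow> a j \<le> a i"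
    and b0: "\<And>i. i < n \<Longrightarrow> 0 \<le> b i"
    and le: "\<And>k. k \<le> n \<Longrightarrow> (\<Sum>i<k. a i) \<le> (\<Sum>i<k. b i)"
  shows "N (step_fun n a) \<le> N (step_fun n b)"
  using b0 le
proof (induction "card {i. i < n \<and> a i \<noteq> b i}" arbitrary: b rule: less_induct)
  case less
  show ?case
  proof (cases "\<forall>i<n. a i \<le> b i")
    case True
    show ?thesis
    proof (rule lattice_quasinorm_mono[OF lq step_fun_measurable step_fun_measurable])
      fix x :: real assume "0 < x" "x < 1"
      then have "nat \<lfloor>x * real n\<rfloor> < n" using n by (rule step_index_less)
      then show "\<bar>step_fun n a x\<bar> \<le> \<bar>step_fun n b x\<bar>"
        using True a0 by (fastforce simp: step_fun_def)
    qed
  next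
    case False
    define i where "i = (LEAST i. i < n \<and> b i < a i)"
    have ex: "\<exists>i. i < n \<and> b i < a i" using False by auto
    have i: "i < n" "b i < a i" using LeastI_ex[OF ex] by (auto simp: i_def)
    have i_least: "a k \<le> b k" if "k < i" for k
      using not_less_Least[of k "\<lambda>i. i < n \<and> b i < a i"] that i(1) by (auto simp: i_def)
    have "\<exists>j<i. a j < b j"
    proof (rule ccontr)
      assume *: "\<not> ?thesis"
      have "(\<Sum>k<i. b k) \<le> (\<Sum>k<i. a k)" by (rule sum_mono) (use * in auto)
      then have "(\<Sum>k<Suc i. b k) < (\<Sum>k<Suc i. a k)" using i by simp
      then show False using less.prems(2)[of "Suc i"] i by simp
    qed
    then have ex: "{j. j < i \<and> a j < b j} \<noteq> {}" by auto
    define j where "j = Max {j. j < i \<and> a j < b j}"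
    have j: "j < i" "a j < b j" using Max_in[OF _ ex] by (auto simp: j_def)
    have between: "a k = b k" if "j < k" "k < i" for k
    proof -
      have "k \<le> j" if "a k < b k"
        unfolding j_def using that \<open>k < i\<close> by (intro Max_ge) auto
      then have "\<not> a k < b k" using that(1) by auto
      then show ?thesis using i_least[OF that(2)] by simp
    qed
    define \<delta> where "\<delta> = min (b j - a j) (a i - b i)"
    have \<delta>: "0 < \<delta>" "\<delta> \<le> b j - a j" "\<delta> \<le> a i - b i" using i j by (auto simp: \<delta>_def)
    define b' where "b' k = b k - (if k = j then \<delta> else 0) + (if k = i then \<delta> else 0)" for k
    have b'_j: "b' j = b j - \<delta>" and b'_i: "b' i = b i + \<delta>" and b'_k: "\<And>k. k \<noteq> i \<Longrightarrow> k \<noteq> j \<Longrightarrow> b' k = b k"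
      using j by (auto simp: b'_def)
    have aij: "a i \<le> a j" using a_anti[of j i] i j by simp
    have jn: "j < n" using i j by simp
    have sum_b': "(\<Sum>l<k. b' l) = (\<Sum>l<k. b l) - (if j < k then \<delta> else 0) + (if i < k then \<delta> else 0)" for k
      by (simp add: b'_def sum.distrib sum_subtractf)
    have "N (step_fun n a) \<le> N (step_fun n b')"
    proof (rule less.hyps)
      have "{l. l < n \<and> a l \<noteq> b' l} \<subseteq> {l. l < n \<and> a l \<noteq> b l}"
      proof safe
        fix l assume "l < n" "a l \<noteq> b' l" "a l = b l"
        then show False using i j b'_k[of l] by (cases "l = i"; cases "l = j") auto
      qed
      moreover have "\<exists>l<n. a l = b' l \<and> a l \<noteq> b l"
      proof (cases "\<delta> = b j - a j")
        case True
        then show ?thesis using b'_j j jn by (intro exI[of _ j]) auto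
      next
        case False
        then have "\<delta> = a i - b i" by (auto simp: \<delta>_def min_def split: if_splits)
        then show ?thesis using b'_i i by (intro exI[of _ i]) auto
      qed
      ultimately have "{l. l < n \<and> a l \<noteq> b' l} \<subset> {l. l < n \<and> a l \<noteq> b l}" by auto
      then show "card {l. l < n \<and> a l \<noteq> b' l} < card {l. l < n \<and> a l \<noteq> b l}"
        by (intro psubset_card_mono) auto
    next
      fix l assume l: "l < n"
      show "0 \<le> b' l"
        using less.prems(1)[OF l] a0[OF jn] \<delta> b'_j b'_i b'_k[of l] less.prems(1)[OF i(1)]
        by (cases "l = i"; cases "l = j") auto
    next
      fix k assume k: "k \<le> n"
      show "(\<Sum>l<k. a l) \<le> (\<Sum>l<k. b' l)"
      proof (cases "j < k \<and> k \<le> i")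
        case True
        have "(\<Sum>l<k. b l - a l) = (\<Sum>l<Suc j. b l - a l) + (\<Sum>l\<in>{Suc j..<k}. b l - a l)"
          using True by (subst sum.union_disjoint[symmetric]) (auto intro!: sum.cong)
        also have "(\<Sum>l\<in>{Suc j..<k}. b l - a l) = 0"
          using True between by (intro sum.neutral) auto
        also have "(\<Sum>l<Suc j. b l - a l) = (\<Sum>l<j. b l) - (\<Sum>l<j. a l) + (b j - a j)"
          by (simp add: sum_subtractf)
        finally have "\<delta> \<le> (\<Sum>l<k. b l - a l)"
          using less.prems(2)[of j] jn \<delta>(2) by simp
        then show ?thesis using True sum_b'[of k] by (simp add: sum_subtractf)
      next
        case False
        then have "(\<Sum>l<k. b' l) = (\<Sum>l<k. b l)" using sum_b'[of k] j by auto
        then show ?thesis using less.prems(2)[OF k] by simp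
      qed
    qed
    also have "N (step_fun n b') \<le> N (step_fun n b)"
    proof -
      define \<theta> where "\<theta> = \<delta> / (b j - b i)"
      let ?p = "\<lambda>k. if k = i then j else if k = j then i else k"
      \<comment> \<open>As \<open>a\<close> is decreasing, the transfer does not reverse the order of the two entries.\<close>
      have gap: "2 * \<delta> \<le> b j - b i" using \<delta> aij by linarith
      then have \<theta>: "0 \<le> \<theta>" "\<theta> \<le> 1" using \<delta> by (auto simp: \<theta>_def)
      have \<theta>\<delta>: "\<theta> * (b j - b i) = \<delta>" using gap \<delta> by (simp add: \<theta>_def)
      have p: "bij_betw ?p {..<n} {..<n}"
        by (rule bij_betwI[where g="?p"]) (use i jn in auto)
      have split: "b' k = (1 - \<theta>) * b k + \<theta> * b (?p k)" for k
      proof -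
        consider "k = i" | "k = j" "k \<noteq> i" | "k \<noteq> i" "k \<noteq> j" by auto
        then show ?thesis
        proof cases
          case 1
          then show ?thesis using b'_i \<theta>\<delta> by (simp add: algebra_simps)
        next
          case 2
          then show ?thesis using b'_j \<theta>\<delta> by (simp add: algebra_simps)
        next
          case 3
          then show ?thesis using b'_k[of k] by (simp add: algebra_simps)
        qed
      qed
      have m: "step_fun n c \<in> borel_measurable leb01" for c by (rule step_fun_measurable)
      have m': "(\<lambda>x. r * step_fun n c x) \<in> borel_measurable leb01" for c r
        by (rule borel_measurable_times[OF borel_measurable_const m])
      have "step_fun n b' = (\<lambda>x. (1 - \<theta>) * step_fun n b x + \<theta> * step_fun n (\<lambda>k. b (?p k)) x)"
        by (rule ext) (simp only: step_fun_def split)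
      then have "N (step_fun n b') \<le> ennreal 1 * (N (\<lambda>x. (1 - \<theta>) * step_fun n b x)
          + N (\<lambda>x. \<theta> * step_fun n (\<lambda>k. b (?p k)) x))"
        using lattice_quasinorm_add[OF lq m' m'] by simp
      also have "\<dots> = ennreal (1 - \<theta>) * N (step_fun n b) + ennreal \<theta> * N (step_fun n (\<lambda>k. b (?p k)))"
        using \<theta> by (simp add: lattice_quasinorm_cmult[OF lq m])
      also have "\<dots> \<le> ennreal (1 - \<theta>) * N (step_fun n b) + ennreal \<theta> * N (step_fun n b)"
        by (intro add_left_mono mult_left_mono norm_step_fun_permute[OF lq N n p]) simp
      also have "\<dots> = N (step_fun n b)"
        using \<theta> by (simp add: distrib_right[symmetric] ennreal_plus[symmetric] del: ennreal_plus)
      finally show ?thesis .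
    qed
    finally show ?thesis .
  qed
qed

text \<open>The prefix sums of a decreasing sequence are concave, so they dominate a piecewise linear
  function as soon as they do so at its nodes.\<close>

lemma prefix_sums_le_of_blocks:
  fixes \<alpha> b :: "nat \<Rightarrow> real"
  assumes K: "0 < K" and anti: "\<And>i j. i \<le> j \<Longrightarrow> b j \<le> b i"
    and nodes: "\<And>j. j \<le> n \<Longrightarrow> K * (\<Sum>i<j. \<alpha> i) \<le> (\<Sum>i<j * K. b i)"
    and k: "k \<le> n * K"
  shows "(\<Sum>i<k. \<alpha> (i div K)) \<le> (\<Sum>i<k. b i)"
proof -
  define j l where "j = k div K" and "l = k mod K"
  have k_eq: "k = j * K + l" and l: "l < K" using K by (auto simp: j_def l_def)
  have block: "(\<Sum>i<j * K. \<alpha> (i div K)) = K * (\<Sum>i<j. \<alpha> i)"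
  proof -
    have "(\<Sum>i<j * K. \<alpha> (i div K)) = (\<Sum>m<j. \<Sum>i\<in>{m * K..<m * K + K}. \<alpha> (i div K))"
      by (rule sum.nat_group[symmetric])
    also have "\<dots> = (\<Sum>m<j. \<Sum>i\<in>{m * K..<m * K + K}. \<alpha> m)"
    proof (intro sum.cong refl)
      fix m i assume "i \<in> {m * K..<m * K + K}"
      then have "i div K = m" by (intro div_nat_eqI) (auto simp: mult.commute)
      then show "\<alpha> (i div K) = \<alpha> m" by simp
    qed
    finally show ?thesis by (simp add: sum_distrib_left)
  qed
  have split: "(\<Sum>i<j * K + r. f i) = (\<Sum>i<j * K. f i) + (\<Sum>i<r. f (j * K + i))" for f :: "nat \<Rightarrow> real" and r
    by (induction r) auto
  have "(\<Sum>i<l. \<alpha> ((j * K + i) div K)) = (\<Sum>i<l. \<alpha> j)"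
  proof (intro sum.cong refl)
    fix i assume "i \<in> {..<l}"
    then have "(j * K + i) div K = j" using l K by simp
    then show "\<alpha> ((j * K + i) div K) = \<alpha> j" by simp
  qed
  then have a: "(\<Sum>i<k. \<alpha> (i div K)) = K * (\<Sum>i<j. \<alpha> i) + l * \<alpha> j"
    unfolding k_eq split block by simp
  show ?thesis
  proof (cases "l = 0")
    case True
    have "j * K \<le> n * K" using k k_eq True by simp
    then have "j \<le> n" using K by simp
    then show ?thesis using nodes[of j] a True k_eq by simp
  next
    case False
    have "j * K < n * K" using k k_eq False by linarith
    then have j: "j < n" by simp
    define P where "P r = (\<Sum>i<r. b (j * K + i))" for r
    have P1: "P l \<ge> l * b (j * K + l)"
    proof -
      have "(\<Sum>i<l. b (j * K + l)) \<le> P l" unfolding P_def by (intro sum_mono anti) auto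
      then show ?thesis by simp
    qed
    have "P K = P l + (\<Sum>i\<in>{l..<K}. b (j * K + i))"
      unfolding P_def using l by (subst sum.union_disjoint[symmetric]) (auto intro!: sum.cong)
    moreover have "(\<Sum>i\<in>{l..<K}. b (j * K + i)) \<le> (\<Sum>i\<in>{l..<K}. b (j * K + l))"
      by (intro sum_mono anti) auto
    ultimately have P2: "P K - P l \<le> (real K - real l) * b (j * K + l)" using l by (simp add: of_nat_diff)
    have conc: "l * P K \<le> K * P l"
    proof -
      have "l * (P K - P l) \<le> l * ((real K - real l) * b (j * K + l))"
        by (rule mult_left_mono[OF P2]) simp
      also have "\<dots> = (real K - real l) * (l * b (j * K + l))" by simp
      also have "\<dots> \<le> (real K - real l) * P l" using P1 l by (intro mult_left_mono) auto
      finally show ?thesis by (simp add: algebra_simps)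
    qed
    let ?S = "\<lambda>j. (\<Sum>i<j. \<alpha> i)" and ?B = "\<lambda>r. (\<Sum>i<r. b i)"
    have n1: "K * ?S j \<le> ?B (j * K)" using nodes[of j] j by simp
    have n2: "K * (?S j + \<alpha> j) \<le> ?B (j * K) + P K"
      using nodes[of "Suc j"] j split[of b K] by (simp add: P_def add.commute)
    have "K * (K * ?S j + l * \<alpha> j) = (real K - real l) * (K * ?S j) + l * (K * (?S j + \<alpha> j))"
      by (simp add: algebra_simps)
    also have "\<dots> \<le> (real K - real l) * ?B (j * K) + l * (?B (j * K) + P K)"
      using n1 n2 l by (intro add_mono mult_left_mono) auto
    also have "\<dots> \<le> K * (?B (j * K) + P l)" using conc by (simp add: algebra_simps)
    finally have "K * ?S j + l * \<alpha> j \<le> ?B (j * K) + P l" using K by simp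
    then show ?thesis unfolding a unfolding k_eq split P_def by simp
  qed
qed


text \<open>The right end point of the half-open dyadic interval containing \<open>t\<close>. It lies strictly to the
  right of \<open>t\<close>, so rearrangements, being right continuous, converge along it.\<close>

definition dyadic_up :: "nat \<Rightarrow> real \<Rightarrow> real" where
  "dyadic_up n t = (real (nat \<lfloor>t * real (2 ^ n)\<rfloor>) + 1) / real (2 ^ n)"

lemma dyadic_up_bounds:
  assumes "0 < t"
  shows "t < dyadic_up n t" "dyadic_up n t \<le> t + 1 / real (2 ^ n)"
proof -
  have "real (nat \<lfloor>t * real (2 ^ n)\<rfloor>) / real (2 ^ n) \<le> t" "t < dyadic_up n t"
    using step_index_eq_iff[of t "2 ^ n" "nat \<lfloor>t * real (2 ^ n)\<rfloor>"] assms by (auto simp: dyadic_up_def)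
  then show "t < dyadic_up n t" "dyadic_up n t \<le> t + 1 / real (2 ^ n)"
    by (simp_all add: dyadic_up_def add_divide_distrib)
qed

lemma dyadic_up_antimono:
  assumes "0 < t"
  shows "dyadic_up (Suc n) t \<le> dyadic_up n t"
proof -
  let ?i = "nat \<lfloor>t * real (2 ^ n)\<rfloor>" and ?m = "nat \<lfloor>t * real (2 ^ Suc n)\<rfloor>"
  have "t < real (Suc ?i) / real (2 ^ n)"
    using dyadic_up_bounds(1)[OF assms, of n] by (simp add: dyadic_up_def add.commute)
  also have "\<dots> = real (2 * Suc ?i) / real (2 ^ Suc n)" by (simp add: field_simps)
  finally have "?m < 2 * Suc ?i"
    using step_index_less_iff[of t "2 ^ Suc n" "2 * Suc ?i"] assms by simp
  then have "(real ?m + 1) / real (2 ^ Suc n) \<le> real (2 * Suc ?i) / real (2 ^ Suc n)"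
    by (intro divide_right_mono) linarith+
  also have "\<dots> = (real ?i + 1) / real (2 ^ n)" by (simp add: field_simps)
  finally show ?thesis by (simp only: dyadic_up_def)
qed

lemma dyadic_up_at_right:
  assumes t: "0 < t"
  shows "filterlim (\<lambda>n. dyadic_up n t) (at_right t) sequentially"
proof -
  have "(\<lambda>n. 1 / real (2 ^ n)) \<longlonglongrightarrow> 0"
    using LIMSEQ_divide_realpow_zero[of 2 1] by simp
  from tendsto_add[OF tendsto_const this, of t]
  have up: "(\<lambda>n. t + 1 / real (2 ^ n)) \<longlonglongrightarrow> t" by simp
  have "(\<lambda>n. dyadic_up n t) \<longlonglongrightarrow> t"
  proof (rule tendsto_sandwich[OF _ _ tendsto_const up])
    show "eventually (\<lambda>n. t \<le> dyadic_up n t) sequentially"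
      by (rule always_eventually) (use dyadic_up_bounds(1)[OF t] in \<open>simp add: less_imp_le\<close>)
    show "eventually (\<lambda>n. dyadic_up n t \<le> t + 1 / real (2 ^ n)) sequentially"
      by (rule always_eventually) (use dyadic_up_bounds(2)[OF t] in simp)
  qed
  moreover have "eventually (\<lambda>n. dyadic_up n t \<in> {t<..} \<and> dyadic_up n t \<noteq> t) sequentially"
    by (rule always_eventually) (use dyadic_up_bounds(1)[OF t] in \<open>auto simp: less_imp_neq[symmetric]\<close>)
  ultimately show ?thesis by (simp add: filterlim_at)
qed

lemma nn_integral_step_prefix:
  assumes n: "0 < n" and j: "j \<le> n" and b: "\<And>i. 0 \<le> b i"
  shows "(\<integral>\<^sup>+t. ennreal (step_fun n b t) * indicator {..<real j / n} t \<partial>leb01) = ennreal ((\<Sum>i<j. b i) / n)"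
proof -
  let ?h = "\<lambda>i. if i < j then ennreal (b i) else 0"
  have "(\<integral>\<^sup>+t. ennreal (step_fun n b t) * indicator {..<real j / n} t \<partial>leb01)
      = (\<integral>\<^sup>+t. ?h (nat \<lfloor>t * real n\<rfloor>) \<partial>leb01)"
    using n by (intro nn_integral_cong) (auto simp: step_fun_def step_index_less_iff space_restrict_space indicator_def)
  also have "\<dots> = ennreal (1 / n) * (\<Sum>i<n. ?h i)" by (rule nn_integral_step[OF n])
  also have "(\<Sum>i<n. ?h i) = (\<Sum>i<j. ennreal (b i))"
    using j by (intro sum.mono_neutral_cong_right) auto
  also have "\<dots> = ennreal (\<Sum>i<j. b i)" using b by (rule sum_ennreal)
  finally show ?thesis using b by (simp add: ennreal_mult[symmetric] sum_nonneg)
qed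

text \<open>Integrals of excesses over levels and integrals over initial intervals are Legendre
  transforms of each other, and the optimal level for the interval \<open>(0, x)\<close> is \<open>g x\<close>.\<close>

lemma prefix_integral_eq_excess:
  fixes g :: "real \<Rightarrow> real"
  assumes g [measurable]: "g \<in> borel_measurable leb01"
    and gx: "0 \<le> g x" and anti: "\<And>t. 0 < t \<Longrightarrow> t < 1 \<Longrightarrow> t < x \<Longrightarrow> g x \<le> g t"
      "\<And>t. 0 < t \<Longrightarrow> t < 1 \<Longrightarrow> x \<le> t \<Longrightarrow> g t \<le> g x"
  shows "(\<integral>\<^sup>+t. ennreal (g t - g x) \<partial>leb01) + ennreal (g x) * (\<integral>\<^sup>+t. indicator {..<x} t \<partial>leb01)
    = (\<integral>\<^sup>+t. ennreal (g t) * indicator {..<x} t \<partial>leb01)"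
proof -
  have [measurable]: "(\<lambda>t. indicator {..<x} t :: ennreal) \<in> borel_measurable leb01"
    by (rule measurable_compose[OF id_measurable_leb01]) simp
  have "(\<integral>\<^sup>+t. ennreal (g t - g x) \<partial>leb01) + ennreal (g x) * (\<integral>\<^sup>+t. indicator {..<x} t \<partial>leb01)
      = (\<integral>\<^sup>+t. ennreal (g t - g x) \<partial>leb01) + (\<integral>\<^sup>+t. ennreal (g x) * indicator {..<x} t \<partial>leb01)"
    by (subst nn_integral_cmult) simp_all
  also have "\<dots> = (\<integral>\<^sup>+t. ennreal (g t - g x) + ennreal (g x) * indicator {..<x} t \<partial>leb01)"
    by (rule nn_integral_add[symmetric]) measurable
  also have "\<dots> = (\<integral>\<^sup>+t. ennreal (g t) * indicator {..<x} t \<partial>leb01)"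
  proof (rule nn_integral_cong)
    fix t assume "t \<in> space leb01"
    then have t: "0 < t" "t < 1" by (auto simp: space_restrict_space)
    show "ennreal (g t - g x) + ennreal (g x) * indicator {..<x} t = ennreal (g t) * indicator {..<x} t"
    proof (cases "t < x")
      case True
      have "ennreal (g t - g x) + ennreal (g x) = ennreal (g t - g x + g x)"
        by (rule ennreal_plus[symmetric]) (use anti(1)[OF t True] gx in simp_all)
      then show ?thesis using True by simp
    next
      case False
      then show ?thesis using anti(2)[OF t] by (simp add: ennreal_neg)
    qed
  qed
  finally show ?thesis .
qed

lemma le_excess_plus_level: "0 \<le> l \<Longrightarrow> ennreal y \<le> ennreal (y - l) + ennreal l"
proof (cases "l \<le> y")
  case True
  assume "0 \<le> l"
  then have "ennreal (y - l) + ennreal l = ennreal (y - l + l)"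
    using True by (intro ennreal_plus[symmetric]) simp_all
  then show ?thesis by simp
next
  case False
  then show ?thesis by (simp add: ennreal_neg ennreal_leI)
qed

text \<open>Any level bounds the integral of \<open>f\<close>; taking the level that is optimal for \<open>g\<close> suffices.\<close>

lemma prefix_integral_le_of_excess:
  fixes f g :: "real \<Rightarrow> real"
  assumes f [measurable]: "f \<in> borel_measurable leb01" and g: "g \<in> borel_measurable leb01"
    and gx: "0 \<le> g x" and anti: "\<And>t. 0 < t \<Longrightarrow> t < 1 \<Longrightarrow> t < x \<Longrightarrow> g x \<le> g t"
      "\<And>t. 0 < t \<Longrightarrow> t < 1 \<Longrightarrow> x \<le> t \<Longrightarrow> g t \<le> g x"
    and le: "\<And>l. 0 \<le> l \<Longrightarrow> (\<integral>\<^sup>+t. ennreal (f t - l) \<partial>leb01) \<le> (\<integral>\<^sup>+t. ennreal (g t - l) \<partial>leb01)"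
  shows "(\<integral>\<^sup>+t. ennreal (f t) * indicator {..<x} t \<partial>leb01) \<le> (\<integral>\<^sup>+t. ennreal (g t) * indicator {..<x} t \<partial>leb01)"
proof -
  have [measurable]: "(\<lambda>t. indicator {..<x} t :: ennreal) \<in> borel_measurable leb01"
    by (rule measurable_compose[OF id_measurable_leb01]) simp
  have "(\<integral>\<^sup>+t. ennreal (f t) * indicator {..<x} t \<partial>leb01)
      \<le> (\<integral>\<^sup>+t. ennreal (f t - g x) + ennreal (g x) * indicator {..<x} t \<partial>leb01)"
    using le_excess_plus_level[OF gx] by (intro nn_integral_mono) (auto simp: indicator_def)
  also have "\<dots> = (\<integral>\<^sup>+t. ennreal (f t - g x) \<partial>leb01) + (\<integral>\<^sup>+t. ennreal (g x) * indicator {..<x} t \<partial>leb01)"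
    by (rule nn_integral_add) measurable
  also have "(\<integral>\<^sup>+t. ennreal (g x) * indicator {..<x} t \<partial>leb01) = ennreal (g x) * (\<integral>\<^sup>+t. indicator {..<x} t \<partial>leb01)"
    by (rule nn_integral_cmult) measurable
  also have "(\<integral>\<^sup>+t. ennreal (f t - g x) \<partial>leb01) + ennreal (g x) * (\<integral>\<^sup>+t. indicator {..<x} t \<partial>leb01)
      \<le> (\<integral>\<^sup>+t. ennreal (g t - g x) \<partial>leb01) + ennreal (g x) * (\<integral>\<^sup>+t. indicator {..<x} t \<partial>leb01)"
    using le[OF gx] by (rule add_right_mono)
  also have "\<dots> = (\<integral>\<^sup>+t. ennreal (g t) * indicator {..<x} t \<partial>leb01)"
    by (rule prefix_integral_eq_excess[OF g gx anti])
  finally show ?thesis .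
qed

lemma ri_norm_increasing_limit:
  assumes ri: "ri_space leb01 N"
    and F: "\<And>n. F n \<in> borel_measurable leb01" and f: "f \<in> borel_measurable leb01"
    and "\<And>x n. 0 < x \<Longrightarrow> x < 1 \<Longrightarrow> 0 \<le> F n x" "\<And>x n. 0 < x \<Longrightarrow> x < 1 \<Longrightarrow> F n x \<le> F (Suc n) x"
    and "\<And>x. 0 < x \<Longrightarrow> x < 1 \<Longrightarrow> (\<lambda>n. F n x) \<longlonglongrightarrow> f x"
  shows "(\<lambda>n. N (F n)) \<longlonglongrightarrow> N f"
proof -
  have "AE x in leb01. (\<forall>n. 0 \<le> F n x \<and> F n x \<le> F (Suc n) x) \<and> (\<lambda>n. F n x) \<longlonglongrightarrow> f x"
    using assms(4-6) by (intro AE_I2) (simp add: space_restrict_space)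
  then show ?thesis
    using ri F f unfolding ri_space_def banach_function_space_def by blast
qed

text \<open>The theorem of Hardy, Littlewood and Polya (Calderon) for functions. Majorization is
  expressed by excesses over levels, which only depend on the distribution. For rearrangements it
  becomes a comparison of prefix integrals. A coarse step function below \<open>f\<^sup>*\<close>, shrunk by a factor
  less than \<open>1\<close>, is majorized by a sufficiently fine step function below \<open>g\<^sup>*\<close>, and the
  Fatou property allows the coarse functions to increase to \<open>f\<^sup>*\<close>.\<close>

proposition ri_norm_majorization:
  assumes ri: "ri_space leb01 N"
    and F: "F \<in> borel_measurable leb01" and G: "G \<in> borel_measurable leb01"
    and le: "\<And>l. 0 \<le> l \<Longrightarrow> (\<integral>\<^sup>+t. ennreal (\<bar>F t\<bar> - l) \<partial>leb01) \<le> (\<integral>\<^sup>+t. ennreal (\<bar>G t\<bar> - l) \<partial>leb01)"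
  shows "N F \<le> N G"
proof -
  interpret L: prob_space leb01 by (rule prob_space_leb01)
  have lq: "lattice_quasinorm leb01 1 N" and inv: "rearrangement_invariant leb01 N"
    using ri by (auto simp: ri_space_def banach_function_space_def)
  define f g where "f = rearrangement leb01 F" and "g = rearrangement leb01 G"
  have fm [measurable]: "f \<in> borel_measurable leb01" and gm [measurable]: "g \<in> borel_measurable leb01"
    unfolding f_def g_def by (rule L.rearrangement_measurable[OF F], rule L.rearrangement_measurable[OF G])
  have f0: "0 \<le> f t" and g0: "0 \<le> g t" if "0 < t" for t
    unfolding f_def g_def
    by (rule L.rearrangement_nonneg[OF F that], rule L.rearrangement_nonneg[OF G that])
  have f_anti: "f t \<le> f s" and g_anti: "g t \<le> g s" if "0 < s" "s \<le> t" for s t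
    unfolding f_def g_def
    by (rule L.rearrangement_antimono[OF F that], rule L.rearrangement_antimono[OF G that])
  have f_lim: "(\<lambda>n. f (dyadic_up n t)) \<longlonglongrightarrow> f t" and g_lim: "(\<lambda>n. g (dyadic_up n t)) \<longlonglongrightarrow> g t"
    if "0 < t" for t
    unfolding f_def g_def
    by (rule filterlim_compose[OF L.rearrangement_right_limit[OF F that] dyadic_up_at_right[OF that]],
        rule filterlim_compose[OF L.rearrangement_right_limit[OF G that] dyadic_up_at_right[OF that]])
  have maj: "(\<integral>\<^sup>+t. ennreal (f t - l) \<partial>leb01) \<le> (\<integral>\<^sup>+t. ennreal (g t - l) \<partial>leb01)" if "0 \<le> l" for l
    using le[OF that] L.nn_integral_rearrangement[OF F, of "\<lambda>y. ennreal (y - l)"]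
      L.nn_integral_rearrangement[OF G, of "\<lambda>y. ennreal (y - l)"] by (simp add: f_def g_def)
  have prefix: "(\<integral>\<^sup>+t. ennreal (f t) * indicator {..<x} t \<partial>leb01)
      \<le> (\<integral>\<^sup>+t. ennreal (g t) * indicator {..<x} t \<partial>leb01)" if "0 < x" for x
    using that g0 g_anti by (intro prefix_integral_le_of_excess[OF fm gm _ _ _ maj]) auto
  define sf where "sf n = step_fun (2 ^ n) (\<lambda>i. f ((real i + 1) / real (2 ^ n)))" for n
  define sg where "sg n = step_fun (2 ^ n) (\<lambda>i. g ((real i + 1) / real (2 ^ n)))" for n
  have sf_eq: "sf n t = f (dyadic_up n t)" and sg_eq: "sg n t = g (dyadic_up n t)" for n t
    by (simp_all only: sf_def sg_def step_fun_def dyadic_up_def)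
  have sfm: "sf n \<in> borel_measurable leb01" and sgm [measurable]: "sg n \<in> borel_measurable leb01" for n
    unfolding sf_def sg_def by (rule step_fun_measurable)+
  \<comment> \<open>The factor makes the prefix integrals of the coarse function strictly smaller than those of
    \<open>f\<close>, unless they vanish, so that those of a sufficiently fine function below \<open>g\<close> exceed them.\<close>
  define fn where "fn n t = (1 - 1 / real (Suc n)) * sf n t" for n t
  have fnm: "fn n \<in> borel_measurable leb01" for n
    unfolding fn_def[abs_def] using sfm by simp
  have "N (fn n) \<le> N g" for n
  proof -
    define c where "c = 1 - 1 / real (Suc n)"
    have c: "0 \<le> c" "c < 1" by (simp_all add: c_def)
    define n0 :: nat where "n0 = 2 ^ n"
    have n0: "0 < n0" by (simp add: n0_def)
    define \<alpha> where "\<alpha> i = c * f ((real i + 1) / n0)" for i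
    define b where "b k i = g ((real i + 1) / real (2 ^ (n + k)))" for k i :: nat
    have b0: "0 \<le> b k i" for k i unfolding b_def by (rule g0) simp
    have fi0: "0 \<le> f ((real i + 1) / n0)" for i by (rule f0) (use n0 in simp)
    have node: "eventually (\<lambda>k. real (2 ^ k) * (\<Sum>i<j. \<alpha> i) \<le> (\<Sum>i<j * 2 ^ k. b k i)) sequentially"
      if j: "j \<le> n0" for j
    proof -
      define S where "S = (\<Sum>i<j. f ((real i + 1) / n0))"
      have S0: "0 \<le> S" unfolding S_def by (intro sum_nonneg fi0)
      have \<alpha>S: "(\<Sum>i<j. \<alpha> i) = c * S" by (simp add: \<alpha>_def S_def sum_distrib_left)
      show ?thesis
      proof (cases "S = 0")
        case True
        then show ?thesis unfolding \<alpha>S by (intro always_eventually) (simp add: sum_nonneg b0)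
      next
        case False
        then have S: "0 < S" using S0 by simp
        have "j \<noteq> 0"
        proof
          assume "j = 0"
          then have "S = 0" by (simp add: S_def)
          then show False using False by simp
        qed
        then have x: "0 < real j / n0" using n0 by simp
        let ?x = "real j / n0"
        have [measurable]: "(\<lambda>t. indicator {..<?x} t :: ennreal) \<in> borel_measurable leb01"
          by (rule measurable_compose[OF id_measurable_leb01]) simp
        have "c * S < 1 * S" using c S by (intro mult_strict_right_mono)
        then have "c * S / n0 < S / n0" using n0 by (simp add: divide_strict_right_mono)
        then have "ennreal (c * S / n0) < ennreal (S / n0)"
          using c S n0 by (subst ennreal_less_iff) auto
        also have "ennreal (S / n0) = (\<integral>\<^sup>+t. ennreal (sf n t) * indicator {..<?x} t \<partial>leb01)"
          using nn_integral_step_prefix[OF n0 j, of "\<lambda>i. f ((real i + 1) / n0)"] fi0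
          by (simp add: sf_def S_def n0_def)
        also have "\<dots> \<le> (\<integral>\<^sup>+t. ennreal (f t) * indicator {..<?x} t \<partial>leb01)"
        proof (intro nn_integral_mono mult_right_mono ennreal_leI)
          fix t assume "t \<in> space leb01"
          then have t: "0 < t" by (simp add: space_restrict_space)
          show "sf n t \<le> f t" unfolding sf_eq
            using dyadic_up_bounds(1)[OF t, of n] by (intro f_anti[OF t]) simp
        qed simp
        also have "\<dots> \<le> (\<integral>\<^sup>+t. ennreal (g t) * indicator {..<?x} t \<partial>leb01)" by (rule prefix[OF x])
        also have "\<dots> = (\<integral>\<^sup>+t. liminf (\<lambda>k. ennreal (sg (n + k) t) * indicator {..<?x} t) \<partial>leb01)"
        proof (rule nn_integral_cong)
          fix t assume "t \<in> space leb01"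
          then have t: "0 < t" by (simp add: space_restrict_space)
          have "(\<lambda>k. sg (n + k) t) \<longlonglongrightarrow> g t"
            unfolding sg_eq using LIMSEQ_ignore_initial_segment[OF g_lim[OF t], of n] by (simp add: add.commute)
          then have "(\<lambda>k. ennreal (sg (n + k) t) * indicator {..<?x} t) \<longlonglongrightarrow> ennreal (g t) * indicator {..<?x} t"
            by (cases "t < ?x") (auto intro!: tendsto_ennrealI)
          then show "ennreal (g t) * indicator {..<?x} t = liminf (\<lambda>k. ennreal (sg (n + k) t) * indicator {..<?x} t)"
            by (intro lim_imp_Liminf[symmetric]) auto
        qed
        also have "\<dots> \<le> liminf (\<lambda>k. \<integral>\<^sup>+t. ennreal (sg (n + k) t) * indicator {..<?x} t \<partial>leb01)"
          by (rule nn_integral_liminf) measurable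
        finally have "eventually (\<lambda>k. ennreal (c * S / n0)
            < (\<integral>\<^sup>+t. ennreal (sg (n + k) t) * indicator {..<?x} t \<partial>leb01)) sequentially"
          by (rule less_LiminfD)
        then show ?thesis
        proof eventually_elim
          case (elim k)
          have M: "2 ^ (n + k) = n0 * 2 ^ k" by (simp add: n0_def power_add)
          have x_eq: "?x = real (j * 2 ^ k) / real (2 ^ (n + k))" using n0 by (simp add: M)
          have "(\<integral>\<^sup>+t. ennreal (sg (n + k) t) * indicator {..<?x} t \<partial>leb01)
              = ennreal ((\<Sum>i<j * 2 ^ k. b k i) / real (2 ^ (n + k)))"
            unfolding x_eq sg_def b_def[symmetric]
            by (rule nn_integral_step_prefix) (use j M b0 n0 in auto)
          with elim have "ennreal (c * S / n0) < ennreal ((\<Sum>i<j * 2 ^ k. b k i) / real (2 ^ (n + k)))"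
            by simp
          then have "c * S / n0 < (\<Sum>i<j * 2 ^ k. b k i) / (real n0 * 2 ^ k)"
            using c S by (subst (asm) ennreal_less_iff) (auto simp: M)
          then have "c * S * 2 ^ k < (\<Sum>i<j * 2 ^ k. b k i)"
            using n0 by (simp add: field_simps)
          then show ?case unfolding \<alpha>S by (simp add: mult.commute)
        qed
      qed
    qed
    have "eventually (\<lambda>k. \<forall>j\<in>{..n0}. real (2 ^ k) * (\<Sum>i<j. \<alpha> i) \<le> (\<Sum>i<j * 2 ^ k. b k i)) sequentially"
      by (rule eventually_ball_finite) (use node in auto)
    then obtain k where k: "\<And>j. j \<le> n0 \<Longrightarrow> real (2 ^ k) * (\<Sum>i<j. \<alpha> i) \<le> (\<Sum>i<j * 2 ^ k. b k i)"
      unfolding eventually_sequentially by auto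
    define K :: nat where "K = 2 ^ k"
    have K: "0 < K" by (simp add: K_def)
    have M: "2 ^ (n + k) = n0 * K" by (simp add: n0_def K_def power_add)
    have M0: "0 < n0 * K" using n0 K by simp
    have b_anti: "b k j \<le> b k i" if "i \<le> j" for i j
      unfolding b_def by (rule g_anti) (use that in \<open>auto simp: divide_right_mono\<close>)
    have fn_eq: "fn n t = step_fun (n0 * K) (\<lambda>i. \<alpha> (i div K)) t" if t: "0 < t" for t
    proof -
      define m where "m = nat \<lfloor>t * real (n0 * K)\<rfloor>"
      have m: "real m / (n0 * K) \<le> t" "t < (real m + 1) / (n0 * K)"
        using step_index_eq_iff[OF t M0, of m] by (auto simp: m_def)
      have "m div K * K \<le> m" by simp
      then have "real (m div K * K) / (n0 * K) \<le> real m / (n0 * K)"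
        by (intro divide_right_mono) (simp_all del: of_nat_mult)
      then have 1: "real (m div K) / n0 \<le> t" using m(1) K by simp
      have "m mod K < K" using K by simp
      then have "Suc m \<le> m div K * K + K" using div_mult_mod_eq[of m K] by linarith
      then have "real (Suc m) \<le> real ((m div K + 1) * K)" unfolding of_nat_le_iff by simp
      then have "(real m + 1) / (n0 * K) \<le> real ((m div K + 1) * K) / (n0 * K)"
        by (intro divide_right_mono) auto
      also have "\<dots> = (real (m div K) + 1) / n0" using K n0 by (simp add: field_simps)
      finally have 2: "t < (real (m div K) + 1) / n0" using m(2) by simp
      have "nat \<lfloor>t * real n0\<rfloor> = m div K" using 1 2 step_index_eq_iff[OF t n0, of "m div K"] by simp
      then show ?thesis
        by (simp add: fn_def sf_def step_fun_def m_def[symmetric] \<alpha>_def c_def n0_def[symmetric] del: of_nat_mult)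
    qed
    have "N (fn n) = N (step_fun (n0 * K) (\<lambda>i. \<alpha> (i div K)))"
      by (rule lattice_quasinorm_cong[OF lq fnm step_fun_measurable]) (rule fn_eq)
    also have "\<dots> \<le> N (step_fun (n0 * K) (b k))"
    proof (rule norm_step_fun_majorization[OF lq inv M0])
      show "0 \<le> \<alpha> (i div K)" for i unfolding \<alpha>_def using c fi0 by simp
      show "\<alpha> (j div K) \<le> \<alpha> (i div K)" if "i \<le> j" for i j
      proof -
        have "(real (i div K) + 1) / n0 \<le> (real (j div K) + 1) / n0"
          using div_le_mono[OF that, of K] by (simp add: divide_right_mono)
        then show ?thesis unfolding \<alpha>_def using c n0
          by (intro mult_left_mono f_anti) auto
      qed
      show "0 \<le> b k i" for i by (rule b0)
      show "(\<Sum>i<l. \<alpha> (i div K)) \<le> (\<Sum>i<l. b k i)" if "l \<le> n0 * K" for l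
        by (rule prefix_sums_le_of_blocks[OF K b_anti _ that]) (use k in \<open>auto simp: K_def\<close>)
    qed
    also have "step_fun (n0 * K) (b k) = sg (n + k)" unfolding sg_def b_def[abs_def] M ..
    also have "N (sg (n + k)) \<le> N g"
    proof (rule lattice_quasinorm_mono[OF lq sgm gm])
      fix x :: real assume x: "0 < x"
      have "sg (n + k) x \<le> g x" unfolding sg_eq
        using dyadic_up_bounds(1)[OF x, of "n + k"] by (intro g_anti[OF x]) simp
      moreover have "0 \<le> sg (n + k) x" unfolding sg_eq
        using dyadic_up_bounds(1)[OF x, of "n + k"] x by (intro g0) simp
      ultimately show "\<bar>sg (n + k) x\<bar> \<le> \<bar>g x\<bar>" by simp
    qed
    finally show ?thesis .
  qed
  moreover have "(\<lambda>n. N (fn n)) \<longlonglongrightarrow> N f"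
  proof (rule ri_norm_increasing_limit[OF ri fnm fm])
    fix x :: real and n :: nat assume x: "0 < x"
    have pos: "0 \<le> sf m x" for m unfolding sf_eq
      using dyadic_up_bounds(1)[OF x, of m] x by (intro f0) simp
    show "0 \<le> fn n x" unfolding fn_def by (intro mult_nonneg_nonneg pos) simp
    have "sf n x \<le> sf (Suc n) x" unfolding sf_eq
      using dyadic_up_bounds(1)[OF x, of "Suc n"] x dyadic_up_antimono[OF x] by (intro f_anti) auto
    moreover have "1 / real (Suc (Suc n)) \<le> 1 / real (Suc n)" by (simp add: field_simps)
    ultimately show "fn n x \<le> fn (Suc n) x" unfolding fn_def using pos by (intro mult_mono) auto
    have "(\<lambda>n. (1 - 1 / real (Suc n)) * sf n x) \<longlonglongrightarrow> (1 - 0) * f x"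
      unfolding sf_eq by (intro tendsto_mult tendsto_diff tendsto_const f_lim x LIMSEQ_Suc lim_1_over_n)
    then show "(\<lambda>n. fn n x) \<longlonglongrightarrow> f x" by (simp add: fn_def)
  qed
  ultimately have "N f \<le> N g" by (intro LIMSEQ_le_const2[of _ "N f"]) auto
  then show ?thesis
    unfolding f_def g_def by (simp add: rearrangement_invariant_norm_eq[OF inv] F G)
qed

section \<open>The gradient modulus and a coarea inequality\<close>

lemma slope_le_lipschitz:
  assumes "L-lipschitz_on UNIV f"
  shows "\<bar>f x - f y\<bar> / dist x y \<le> L"
proof (cases "x = y")
  case True
  then show ?thesis using lipschitz_on_nonneg[OF assms] by simp
next
  case False
  have "dist (f x) (f y) \<le> L * dist x y" by (rule lipschitz_onD[OF assms]) auto
  then show ?thesis using False by (simp add: dist_real_def pos_divide_le_eq)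
qed

lemma ennreal_grad_modulus:
  assumes "f \<in> Lip"
  shows "ennreal (grad_modulus f x) = Limsup (at x) (\<lambda>y. ennreal (\<bar>f x - f y\<bar> / dist x y))"
proof -
  obtain L where L: "L-lipschitz_on UNIV f" using assms by (auto simp: Lip_def)
  have "Limsup (at x) (\<lambda>y. ennreal (\<bar>f x - f y\<bar> / dist x y)) \<le> ennreal L"
    by (intro Limsup_bounded always_eventually allI ennreal_leI slope_le_lipschitz[OF L])
  also have "\<dots> < top" by simp
  finally show ?thesis unfolding grad_modulus_def by (rule ennreal_enn2real)
qed

lemma grad_modulus_nonneg: "0 \<le> grad_modulus f x"
  by (simp add: grad_modulus_def)

lemma grad_modulus_le_lipschitz:
  assumes L: "L-lipschitz_on UNIV f"
  shows "grad_modulus f x \<le> L"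
proof -
  have "f \<in> Lip" using L by (auto simp: Lip_def)
  have "Limsup (at x) (\<lambda>y. ennreal (\<bar>f x - f y\<bar> / dist x y)) \<le> ennreal L"
    by (intro Limsup_bounded always_eventually allI ennreal_leI slope_le_lipschitz[OF L])
  then have "ennreal (grad_modulus f x) \<le> ennreal L"
    unfolding ennreal_grad_modulus[OF \<open>f \<in> Lip\<close>] .
  then show ?thesis
    using ennreal_le_iff[OF lipschitz_on_nonneg[OF L]] by blast
qed

lemma lipschitz_on_mono_dist:
  fixes f g :: "'a::metric_space \<Rightarrow> real"
  assumes L: "L-lipschitz_on UNIV g" and le: "\<And>x y. \<bar>f x - f y\<bar> \<le> \<bar>g x - g y\<bar>"
  shows "L-lipschitz_on UNIV f"
proof (rule lipschitz_onI)
  fix x y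
  have "dist (f x) (f y) \<le> dist (g x) (g y)" using le by (simp add: dist_real_def)
  also have "\<dots> \<le> L * dist x y" by (rule lipschitz_onD[OF L]) auto
  finally show "dist (f x) (f y) \<le> L * dist x y" .
qed (rule lipschitz_on_nonneg[OF L])

lemma grad_modulus_mono:
  assumes g: "g \<in> Lip" and le: "\<And>x y. \<bar>f x - f y\<bar> \<le> \<bar>g x - g y\<bar>"
  shows "grad_modulus f x \<le> grad_modulus g x"
proof -
  obtain L where L: "L-lipschitz_on UNIV g" using g by (auto simp: Lip_def)
  have f: "f \<in> Lip" using lipschitz_on_mono_dist[OF L le] by (auto simp: Lip_def)
  have "ennreal (grad_modulus f x) \<le> ennreal (grad_modulus g x)"
    unfolding ennreal_grad_modulus[OF f] ennreal_grad_modulus[OF g]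
    by (intro Limsup_mono always_eventually allI ennreal_leI divide_right_mono le) simp
  then show ?thesis
    using ennreal_le_iff[OF grad_modulus_nonneg[of g x]] by blast
qed

text \<open>The supremum of the difference quotients over a punctured ball of fixed radius is lower
  semicontinuous in the centre, so the gradient modulus is a countable infimum of such
  functions.\<close>

lemma grad_modulus_measurable:
  fixes f :: "'a::metric_space \<Rightarrow> real"
  assumes f: "continuous_on UNIV f"
  shows "grad_modulus f \<in> borel_measurable borel"
proof -
  define q where "q x y = ennreal (\<bar>f x - f y\<bar> / dist x y)" for x y
  define S where "S n x = (SUP y\<in>{y. y \<noteq> x \<and> dist y x < 1 / real (Suc n)}. q x y)" for n x
  have S: "S n \<in> borel_measurable borel" for n
  proof (rule borel_measurableI_greater)
    fix a
    let ?U = "\<lambda>y. - {y} \<inter> {x. dist y x < 1 / real (Suc n)}"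
    have cont: "continuous_on (- {y}) (\<lambda>x. q x y)" for y
      unfolding q_def
      by (intro continuous_on_ennreal continuous_intros continuous_on_subset[OF f]) auto
    have op: "open (- {y} \<inter> (\<lambda>x. q x y) -` {a<..} \<inter> {x. dist y x < 1 / real (Suc n)})" for y
      by (intro open_Int continuous_open_preimage[OF cont] open_Collect_less continuous_intros) auto
    have "{x \<in> space borel. a < S n x} = (\<Union>y. - {y} \<inter> (\<lambda>x. q x y) -` {a<..} \<inter> {x. dist y x < 1 / real (Suc n)})"
      by (auto simp: S_def less_SUP_iff) metis+
    also have "\<dots> \<in> sets borel"
      by (intro borel_open open_UN ballI op)
    finally show "{x \<in> space borel. a < S n x} \<in> sets borel" .
  qed
  have "Limsup (at x) (\<lambda>y. q x y) = (INF n. S n x)" for x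
  proof (rule antisym)
    show "Limsup (at x) (\<lambda>y. q x y) \<le> (INF n. S n x)"
    proof (rule INF_greatest)
      fix n
      have "eventually (\<lambda>y. y \<noteq> x \<and> dist y x < 1 / real (Suc n)) (at x)"
        unfolding eventually_at by (intro exI[of _ "1 / real (Suc n)"]) auto
      then show "Limsup (at x) (\<lambda>y. q x y) \<le> S n x"
        unfolding Limsup_def S_def by (intro INF_lower) auto
    qed
    show "(INF n. S n x) \<le> Limsup (at x) (\<lambda>y. q x y)"
      unfolding Limsup_def
    proof (rule INF_greatest)
      fix P assume "P \<in> {P. eventually P (at x)}"
      then obtain d where d: "0 < d" "\<And>y. y \<noteq> x \<Longrightarrow> dist y x < d \<Longrightarrow> P y"
        by (auto simp: eventually_at)
      obtain n where n: "1 / real (Suc n) < d" using reals_Archimedean[OF d(1)] by (auto simp: inverse_eq_divide)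
      have "(INF n. S n x) \<le> S n x" by (rule INF_lower) simp
      also have "\<dots> \<le> (SUP y\<in>Collect P. q x y)"
        unfolding S_def using n d(2) by (intro SUP_subset_mono) auto
      finally show "(INF n. S n x) \<le> (SUP y\<in>Collect P. q x y)" .
    qed
  qed
  then have "grad_modulus f = (\<lambda>x. enn2real (INF n. S n x))"
    by (simp add: fun_eq_iff grad_modulus_def q_def)
  then show ?thesis using S by simp
qed

lemma Lip_measurable:
  fixes g :: "'a::metric_space \<Rightarrow> real"
  assumes M: "sets M = sets borel" and g: "g \<in> Lip"
  shows "g \<in> borel_measurable M" "grad_modulus g \<in> borel_measurable M"
proof -
  obtain L where "L-lipschitz_on UNIV g" using g by (auto simp: Lip_def)
  then have "continuous_on UNIV g" by (rule lipschitz_on_continuous_on)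
  then have "g \<in> borel_measurable borel" "grad_modulus g \<in> borel_measurable borel"
    by (rule borel_measurable_continuous_onI, rule grad_modulus_measurable)
  then show "g \<in> borel_measurable M" "grad_modulus g \<in> borel_measurable M"
    using measurable_cong_sets[OF M refl] by blast+
qed

lemma enlargement_iff: "x \<in> enlargement A h \<longleftrightarrow> (\<exists>y\<in>A. dist x y < h)"
proof (cases "A = {}")
  case False
  have "infdist x A < h \<longleftrightarrow> (\<exists>y\<in>A. dist x y < h)"
    using False by (simp add: infdist_notempty cINF_less_iff bdd_belowI[of _ 0])
  then show ?thesis using False by (simp add: enlargement_def)
qed (simp add: enlargement_def)

lemma less_SUP_ball_iff:
  fixes W :: "'a::metric_space \<Rightarrow> real"
  assumes "bounded (range W)" "0 < h"
  shows "s < (SUP y\<in>ball x h. W y) \<longleftrightarrow> x \<in> enlargement {y. s < W y} h"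
proof -
  have bdd: "bdd_above (W ` ball x h)"
    using bounded_imp_bdd_above[OF assms(1)] by (rule bdd_above_mono) auto
  have "s < (SUP y\<in>ball x h. W y) \<longleftrightarrow> (\<exists>y\<in>ball x h. s < W y)"
    using assms(2) by (intro less_cSUP_iff bdd) auto
  also have "\<dots> \<longleftrightarrow> x \<in> enlargement {y. s < W y} h" by (auto simp: enlargement_iff)
  finally show ?thesis .
qed

lemma open_enlargement: "open (enlargement A h)"
proof -
  have "enlargement A h = (if A = {} then {} else {x. infdist x A < h})"
    by (auto simp: enlargement_def)
  then show ?thesis
    by (auto intro!: open_Collect_less continuous_intros)
qed

lemma subset_enlargement: "0 < h \<Longrightarrow> A \<subseteq> enlargement A h"
  by (auto simp: enlargement_def)

text \<open>The inequality of Bobkov and Houdre: half of the coarea formula, with the Minkowski content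
  in place of the perimeter. The superlevel sets of \<open>x \<mapsto> sup {W y | d x y < h}\<close> are the
  enlargements of those of \<open>W\<close>, so by Tonelli the integral over the levels of the difference quotients
  defining the content is the integral of the difference quotients of this function in \<open>h\<close>.
  The limit \<open>h \<rightarrow> 0\<close> is controlled by Fatou's lemma on both sides, with the Lipschitz constant as
  a majorant on the side of the space.\<close>

lemma coarea_bounded:
  fixes M :: "'a::metric_space measure" and W :: "'a \<Rightarrow> real"
  assumes M: "prob_space M" "sets M = sets borel"
    and L: "L-lipschitz_on UNIV W" and bdd: "bounded (range W)"
    and \<kappa>0: "\<And>s. 0 \<le> \<kappa> s"
    and content: "\<And>s. 0 < s \<Longrightarrow> s < \<beta> \<Longrightarrow> ereal (\<kappa> s) \<le> minkowski_content M {x. s < W x}"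
  shows "(\<integral>\<^sup>+s. ennreal (\<kappa> s) * indicator {0<..<\<beta>} s \<partial>lborel) \<le> (\<integral>\<^sup>+x. ennreal (grad_modulus W x) \<partial>M)"
proof -
  interpret prob_space M by (rule M(1))
  note M(2)[measurable_cong]
  have spM: "space M = UNIV" using sets_eq_imp_space_eq[OF M(2)] by simp
  have W_Lip: "W \<in> Lip" using L by (auto simp: Lip_def)
  have W_cont: "continuous_on UNIV W" using L by (rule lipschitz_on_continuous_on)
  have W_meas [measurable]: "W \<in> borel_measurable borel" by (rule borel_measurable_continuous_onI[OF W_cont])
  have L0: "0 \<le> L" by (rule lipschitz_on_nonneg[OF L])
  define h where "h n = 1 / real (Suc n)" for n
  have h: "0 < h n" for n by (simp add: h_def)
  have h_lim: "h \<longlonglongrightarrow> 0" unfolding h_def[abs_def] by (rule LIMSEQ_Suc[OF lim_1_over_n])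
  have h_right: "filterlim h (at_right 0) sequentially"
    using h_lim h by (simp add: filterlim_at less_imp_neq[symmetric])
  \<comment> \<open>\<open>V n\<close> is \<open>W\<close> enlarged by \<open>h n\<close>, and \<open>D n s\<close> is the quotient in the content of \<open>{W > s}\<close>.\<close>
  define V where "V n x = (SUP y\<in>ball x (h n). W y)" for n x
  have V_iff: "s < V n x \<longleftrightarrow> x \<in> enlargement {y. s < W y} (h n)" for s n x
    unfolding V_def by (rule less_SUP_ball_iff[OF bdd h])
  have V_meas [measurable]: "V n \<in> borel_measurable borel" for n
    by (rule borel_measurableI_greater) (simp add: V_iff open_enlargement borel_open)
  have V_ge: "W x \<le> V n x" for n x
  proof (rule ccontr)
    assume "\<not> W x \<le> V n x"
    then have "x \<in> {y. V n x < W y}" by simp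
    then have "x \<in> enlargement {y. V n x < W y} (h n)"
      by (rule subsetD[OF subset_enlargement[OF h]])
    then show False using V_iff[of "V n x" n x] by simp
  qed
  have V_le: "V n x \<le> W x + c * h n"
    if "0 \<le> c" "\<And>y. y \<noteq> x \<Longrightarrow> dist y x < h n \<Longrightarrow> \<bar>W x - W y\<bar> / dist x y \<le> c" for n x c
    unfolding V_def
  proof (rule cSUP_least)
    show "ball x (h n) \<noteq> {}" using h[of n] by simp
    fix y assume "y \<in> ball x (h n)"
    then have y: "dist x y < h n" by simp
    show "W y \<le> W x + c * h n"
    proof (cases "y = x")
      case True
      then show ?thesis using that(1) h[of n] by simp
    next
      case False
      then have "\<bar>W x - W y\<bar> \<le> c * dist x y"
        using that(2)[OF False] y by (simp add: dist_commute pos_divide_le_eq)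
      also have "\<dots> \<le> c * h n" using y that(1) by (intro mult_left_mono) auto
      finally show ?thesis by linarith
    qed
  qed
  define D where "D n s = (measure M (enlargement {x. s < W x} (h n)) - measure M {x. s < W x}) / h n" for n s
  have D_eq: "ennreal (D n s) = (\<integral>\<^sup>+x. indicator {W x..<V n x} s \<partial>M) / ennreal (h n)" for n s
  proof -
    have "measure M (enlargement {x. s < W x} (h n)) - measure M {x. s < W x}
        = measure M (enlargement {x. s < W x} (h n) - {x. s < W x})"
      using subset_enlargement[OF h[of n], of "{x. s < W x}"]
      by (intro finite_measure_Diff[symmetric]) (simp_all add: M(2) open_enlargement borel_open)
    also have "enlargement {x. s < W x} (h n) - {x. s < W x} = {x \<in> space M. W x \<le> s \<and> s < V n x}"
      by (auto simp: V_iff spM)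
    finally have "ennreal (D n s) = emeasure M {x \<in> space M. W x \<le> s \<and> s < V n x} / ennreal (h n)"
      using h[of n] by (simp add: D_def emeasure_eq_measure divide_ennreal)
    also have "emeasure M {x \<in> space M. W x \<le> s \<and> s < V n x}
        = (\<integral>\<^sup>+x. indicator {x \<in> space M. W x \<le> s \<and> s < V n x} x \<partial>M)"
      by (rule nn_integral_indicator[symmetric]) measurable
    also have "\<dots> = (\<integral>\<^sup>+x. indicator {W x..<V n x} s \<partial>M)"
      by (intro nn_integral_cong) (auto simp: indicator_def)
    finally show ?thesis .
  qed
  have D_meas [measurable]: "(\<lambda>s. ennreal (D n s)) \<in> borel_measurable borel" for n
  proof -
    interpret P: pair_sigma_finite M lborel ..
    have "(\<lambda>s. \<integral>\<^sup>+x. (if W x \<le> s \<and> s < V n x then 1 else 0) \<partial>M) \<in> borel_measurable (borel :: real measure)"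
      by measurable
    moreover have "(\<lambda>s. \<integral>\<^sup>+x. (if W x \<le> s \<and> s < V n x then 1 else 0) \<partial>M) = (\<lambda>s. \<integral>\<^sup>+x. indicator {W x..<V n x} s \<partial>M)"
      by (intro ext nn_integral_cong) (auto simp: indicator_def)
    ultimately show ?thesis unfolding D_eq by simp
  qed
  have level: "(\<integral>\<^sup>+s. ennreal (D n s) * indicator {0<..<\<beta>} s \<partial>lborel)
      \<le> (\<integral>\<^sup>+x. ennreal ((V n x - W x) / h n) \<partial>M)" for n
  proof -
    interpret P: pair_sigma_finite M lborel ..
    have "(\<integral>\<^sup>+s. ennreal (D n s) * indicator {0<..<\<beta>} s \<partial>lborel) \<le> (\<integral>\<^sup>+s. ennreal (D n s) \<partial>lborel)"
      by (intro nn_integral_mono) (auto simp: indicator_def)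
    also have "\<dots> = (\<integral>\<^sup>+s. (\<integral>\<^sup>+x. (if W x \<le> s \<and> s < V n x then 1 else 0) \<partial>M) / ennreal (h n) \<partial>lborel)"
      unfolding D_eq by (intro nn_integral_cong arg_cong2[where f="(/)"]) (auto simp: indicator_def)
    also have "\<dots> = (\<integral>\<^sup>+s. (\<integral>\<^sup>+x. (if W x \<le> s \<and> s < V n x then 1 else 0) \<partial>M) \<partial>lborel) / ennreal (h n)"
      by (rule nn_integral_divide) measurable
    also have "(\<integral>\<^sup>+s. (\<integral>\<^sup>+x. (if W x \<le> s \<and> s < V n x then 1 else 0) \<partial>M) \<partial>lborel)
        = (\<integral>\<^sup>+x. (\<integral>\<^sup>+s. (if W x \<le> s \<and> s < V n x then 1 else 0) \<partial>lborel) \<partial>M)"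
      by (rule P.Fubini') measurable
    also have "\<dots> = (\<integral>\<^sup>+x. ennreal (V n x - W x) \<partial>M)"
    proof (rule nn_integral_cong)
      fix x
      have "(\<integral>\<^sup>+s. (if W x \<le> s \<and> s < V n x then 1 else 0) \<partial>lborel) = (\<integral>\<^sup>+s. indicator {W x..<V n x} s \<partial>lborel)"
        by (intro nn_integral_cong) (auto simp: indicator_def)
      then show "(\<integral>\<^sup>+s. (if W x \<le> s \<and> s < V n x then 1 else 0) \<partial>lborel) = ennreal (V n x - W x)"
        using V_ge[of x n] by simp
    qed
    also have "\<dots> / ennreal (h n) = (\<integral>\<^sup>+x. ennreal (V n x - W x) / ennreal (h n) \<partial>M)"
      by (rule nn_integral_divide[symmetric]) measurable
    also have "\<dots> = (\<integral>\<^sup>+x. ennreal ((V n x - W x) / h n) \<partial>M)"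
      using V_ge h by (intro nn_integral_cong) (simp add: divide_ennreal)
    finally show ?thesis .
  qed
  have lower: "ennreal (\<kappa> s) * indicator {0<..<\<beta>} s \<le> liminf (\<lambda>n. ennreal (D n s) * indicator {0<..<\<beta>} s)" for s
  proof (cases "0 < s \<and> s < \<beta>")
    case True
    have "ennreal (\<kappa> s) \<le> liminf (\<lambda>n. ennreal (D n s))"
      unfolding le_Liminf_iff
    proof safe
      fix y assume y: "y < ennreal (\<kappa> s)"
      then have "y < top" by (rule less_trans) simp
      then obtain c where c: "y = ennreal c" "0 \<le> c" by (cases y) auto
      then have "c < \<kappa> s" using y by (simp add: ennreal_less_iff)
      then have "ereal c < ereal (\<kappa> s)" by simp
      also have "\<dots> \<le> minkowski_content M {x. s < W x}"
        using content[of s] True by simp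
      finally have "eventually (\<lambda>h. ereal c < ereal ((measure M (enlargement {x. s < W x} h) - measure M {x. s < W x}) / h)) (at_right 0)"
        unfolding minkowski_content_def by (rule less_LiminfD)
      from eventually_compose_filterlim[OF this h_right]
      have "eventually (\<lambda>n. c < D n s) sequentially" by (simp add: D_def)
      then show "eventually (\<lambda>n. y < ennreal (D n s)) sequentially"
        by eventually_elim (use c in \<open>simp add: ennreal_less_iff\<close>)
    qed
    then show ?thesis using True by simp
  qed simp
  have upper: "limsup (\<lambda>n. ennreal ((V n x - W x) / h n)) \<le> ennreal (grad_modulus W x)" for x
    unfolding Limsup_le_iff
  proof safe
    fix y assume "ennreal (grad_modulus W x) < y"
    then obtain c where c: "ennreal (grad_modulus W x) < c" "c < y" using dense by blast
    then have "c < top" by (meson less_le_trans top_greatest)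
    then obtain r where r: "c = ennreal r" "0 \<le> r" by (cases c) auto
    have "eventually (\<lambda>y. ennreal (\<bar>W x - W y\<bar> / dist x y) < ennreal r) (at x)"
      using c(1) unfolding ennreal_grad_modulus[OF W_Lip] r(1) by (rule Limsup_lessD)
    then obtain d where d: "0 < d" "\<And>y. y \<noteq> x \<Longrightarrow> dist y x < d \<Longrightarrow> \<bar>W x - W y\<bar> / dist x y < r"
      by (auto simp: eventually_at ennreal_less_iff)
    have "eventually (\<lambda>n. h n < d) sequentially"
      using h_lim d(1) by (rule order_tendstoD)
    then show "eventually (\<lambda>n. ennreal ((V n x - W x) / h n) < y) sequentially"
    proof eventually_elim
      case (elim n)
      have "V n x \<le> W x + r * h n"
        using r(2)
      proof (rule V_le)
        fix y assume "y \<noteq> x" "dist y x < h n"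
        then show "\<bar>W x - W y\<bar> / dist x y \<le> r" using d(2)[of y] elim by simp
      qed
      then have "(V n x - W x) / h n \<le> r" using h[of n] by (simp add: pos_divide_le_eq)
      then have "ennreal ((V n x - W x) / h n) \<le> c" unfolding r(1) by (rule ennreal_leI)
      then show ?case using c(2) by (rule le_less_trans)
    qed
  qed
  have "(\<integral>\<^sup>+s. ennreal (\<kappa> s) * indicator {0<..<\<beta>} s \<partial>lborel)
      \<le> (\<integral>\<^sup>+s. liminf (\<lambda>n. ennreal (D n s) * indicator {0<..<\<beta>} s) \<partial>lborel)"
    by (rule nn_integral_mono) (rule lower)
  also have "\<dots> \<le> liminf (\<lambda>n. \<integral>\<^sup>+s. ennreal (D n s) * indicator {0<..<\<beta>} s \<partial>lborel)"
    by (rule nn_integral_liminf) measurable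
  also have "\<dots> \<le> liminf (\<lambda>n. \<integral>\<^sup>+x. ennreal ((V n x - W x) / h n) \<partial>M)"
    by (rule Liminf_mono) (use level in auto)
  also have "\<dots> \<le> limsup (\<lambda>n. \<integral>\<^sup>+x. ennreal ((V n x - W x) / h n) \<partial>M)"
    by (rule Liminf_le_Limsup) simp
  also have "\<dots> \<le> (\<integral>\<^sup>+x. limsup (\<lambda>n. ennreal ((V n x - W x) / h n)) \<partial>M)"
  proof (rule nn_integral_limsup[where w="\<lambda>_. ennreal L"])
    fix n
    show "AE x in M. ennreal ((V n x - W x) / h n) \<le> ennreal L"
    proof (intro AE_I2 ennreal_leI)
      fix x
      have "V n x \<le> W x + L * h n" by (rule V_le[OF L0 slope_le_lipschitz[OF L]])
      then show "(V n x - W x) / h n \<le> L" using h[of n] by (simp add: pos_divide_le_eq)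
    qed
  qed (measurable, simp add: emeasure_space_1)
  also have "\<dots> \<le> (\<integral>\<^sup>+x. ennreal (grad_modulus W x) \<partial>M)"
    by (rule nn_integral_mono) (rule upper)
  finally show ?thesis .
qed

text \<open>Applied to a truncation of \<open>w\<close>, whose gradient modulus vanishes almost everywhere on its two
  extreme level sets, the coarea inequality localizes to a strip of levels.\<close>

lemma coarea_strip:
  fixes M :: "'a::metric_space measure" and w :: "'a \<Rightarrow> real"
  assumes M: "prob_space M" "sets M = sets borel"
    and level: "\<forall>f\<in>Lip. \<forall>c. AE x in M. f x = c \<longrightarrow> grad_modulus f x = 0"
    and w: "w \<in> Lip"
    and \<kappa> [measurable]: "\<kappa> \<in> borel_measurable borel" and \<kappa>0: "\<And>s. 0 \<le> \<kappa> s"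
    and content: "\<And>s. 0 < s \<Longrightarrow> ereal (\<kappa> s) \<le> minkowski_content M {x. s < w x}"
    and ab: "0 \<le> a" "a < b"
  shows "(\<integral>\<^sup>+s. ennreal (\<kappa> s) * indicator {a<..<b} s \<partial>lborel)
    \<le> (\<integral>\<^sup>+x. ennreal (grad_modulus w x) * indicator {a<..<b} (w x) \<partial>M)"
proof -
  define W where "W x = max a (min b (w x)) - a" for x
  have W_le: "\<bar>W x - W y\<bar> \<le> \<bar>w x - w y\<bar>" for x y by (auto simp: W_def min_def max_def)
  obtain L where L: "L-lipschitz_on UNIV w" using w by (auto simp: Lip_def)
  have LW: "L-lipschitz_on UNIV W" by (rule lipschitz_on_mono_dist[OF L W_le])
  then have W: "W \<in> Lip" by (auto simp: Lip_def)
  have bdd: "bounded (range W)"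
    by (rule boundedI[of _ "b - a"]) (use ab in \<open>auto simp: W_def min_def max_def\<close>)
  have "(\<integral>\<^sup>+s. ennreal (\<kappa> s) * indicator {a<..<b} s \<partial>lborel)
      = (\<integral>\<^sup>+s. ennreal (\<kappa> (a + 1 * s)) * indicator {a<..<b} (a + 1 * s) \<partial>lborel)"
    by (subst nn_integral_real_affine[where c=1 and t=a]) auto
  also have "\<dots> = (\<integral>\<^sup>+s. ennreal (\<kappa> (a + s)) * indicator {0<..<b - a} s \<partial>lborel)"
    by (intro nn_integral_cong) (auto simp: indicator_def)
  also have "\<dots> \<le> (\<integral>\<^sup>+x. ennreal (grad_modulus W x) \<partial>M)"
  proof (rule coarea_bounded[OF M LW bdd])
    fix s assume s: "0 < s" "s < b - a"
    then have "{x. s < W x} = {x. a + s < w x}" by (auto simp: W_def min_def max_def)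
    then show "ereal (\<kappa> (a + s)) \<le> minkowski_content M {x. s < W x}"
      using content[of "a + s"] s ab by simp
  qed (rule \<kappa>0)
  also have "\<dots> \<le> (\<integral>\<^sup>+x. ennreal (grad_modulus w x) * indicator {a<..<b} (w x) \<partial>M)"
  proof (rule nn_integral_mono_AE)
    have "AE x in M. W x = 0 \<longrightarrow> grad_modulus W x = 0" "AE x in M. W x = b - a \<longrightarrow> grad_modulus W x = 0"
      using level W by auto
    then show "AE x in M. ennreal (grad_modulus W x) \<le> ennreal (grad_modulus w x) * indicator {a<..<b} (w x)"
    proof eventually_elim
      case (elim x)
      show ?case
      proof (cases "a < w x \<and> w x < b")
        case True
        then show ?thesis using grad_modulus_mono[OF w W_le] by (simp add: ennreal_leI)
      next
        case False
        then have "W x = 0 \<or> W x = b - a" using ab by (auto simp: W_def min_def max_def)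
        then show ?thesis using elim by auto
      qed
    qed
  qed
  finally show ?thesis .
qed

section \<open>Comparison of integrals over levels and over the space\<close>

lemma UN_Ioc_eq_UNIV: "(\<Union>n::nat. {- real n<..real n}) = UNIV"
proof -
  have "\<exists>n::nat. - real n < x \<and> x \<le> real n" for x :: real
  proof -
    obtain n where n: "\<bar>x\<bar> < real n" using reals_Archimedean2[of "\<bar>x\<bar>"] ..
    have "- real n < x" "x \<le> real n" using n by linarith+
    then show ?thesis by (intro exI conjI)
  qed
  then show ?thesis by (simp add: set_eq_iff)
qed

lemma emeasure_Ioc_tendsto:
  fixes M :: "real measure"
  assumes "sets M = sets borel"
  shows "(\<lambda>n::nat. emeasure M {- real n<..real n}) \<longlonglongrightarrow> emeasure M UNIV"
proof -
  have 1: "range (\<lambda>n::nat. {- real n<..real n}) \<subseteq> sets M"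
    unfolding assms by (rule image_subsetI) (rule greaterThanAtMost_borel)
  have 2: "incseq (\<lambda>n::nat. {- real n<..real n})"
  proof (rule incseq_SucI, rule subsetI)
    fix n :: nat and x :: real assume "x \<in> {- real n<..real n}"
    then have "- real n < x" "x \<le> real n" by simp_all
    then show "x \<in> {- real (Suc n)<..real (Suc n)}" by simp
  qed
  have "(\<lambda>n::nat. emeasure M {- real n<..real n}) \<longlonglongrightarrow> emeasure M (\<Union>n. {- real n<..real n})"
    using Lim_emeasure_incseq[OF 1 2] by simp
  then show ?thesis by (simp only: UN_Ioc_eq_UNIV)
qed

text \<open>The defect of the two distribution functions is nondecreasing and right continuous, so it
  is the distribution function of a third measure, which makes up the difference.\<close>

lemma emeasure_le_of_Ioc:
  fixes M1 M2 :: "real measure"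
  assumes "finite_borel_measure M1" "finite_borel_measure M2"
    and le: "\<And>a b. a < b \<Longrightarrow> emeasure M1 {a<..b} \<le> emeasure M2 {a<..b}"
    and B: "B \<in> sets borel"
  shows "emeasure M1 B \<le> emeasure M2 B"
proof -
  interpret M1: finite_borel_measure M1 by fact
  interpret M2: finite_borel_measure M2 by fact
  define F where "F x = cdf M2 x - cdf M1 x" for x
  have le': "measure M1 {a<..b} \<le> measure M2 {a<..b}" if "a < b" for a b
    using le[OF that] by (simp add: M1.emeasure_eq_measure M2.emeasure_eq_measure)
  have F_diff: "F b - F a = measure M2 {a<..b} - measure M1 {a<..b}" if "a < b" for a b
    using M1.cdf_diff_eq[OF that] M2.cdf_diff_eq[OF that] by (simp add: F_def)
  have F_mono: "F x \<le> F y" if "x \<le> y" for x y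
    using F_diff[of x y] le'[of x y] that by (cases "x = y") auto
  have F_cont: "continuous (at_right a) F" for a
    unfolding F_def[abs_def] by (intro continuous_diff M1.cdf_is_right_cont M2.cdf_is_right_cont)
  define M3 where "M3 = interval_measure F"
  have sets3: "sets M3 = sets borel" by (simp add: M3_def)
  let ?P = "\<lambda>A. emeasure M1 A + emeasure M3 A = emeasure M2 A"
  have Ioc: "?P {a<..b}" for a b
  proof (cases "a < b")
    case True
    have "emeasure M3 {a<..b} = ennreal (F b - F a)"
      unfolding M3_def by (rule emeasure_interval_measure_Ioc[OF less_imp_le[OF True] F_mono F_cont])
    then have "emeasure M3 {a<..b} = ennreal (measure M2 {a<..b} - measure M1 {a<..b})"
      by (simp only: F_diff[OF True])
    then have "emeasure M1 {a<..b} + emeasure M3 {a<..b}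
        = ennreal (measure M1 {a<..b}) + ennreal (measure M2 {a<..b} - measure M1 {a<..b})"
      by (simp only: M1.emeasure_eq_measure)
    also have "\<dots> = ennreal (measure M1 {a<..b} + (measure M2 {a<..b} - measure M1 {a<..b}))"
      by (rule ennreal_plus[symmetric]) (use le'[OF True] in simp_all)
    also have "\<dots> = emeasure M2 {a<..b}"
      unfolding M2.emeasure_eq_measure by (rule arg_cong[where f=ennreal]) linarith
    finally show ?thesis .
  next
    case False
    then have "{a<..b} = {}" by (simp add: not_less)
    then show ?thesis by (simp only: emeasure_empty add_0)
  qed
  have UNIV: "?P UNIV"
  proof (rule LIMSEQ_unique)
    note lim = emeasure_Ioc_tendsto
    show "(\<lambda>n. emeasure M1 {- real n<..real n} + emeasure M3 {- real n<..real n}) \<longlonglongrightarrow> emeasure M1 UNIV + emeasure M3 UNIV"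
      by (rule tendsto_add[OF lim[OF M1.M_is_borel] lim[OF sets3]])
    show "(\<lambda>n. emeasure M1 {- real n<..real n} + emeasure M3 {- real n<..real n}) \<longlonglongrightarrow> emeasure M2 UNIV"
      unfolding Ioc by (rule lim[OF M2.M_is_borel])
  qed
  have sb: "sets (borel :: real measure) = sigma_sets UNIV (range (\<lambda>(a, b). {a<..b}))"
    by (subst borel_sigma_sets_Ioc) simp
  have "Int_stable (range (\<lambda>(a, b). {a<..b :: real}))"
    by (auto simp: Int_stable_def Int_greaterThanAtMost)
  moreover have "range (\<lambda>(a, b). {a<..b :: real}) \<subseteq> Pow UNIV" by simp
  moreover have "B \<in> sigma_sets UNIV (range (\<lambda>(a, b). {a<..b}))" using B sb by simp
  ultimately have "?P B"
  proof (induction rule: sigma_sets_induct_disjoint)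
    case (basic A)
    then show ?case using Ioc by auto
  next
    case empty
    show ?case by simp
  next
    case (compl A)
    then have A: "A \<in> sets borel" by (simp add: sb)
    have split: "emeasure M A + emeasure M (UNIV - A) = emeasure M UNIV" if "sets M = sets borel" for M :: "real measure"
      using A that by (subst plus_emeasure) auto
    have "emeasure M2 A + (emeasure M1 (UNIV - A) + emeasure M3 (UNIV - A)) =
        (emeasure M1 A + emeasure M1 (UNIV - A)) + (emeasure M3 A + emeasure M3 (UNIV - A))"
      by (simp add: compl(2)[symmetric] ac_simps)
    also have "\<dots> = emeasure M2 UNIV" using split[OF M1.M_is_borel] split[OF sets3] UNIV by simp
    also have "\<dots> = emeasure M2 A + emeasure M2 (UNIV - A)" using split[OF M2.M_is_borel] by simp
    finally show ?case by (simp add: M2.emeasure_eq_measure[of A] ennreal_add_left_cancel)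
  next
    case (union A)
    then have A: "range A \<subseteq> sets borel" by (simp add: sb)
    have su: "emeasure M (\<Union>i. A i) = (\<Sum>i. emeasure M (A i))" if "sets M = sets borel" for M :: "real measure"
      using A union(1) that by (intro suminf_emeasure[symmetric]) auto
    show ?case using union(3) by (simp add: su[OF M1.M_is_borel] su[OF M2.M_is_borel] su[OF sets3] suminf_add)
  qed
  then show ?thesis by (metis le_iff_add)
qed

text \<open>The hypothesis on strips compares two finite measures on open intervals of levels: the one
  with density \<open>\<kappa>\<close>, and the image under \<open>w\<close> of the measure with density \<open>\<phi>\<close>. As points are null sets
  for the former, half-open intervals may be taken instead, and the comparison extends to all
  Borel sets and to integrals.\<close>

lemma nn_integral_levels_le:
  fixes \<kappa> :: "real \<Rightarrow> real" and p :: "real \<Rightarrow> ennreal"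
  assumes M: "prob_space M" and w [measurable]: "w \<in> borel_measurable M"
    and \<phi> [measurable]: "\<phi> \<in> borel_measurable M" and fin: "(\<integral>\<^sup>+x. ennreal (\<phi> x) \<partial>M) < \<infinity>"
    and \<kappa> [measurable]: "\<kappa> \<in> borel_measurable borel"
    and strip: "\<And>a b. 0 \<le> a \<Longrightarrow> a < b \<Longrightarrow>
      (\<integral>\<^sup>+s. ennreal (\<kappa> s) * indicator {a<..<b} s \<partial>lborel) \<le> (\<integral>\<^sup>+x. ennreal (\<phi> x) * indicator {a<..<b} (w x) \<partial>M)"
    and p [measurable]: "p \<in> borel_measurable borel"
  shows "(\<integral>\<^sup>+s. p s * ennreal (\<kappa> s) * indicator {0<..} s \<partial>lborel) \<le> (\<integral>\<^sup>+x. p (w x) * ennreal (\<phi> x) \<partial>M)"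
proof -
  define M1 where "M1 = density lborel (\<lambda>s. ennreal (\<kappa> s) * indicator {0<..} s)"
  define M2 where "M2 = distr (density M (\<lambda>x. ennreal (\<phi> x))) borel w"
  have s1 [measurable_cong]: "sets M1 = sets borel" and s2 [measurable_cong]: "sets M2 = sets borel"
    by (simp_all add: M1_def M2_def)
  have e1: "emeasure M1 A = (\<integral>\<^sup>+s. ennreal (\<kappa> s) * indicator {0<..} s * indicator A s \<partial>lborel)"
    if "A \<in> sets borel" for A
    unfolding M1_def using that by (subst emeasure_density) auto
  have e2: "emeasure M2 A = (\<integral>\<^sup>+x. ennreal (\<phi> x) * indicator A (w x) \<partial>M)"
    if [measurable]: "A \<in> sets borel" for A
  proof -
    have "emeasure M2 A = emeasure (density M (\<lambda>x. ennreal (\<phi> x))) (w -` A \<inter> space M)"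
      unfolding M2_def by (subst emeasure_distr) auto
    also have "\<dots> = (\<integral>\<^sup>+x. ennreal (\<phi> x) * indicator (w -` A \<inter> space M) x \<partial>M)"
      by (subst emeasure_density) auto
    also have "\<dots> = (\<integral>\<^sup>+x. ennreal (\<phi> x) * indicator A (w x) \<partial>M)"
      by (intro nn_integral_cong) (auto simp: indicator_def)
    finally show ?thesis .
  qed
  have le: "emeasure M1 {a<..b} \<le> emeasure M2 {a<..b}" for a b
  proof (cases "max a 0 < b")
    case True
    have "emeasure M1 {a<..b} = (\<integral>\<^sup>+s. ennreal (\<kappa> s) * indicator {max a 0<..<b} s \<partial>lborel)"
      unfolding e1[OF greaterThanAtMost_borel]
    proof (rule nn_integral_cong_AE)
      show "AE s in lborel. ennreal (\<kappa> s) * indicator {0<..} s * indicator {a<..b} s = ennreal (\<kappa> s) * indicator {max a 0<..<b} s"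
        using AE_lborel_singleton[of b] by eventually_elim (auto simp: indicator_def)
    qed
    also have "\<dots> \<le> (\<integral>\<^sup>+x. ennreal (\<phi> x) * indicator {max a 0<..<b} (w x) \<partial>M)"
      by (rule strip) (use True in auto)
    also have "\<dots> \<le> emeasure M2 {a<..b}"
      unfolding e2[OF greaterThanAtMost_borel] by (intro nn_integral_mono) (auto simp: indicator_def)
    finally show ?thesis .
  next
    case False
    then have "emeasure M1 {a<..b} = (\<integral>\<^sup>+s. 0 \<partial>(lborel :: real measure))"
      unfolding e1[OF greaterThanAtMost_borel] by (intro nn_integral_cong) (auto simp: indicator_def)
    then show ?thesis by simp
  qed
  have fin2: "emeasure M2 UNIV < \<infinity>" using fin e2[of UNIV] by simp
  have "emeasure M1 UNIV \<le> emeasure M2 UNIV"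
  proof (rule LIMSEQ_le_const2)
    show "(\<lambda>n::nat. emeasure M1 {- real n<..real n}) \<longlonglongrightarrow> emeasure M1 UNIV"
      by (rule emeasure_Ioc_tendsto[OF s1])
    show "\<exists>N. \<forall>n\<ge>N. emeasure M1 {- real n<..real n} \<le> emeasure M2 UNIV"
      by (intro exI allI impI order_trans[OF le] emeasure_mono) (auto simp: s2)
  qed
  then have fin1: "emeasure M1 UNIV < \<infinity>" using fin2 by (rule le_less_trans)
  have sp: "space M1 = UNIV" "space M2 = UNIV" by (simp_all add: M1_def M2_def)
  have fb: "finite_borel_measure M1" "finite_borel_measure M2"
    using fin1 fin2 s1 s2 sp
    by (auto simp: finite_borel_measure_def finite_borel_measure_axioms_def intro!: finite_measureI)
  have "M1 \<le> M2"
    using s1 s2 emeasure_le_of_Ioc[OF fb le] by (subst le_measure) auto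
  then have "(\<integral>\<^sup>+s. p s \<partial>M1) \<le> (\<integral>\<^sup>+s. p s \<partial>M2)"
    using s1 s2 by (intro nn_integral_mono_measure) auto
  moreover have "(\<integral>\<^sup>+s. p s \<partial>M1) = (\<integral>\<^sup>+s. p s * ennreal (\<kappa> s) * indicator {0<..} s \<partial>lborel)"
    unfolding M1_def by (subst nn_integral_density) (auto simp: ac_simps)
  moreover have "(\<integral>\<^sup>+s. p s \<partial>M2) = (\<integral>\<^sup>+x. p (w x) * ennreal (\<phi> x) \<partial>M)"
    unfolding M2_def by (simp add: nn_integral_distr nn_integral_density mult.commute)
  ultimately show ?thesis by simp
qed

lemma (in prob_space) dist_fun_measurable:
  assumes "u \<in> borel_measurable M"
  shows "dist_fun M u \<in> borel_measurable borel"
proof -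
  have "mono (\<lambda>s. - dist_fun M u s)" using dist_fun_antimono[OF assms] by (intro monoI) auto
  from borel_measurable_uminus[OF borel_measurable_mono[OF this]] show ?thesis by simp
qed

text \<open>For \<open>s = w\<^sup>* r\<close> the Galois connection shows that \<open>r\<close> lies between the measures of
  \<open>{s < \<bar>w\<bar>}\<close> and of \<open>{s \<le> \<bar>w\<bar>}\<close>, and these agree unless \<open>s\<close> is an atom of the law.\<close>

lemma (in prob_space) dist_fun_of_rearrangement:
  assumes w [measurable]: "w \<in> borel_measurable M" and r: "0 < r" "r < 1"
    and no_atom: "measure M {x \<in> space M. \<bar>w x\<bar> = rearrangement M w r} = 0"
  shows "dist_fun M w (rearrangement M w r) = r"
proof (rule antisym)
  let ?s = "rearrangement M w r"
  have s0: "0 \<le> ?s" by (rule rearrangement_nonneg[OF w r(1)])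
  show "dist_fun M w ?s \<le> r" using less_rearrangement_iff[OF w r(1) s0] by simp
  have "measure M {x \<in> space M. ?s \<le> \<bar>w x\<bar>} = dist_fun M w ?s + measure M {x \<in> space M. \<bar>w x\<bar> = ?s}"
    unfolding dist_fun_def
    by (subst finite_measure_Union[symmetric]) (auto intro!: arg_cong[where f="measure M"])
  then have eq: "measure M {x \<in> space M. ?s \<le> \<bar>w x\<bar>} = dist_fun M w ?s" using no_atom by simp
  show "r \<le> dist_fun M w ?s"
  proof (cases "?s = 0")
    case True
    have "measure M {x \<in> space M. ?s \<le> \<bar>w x\<bar>} = 1" using True by (simp add: prob_space)
    then show ?thesis using eq r by simp
  next
    case False
    then have s: "0 < ?s" using s0 by simp
    let ?\<tau> = "\<lambda>n. ?s - ?s / real (Suc n)"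
    have \<tau>: "0 \<le> ?\<tau> n" "?\<tau> n < ?s" for n using s by (auto simp: field_simps)
    have "(\<lambda>n. measure M {x \<in> space M. ?\<tau> n < \<bar>w x\<bar>}) \<longlonglongrightarrow> measure M (\<Inter>n. {x \<in> space M. ?\<tau> n < \<bar>w x\<bar>})"
    proof (rule finite_Lim_measure_decseq)
      show "decseq (\<lambda>n. {x \<in> space M. ?\<tau> n < \<bar>w x\<bar>})"
      proof (rule decseq_SucI, safe)
        fix n x assume "?\<tau> (Suc n) < \<bar>w x\<bar>"
        moreover have "?s / real (Suc (Suc n)) \<le> ?s / real (Suc n)" using s by (intro divide_left_mono) auto
        ultimately show "?\<tau> n < \<bar>w x\<bar>" by linarith
      qed
    qed auto
    moreover have "(\<Inter>n. {x \<in> space M. ?\<tau> n < \<bar>w x\<bar>}) = {x \<in> space M. ?s \<le> \<bar>w x\<bar>}"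
    proof (intro equalityI subsetI CollectI conjI)
      fix x assume x: "x \<in> (\<Inter>n. {x \<in> space M. ?\<tau> n < \<bar>w x\<bar>})"
      then show "x \<in> space M" by auto
      show "?s \<le> \<bar>w x\<bar>"
      proof (rule ccontr)
        assume "\<not> ?s \<le> \<bar>w x\<bar>"
        then have "0 < (?s - \<bar>w x\<bar>) / ?s" using s by simp
        then obtain n where "1 / real (Suc n) < (?s - \<bar>w x\<bar>) / ?s"
          using reals_Archimedean by (metis inverse_eq_divide)
        then have "?s / real (Suc n) < ?s - \<bar>w x\<bar>" using s by (simp add: field_simps)
        moreover have "?\<tau> n < \<bar>w x\<bar>" using x by blast
        ultimately show False by linarith
      qed
    next
      fix x assume x: "x \<in> {x \<in> space M. ?s \<le> \<bar>w x\<bar>}"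
      have "?\<tau> n < \<bar>w x\<bar>" for n
        using \<tau>(2)[of n] x by simp
      then show "x \<in> (\<Inter>n. {x \<in> space M. ?\<tau> n < \<bar>w x\<bar>})" using x by blast
    qed
    moreover have "measure M {x \<in> space M. ?\<tau> n < \<bar>w x\<bar>} = dist_fun M w (?\<tau> n)" for n
      by (simp only: dist_fun_def)
    ultimately have "(\<lambda>n. dist_fun M w (?\<tau> n)) \<longlonglongrightarrow> dist_fun M w ?s"
      by (simp only: eq)
    moreover have "r \<le> dist_fun M w (?\<tau> n)" for n
      using less_rearrangement_iff[OF w r(1) \<tau>(1)] \<tau>(2)[of n] by (simp add: less_imp_le)
    ultimately show ?thesis by (intro LIMSEQ_le_const) auto
  qed
qed

text \<open>The gradient is split into its excess over \<open>l\<close>, which meets the bound \<open>K\<close> of the weight, and a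
  part bounded by \<open>l\<close>, which meets the integral of the weight. At a level
  \<open>s\<close> that is an atom of the law of \<open>w\<close>, the measure of the superlevel set does not determine a
  position in the unit interval. There are only countably many such levels, and a null set of
  levels does not contribute to the left-hand side.\<close>

lemma (in prob_space) weighted_level_integral_le:
  fixes \<kappa> :: "real \<Rightarrow> real" and k :: "real \<Rightarrow> ennreal"
  assumes w [measurable]: "w \<in> borel_measurable M" and w0: "\<And>x. 0 \<le> w x"
    and \<phi> [measurable]: "\<phi> \<in> borel_measurable M" and fin: "(\<integral>\<^sup>+x. ennreal (\<phi> x) \<partial>M) < \<infinity>"
    and \<kappa>: "\<kappa> \<in> borel_measurable borel"
    and strip: "\<And>a b. 0 \<le> a \<Longrightarrow> a < b \<Longrightarrow>
      (\<integral>\<^sup>+s. ennreal (\<kappa> s) * indicator {a<..<b} s \<partial>lborel) \<le> (\<integral>\<^sup>+x. ennreal (\<phi> x) * indicator {a<..<b} (w x) \<partial>M)"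
    and k [measurable]: "k \<in> borel_measurable borel" and kK: "\<And>r. 0 \<le> r \<Longrightarrow> r \<le> 1 \<Longrightarrow> k r \<le> K"
    and l: "0 \<le> l"
  shows "(\<integral>\<^sup>+s. k (dist_fun M w s) * ennreal (\<kappa> s) * indicator {0<..} s \<partial>lborel)
    \<le> K * (\<integral>\<^sup>+x. ennreal (\<phi> x - l) \<partial>M) + ennreal l * (\<integral>\<^sup>+r. k r \<partial>leb01)"
proof -
  have [measurable]: "dist_fun M w \<in> borel_measurable borel" by (rule dist_fun_measurable[OF w])
  interpret D: prob_space "distr M borel w" by (rule prob_space_distr[OF w])
  define A where "A = {s. measure (distr M borel w) {s} \<noteq> 0}"
  have A: "countable A" unfolding A_def by (rule D.countable_support)
  then have A_null: "A \<in> null_sets lborel" by (rule countable_imp_null_set_lborel)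
  then have [measurable]: "A \<in> sets borel" by auto
  \<comment> \<open>At the points \<open>s = w\<^sup>* r\<close> that are no atoms, this is \<open>k r\<close>.\<close>
  define p where "p s = k (dist_fun M w s) * indicator (- A) s" for s
  have p [measurable]: "p \<in> borel_measurable borel" unfolding p_def[abs_def] by measurable
  have "(\<integral>\<^sup>+s. k (dist_fun M w s) * ennreal (\<kappa> s) * indicator {0<..} s \<partial>lborel)
      = (\<integral>\<^sup>+s. p s * ennreal (\<kappa> s) * indicator {0<..} s \<partial>lborel)"
  proof (rule nn_integral_cong_AE)
    show "AE s in lborel. k (dist_fun M w s) * ennreal (\<kappa> s) * indicator {0<..} s = p s * ennreal (\<kappa> s) * indicator {0<..} s"
      using AE_not_in[OF A_null] by eventually_elim (auto simp: p_def)
  qed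
  also have "\<dots> \<le> (\<integral>\<^sup>+x. p (w x) * ennreal (\<phi> x) \<partial>M)"
    by (rule nn_integral_levels_le[OF prob_space_axioms w \<phi> fin \<kappa> strip p])
  also have "\<dots> \<le> (\<integral>\<^sup>+x. K * ennreal (\<phi> x - l) + ennreal l * p (w x) \<partial>M)"
  proof (rule nn_integral_mono)
    fix x
    have pK: "p (w x) \<le> K"
      using kK[of "dist_fun M w (w x)"] dist_fun_bounds[of w] by (auto simp: p_def indicator_def)
    have "p (w x) * ennreal (\<phi> x) \<le> p (w x) * (ennreal (\<phi> x - l) + ennreal l)"
      by (rule mult_left_mono[OF le_excess_plus_level[OF l]]) simp
    also have "\<dots> = p (w x) * ennreal (\<phi> x - l) + ennreal l * p (w x)"
      by (simp add: distrib_left mult.commute)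
    also have "\<dots> \<le> K * ennreal (\<phi> x - l) + ennreal l * p (w x)"
      by (intro add_right_mono mult_right_mono pK) simp
    finally show "p (w x) * ennreal (\<phi> x) \<le> K * ennreal (\<phi> x - l) + ennreal l * p (w x)" .
  qed
  also have "\<dots> = K * (\<integral>\<^sup>+x. ennreal (\<phi> x - l) \<partial>M) + ennreal l * (\<integral>\<^sup>+x. p (w x) \<partial>M)"
    by (subst nn_integral_add) (auto simp: nn_integral_cmult)
  also have "(\<integral>\<^sup>+x. p (w x) \<partial>M) = (\<integral>\<^sup>+r. p (rearrangement M w r) \<partial>leb01)"
    using nn_integral_rearrangement[OF w p] w0 by simp
  also have "(\<integral>\<^sup>+r. p (rearrangement M w r) \<partial>leb01) \<le> (\<integral>\<^sup>+r. k r \<partial>leb01)"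
  proof (rule nn_integral_mono)
    fix r assume "r \<in> space leb01"
    then have r: "0 < r" "r < 1" by (auto simp: space_restrict_space)
    show "p (rearrangement M w r) \<le> k r"
    proof (cases "rearrangement M w r \<in> A")
      case False
      have "w -` {rearrangement M w r} \<inter> space M = {x \<in> space M. \<bar>w x\<bar> = rearrangement M w r}"
        using w0 by auto
      then have "measure M {x \<in> space M. \<bar>w x\<bar> = rearrangement M w r} = 0"
        using False by (simp add: A_def measure_distr)
      then show ?thesis using dist_fun_of_rearrangement[OF w r] False by (simp add: p_def)
    qed (simp add: p_def)
  qed
  finally show ?thesis by (meson add_left_mono mult_left_mono order_trans zero_le)
qed

section \<open>Isoperimetric estimators\<close>

text \<open>The estimator, continued constantly to the right of \<open>1/2\<close>. On \<open>[0, 1]\<close> it dominates \<open>I\<close>,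
  and unlike \<open>I\<close> it does not degenerate at \<open>1\<close>. To the left of \<open>0\<close> it is continued by \<open>I 0\<close>
  only to be continuous on the whole line.\<close>

definition flat_estimator :: "(real \<Rightarrow> real) \<Rightarrow> real \<Rightarrow> real" where
  "flat_estimator I t = I (max 0 (min t (1/2)))"

lemma estimator_scaling:
  assumes est: "convex_isoperimetric_estimator M I" and st: "0 < s" "s \<le> t" "t \<le> 1/2"
  shows "I s / s \<le> I t / t"
proof -
  have conv: "convex_on {0..1/2} I" and I0: "I 0 = 0"
    using est by (auto simp: convex_isoperimetric_estimator_def)
  have "I ((1 - s / t) *\<^sub>R 0 + (s / t) *\<^sub>R t) \<le> (1 - s / t) * I 0 + (s / t) * I t"
    using st by (intro convex_onD[OF conv]) auto
  then have "I s \<le> (s / t) * I t" using st I0 by simp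
  then show ?thesis using st by (simp add: field_simps)
qed

lemma estimator_mono:
  assumes est: "convex_isoperimetric_estimator M I" and st: "0 \<le> s" "s \<le> t" "t \<le> 1/2"
  shows "I s \<le> I t"
proof -
  have I0: "I 0 = 0" and pos: "0 \<le> I t"
    using est st by (auto simp: convex_isoperimetric_estimator_def)
  show ?thesis
  proof (cases "s = 0")
    case False
    then have s: "0 < s" using st by simp
    then have "I s \<le> s / t * I t"
      using estimator_scaling[OF est s st(2,3)] st by (simp add: field_simps)
    also have "\<dots> \<le> 1 * I t" using st s pos by (intro mult_right_mono) auto
    finally show ?thesis by simp
  qed (use I0 pos in simp)
qed

lemma estimator_pos:
  assumes "convex_isoperimetric_estimator M I" "0 < t" "t < 1"
  shows "0 < I t"
  using assms by (auto simp: convex_isoperimetric_estimator_def)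

lemma flat_estimator_measurable:
  assumes est: "convex_isoperimetric_estimator M I"
  shows "flat_estimator I \<in> borel_measurable borel"
proof -
  have "continuous_on {0..1} I" using est by (simp add: convex_isoperimetric_estimator_def)
  then have "continuous_on UNIV (\<lambda>t. I (max 0 (min t (1/2))))"
    by (rule continuous_on_compose2) (auto intro!: continuous_intros)
  then show ?thesis unfolding flat_estimator_def[abs_def] by (rule borel_measurable_continuous_onI)
qed

lemma flat_estimator_pos:
  assumes "convex_isoperimetric_estimator M I" "0 < t"
  shows "0 < flat_estimator I t"
  unfolding flat_estimator_def using assms(2) by (intro estimator_pos[OF assms(1)]) auto

lemma flat_estimator_nonneg:
  assumes est: "convex_isoperimetric_estimator M I"
  shows "0 \<le> flat_estimator I t"
proof -
  have "max 0 (min t (1/2)) \<in> {0..1}" by auto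
  then show ?thesis using est unfolding flat_estimator_def convex_isoperimetric_estimator_def by blast
qed

lemma flat_estimator_eq: "0 \<le> t \<Longrightarrow> t \<le> 1/2 \<Longrightarrow> flat_estimator I t = I t"
  by (simp add: flat_estimator_def)

lemma flat_estimator_eq_half: "1/2 \<le> t \<Longrightarrow> flat_estimator I t = I (1/2)"
  by (simp add: flat_estimator_def)

lemma estimator_le_flat:
  assumes est: "convex_isoperimetric_estimator M I" and t: "0 \<le> t" "t \<le> 1"
  shows "I t \<le> flat_estimator I t"
proof (cases "t \<le> 1/2")
  case True
  then show ?thesis using t by (simp add: flat_estimator_eq)
next
  case False
  have "I t = I (1 - t)" using est t by (simp add: convex_isoperimetric_estimator_def)
  also have "\<dots> \<le> I (1/2)" using t False by (intro estimator_mono[OF est]) auto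
  finally show ?thesis using False by (simp add: flat_estimator_eq_half)
qed

text \<open>On \<open>[0, 1/2]\<close> convexity makes \<open>J t / t\<close> increasing. To the right of \<open>1/2\<close> it decreases, but only
  from \<open>2 I (1/2)\<close> to \<open>I (1/2)\<close>, which costs the factor \<open>2\<close>.\<close>

lemma flat_estimator_ratio:
  assumes est: "convex_isoperimetric_estimator M I" and tr: "0 < t" "t \<le> r" "r \<le> 1"
  shows "flat_estimator I t / t \<le> 2 * (flat_estimator I r / r)"
proof -
  let ?J = "flat_estimator I"
  have half: "?J s / s \<le> 2 * I (1/2)" if s: "0 < s" for s
  proof (cases "s \<le> 1/2")
    case True
    then show ?thesis using estimator_scaling[OF est s True] s by (simp add: flat_estimator_eq)
  next
    case False
    have "0 < I (1/2)" by (rule estimator_pos[OF est]) auto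
    moreover have "1 \<le> 2 * s" using False by simp
    ultimately have "I (1/2) * 1 \<le> I (1/2) * (2 * s)" by (intro mult_left_mono) auto
    then show ?thesis using False s by (simp add: flat_estimator_eq_half field_simps)
  qed
  show ?thesis
  proof (cases "r \<le> 1/2")
    case True
    have "0 < I r" using tr True by (intro estimator_pos[OF est]) auto
    then have "0 \<le> I r / r" using tr by simp
    moreover have "I t / t \<le> I r / r" by (rule estimator_scaling[OF est tr(1,2) True])
    ultimately have "I t / t \<le> 2 * (I r / r)" by linarith
    then show ?thesis using tr True by (simp add: flat_estimator_eq)
  next
    case False
    have pos: "0 < I (1/2)" by (rule estimator_pos[OF est]) auto
    have "I (1/2) * r \<le> I (1/2) * 1" using pos tr by (intro mult_left_mono) auto
    then have "I (1/2) \<le> I (1/2) / r" using tr by (simp add: pos_le_divide_eq)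
    moreover have "?J r = I (1/2)" using False by (simp add: flat_estimator_eq_half)
    ultimately show ?thesis using half[OF tr(1)] by simp
  qed
qed

text \<open>Small enlargements of \<open>A\<close> do not meet \<open>B\<close>, so joining \<open>B\<close> adds the measure of \<open>B\<close> to \<open>A\<close> and at
  least as much to its enlargements.\<close>

lemma minkowski_content_le_Un:
  fixes M :: "'a::metric_space measure"
  assumes M: "prob_space M" "sets M = sets borel" and A: "A \<in> sets borel" and B: "B \<in> sets borel"
    and h0: "0 < h0" and disj: "\<And>h. h < h0 \<Longrightarrow> enlargement A h \<inter> B = {}" "A \<inter> B = {}"
  shows "minkowski_content M A \<le> minkowski_content M (A \<union> B)"
  unfolding minkowski_content_def
proof (rule Liminf_mono)
  interpret prob_space M by (rule M(1))
  have "eventually (\<lambda>h. 0 < h \<and> h < h0) (at_right (0::real))"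
    unfolding eventually_at_right_field using h0 by (intro exI[of _ h0]) auto
  then show "eventually (\<lambda>h. ereal ((measure M (enlargement A h) - measure M A) / h)
      \<le> ereal ((measure M (enlargement (A \<union> B) h) - measure M (A \<union> B)) / h)) (at_right 0)"
  proof eventually_elim
    case (elim h)
    have oA: "enlargement A h \<in> sets M" and oAB: "enlargement (A \<union> B) h \<in> sets M"
      using M(2) by (simp_all add: open_enlargement borel_open)
    have AM: "A \<in> sets M" "B \<in> sets M" using A B M(2) by auto
    have "enlargement A h \<union> B \<subseteq> enlargement (A \<union> B) h"
    proof
      fix x assume "x \<in> enlargement A h \<union> B"
      then show "x \<in> enlargement (A \<union> B) h"
      proof
        assume "x \<in> enlargement A h"
        then show ?thesis unfolding enlargement_iff by blast
      next
        assume "x \<in> B"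
        then show ?thesis using elim unfolding enlargement_iff by (intro bexI[of _ x]) auto
      qed
    qed
    then have "measure M (enlargement A h \<union> B) \<le> measure M (enlargement (A \<union> B) h)"
      using oAB by (intro finite_measure_mono)
    moreover have "measure M (enlargement A h \<union> B) = measure M (enlargement A h) + measure M B"
      using disj(1) elim oA AM by (intro finite_measure_Union) auto
    moreover have "measure M (A \<union> B) = measure M A + measure M B"
      using disj(2) AM by (intro finite_measure_Union) auto
    ultimately have "measure M (enlargement A h) - measure M A \<le> measure M (enlargement (A \<union> B) h) - measure M (A \<union> B)"
      by linarith
    then show ?case using elim by (simp add: divide_right_mono)
  qed
qed

lemma (in prob_space) median_exists:
  assumes g [measurable]: "g \<in> borel_measurable M"
  obtains m :: real where "measure M {x \<in> space M. m < g x} \<le> 1/2" "measure M {x \<in> space M. g x < m} \<le> 1/2"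
proof -
  let ?D = "distr M borel g"
  interpret D: real_distribution ?D by (rule real_distribution_distr[OF g])
  define S where "S = {x. 1/2 \<le> cdf ?D x}"
  have "eventually (\<lambda>x. 1/2 < cdf ?D x) at_top"
    by (rule order_tendstoD(1)[OF D.cdf_lim_at_top_prob]) simp
  then obtain x1 where "1/2 < cdf ?D x1" by (auto simp: eventually_at_top_linorder)
  then have ne: "S \<noteq> {}" by (auto simp: S_def intro!: exI[of _ x1])
  have "eventually (\<lambda>x. cdf ?D x < 1/2) at_bot"
    by (rule order_tendstoD(2)[OF D.cdf_lim_at_bot]) simp
  then obtain x0 where x0: "\<And>x. x \<le> x0 \<Longrightarrow> cdf ?D x < 1/2" by (auto simp: eventually_at_bot_linorder)
  have bdd: "bdd_below S"
  proof (rule bdd_belowI)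
    fix x assume "x \<in> S"
    then show "x0 \<le> x" using x0[of x] by (cases "x \<le> x0") (auto simp: S_def)
  qed
  define m where "m = Inf S"
  have above: "1/2 \<le> cdf ?D t" if t: "m < t" for t
  proof -
    obtain s where "s \<in> S" "s < t" using cInf_lessD[OF ne, of t] t unfolding m_def by blast
    then show ?thesis using D.cdf_nondecreasing[of s t] by (simp add: S_def)
  qed
  have below: "cdf ?D t \<le> 1/2" if t: "t < m" for t
    using cInf_lower[OF _ bdd, of t] t unfolding m_def S_def by fastforce
  show ?thesis
  proof (rule that[of m])
    have "(cdf ?D \<longlongrightarrow> cdf ?D m) (at_right m)"
      using D.cdf_is_right_cont[of m] by (simp add: continuous_within)
    moreover have "eventually (\<lambda>t. 1/2 \<le> cdf ?D t) (at_right m)"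
      using eventually_at_right_less by (rule eventually_mono) (rule above)
    ultimately have "1/2 \<le> cdf ?D m" by (rule tendsto_lowerbound) simp
    also have "cdf ?D m = measure M (space M - {x \<in> space M. m < g x})"
      unfolding cdf_def by (subst measure_distr) (auto intro!: arg_cong[where f="measure M"])
    also have "\<dots> = 1 - measure M {x \<in> space M. m < g x}" by (rule prob_compl) measurable
    finally show "measure M {x \<in> space M. m < g x} \<le> 1/2" by simp
    have "eventually (\<lambda>t. t < m) (at_left m)" by (simp add: eventually_at_filter)
    then have "eventually (\<lambda>t. cdf ?D t \<le> 1/2) (at_left m)" by (rule eventually_mono) (rule below)
    with D.cdf_at_left have "measure ?D {..<m} \<le> 1/2" by (rule tendsto_upperbound) simp
    also have "measure ?D {..<m} = measure M {x \<in> space M. g x < m}"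
      by (subst measure_distr) (auto intro!: arg_cong[where f="measure M"])
    finally show "measure M {x \<in> space M. g x < m} \<le> 1/2" .
  qed
qed

text \<open>For levels whose superlevel set occupies at most half of the space, the claim is the
  isoperimetric inequality. Otherwise one of the two parts, above and below
  the median, has measure between \<open>1/4\<close> and \<open>1/2\<close>; being at a positive distance from the other
  part, it does not have more content than the whole superlevel set.\<close>

lemma median_content_lower_bound:
  fixes M :: "'a::metric_space measure" and g :: "'a \<Rightarrow> real"
  assumes M: "prob_space M" "sets M = sets borel" and est: "convex_isoperimetric_estimator M I"
    and g: "g \<in> Lip"
    and med: "measure M {x. m < g x} \<le> 1/2" "measure M {x. g x < m} \<le> 1/2"
    and s: "0 < s"
  shows "ereal (I (1/4) / I (1/2) * flat_estimator I (measure M {x. s < \<bar>g x - m\<bar>}))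
    \<le> minkowski_content M {x. s < \<bar>g x - m\<bar>}"
proof -
  interpret prob_space M by (rule M(1))
  obtain L where L: "L-lipschitz_on UNIV g" using g by (auto simp: Lip_def)
  have L0: "0 \<le> L" by (rule lipschitz_on_nonneg[OF L])
  have cont: "continuous_on UNIV g" using L by (rule lipschitz_on_continuous_on)
  define P Q where "P = {x. m + s < g x}" and "Q = {x. g x < m - s}"
  have oP: "open P" and oQ: "open Q"
    unfolding P_def Q_def by (intro open_Collect_less cont continuous_intros)+
  have PQ: "{x. s < \<bar>g x - m\<bar>} = P \<union> Q" unfolding P_def Q_def by auto
  have disj: "P \<inter> Q = {}" using s by (auto simp: P_def Q_def)
  have sets: "P \<in> sets borel" "Q \<in> sets borel" using oP oQ by auto
  have setsM: "P \<in> sets M" "Q \<in> sets M" using sets M(2) by auto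
  have iso: "ereal (I (measure M A)) \<le> minkowski_content M A" if "A \<in> sets borel" for A
    using est that by (simp add: convex_isoperimetric_estimator_def)
  have I4: "0 < I (1/4)" "0 < I (1/2)" by (intro estimator_pos[OF est]; simp)+
  have I42: "I (1/4) \<le> I (1/2)" by (rule estimator_mono[OF est]) auto
  \<comment> \<open>The radius is taken with \<open>L + 1\<close> instead of \<open>L\<close>, as \<open>L\<close> may vanish.\<close>
  have gap: "\<bar>g x - g y\<bar> < 2 * s" if "dist x y < 2 * s / (L + 1)" for x y
  proof -
    have "\<bar>g x - g y\<bar> \<le> L * dist x y" using lipschitz_onD[OF L, of x y] by (simp add: dist_real_def)
    also have "\<dots> \<le> (L + 1) * dist x y" by (intro mult_right_mono) auto
    also have "\<dots> < 2 * s" using that L0 by (simp add: field_simps)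
    finally show ?thesis .
  qed
  have h0: "0 < 2 * s / (L + 1)" using s L0 by simp
  let ?\<nu> = "measure M {x. s < \<bar>g x - m\<bar>}"
  show ?thesis
  proof (cases "?\<nu> \<le> 1/2")
    case True
    have "0 \<le> I ?\<nu>" using est True by (simp add: convex_isoperimetric_estimator_def)
    then have "I (1/4) / I (1/2) * I ?\<nu> \<le> 1 * I ?\<nu>"
      using I4 I42 by (intro mult_right_mono) auto
    then have "ereal (I (1/4) / I (1/2) * flat_estimator I ?\<nu>) \<le> ereal (I ?\<nu>)"
      using True by (simp add: flat_estimator_eq)
    also have "\<dots> \<le> minkowski_content M {x. s < \<bar>g x - m\<bar>}"
      using sets unfolding PQ by (intro iso) auto
    finally show ?thesis .
  next
    case False
    then have eq: "I (1/4) / I (1/2) * flat_estimator I ?\<nu> = I (1/4)"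
      using I4 by (simp add: flat_estimator_eq_half)
    have part: "ereal (I (1/4)) \<le> minkowski_content M (A \<union> B)"
      if "1/4 \<le> measure M A" "measure M A \<le> 1/2" "A \<in> sets borel" "B \<in> sets borel" "A \<inter> B = {}"
        and "\<And>x y. x \<in> B \<Longrightarrow> y \<in> A \<Longrightarrow> 2 * s < \<bar>g x - g y\<bar>" for A B
    proof -
      have "ereal (I (1/4)) \<le> ereal (I (measure M A))"
        using that(1,2) by (simp add: estimator_mono[OF est])
      also have "\<dots> \<le> minkowski_content M A" by (rule iso[OF that(3)])
      also have "\<dots> \<le> minkowski_content M (A \<union> B)"
      proof (rule minkowski_content_le_Un[OF M that(3,4) h0 _ that(5)])
        fix h assume h: "h < 2 * s / (L + 1)"
        show "enlargement A h \<inter> B = {}"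
        proof (rule ccontr)
          assume "enlargement A h \<inter> B \<noteq> {}"
          then obtain x y where "x \<in> B" "y \<in> A" "dist x y < h" by (auto simp: enlargement_iff)
          then show False using gap[of x y] that(6)[of x y] h by linarith
        qed
      qed
      finally show ?thesis .
    qed
    have "measure M (P \<union> Q) = measure M P + measure M Q"
      by (rule finite_measure_Union[OF setsM disj])
    then have "1/2 < measure M P + measure M Q" using False unfolding PQ by simp
    then consider "1/4 \<le> measure M P" | "1/4 \<le> measure M Q" by linarith
    then show ?thesis
    proof cases
      case 1
      have "measure M P \<le> measure M {x. m < g x}"
      proof (rule finite_measure_mono)
        show "P \<subseteq> {x. m < g x}" using s by (auto simp: P_def)
        have "open {x. m < g x}" by (intro open_Collect_less cont continuous_intros)
        then show "{x. m < g x} \<in> sets M" using M(2) by auto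
      qed
      then have "measure M P \<le> 1/2" using med by simp
      then show ?thesis unfolding eq unfolding PQ
        using 1 sets disj by (intro part) (auto simp: P_def Q_def)
    next
      case 2
      have "measure M Q \<le> measure M {x. g x < m}"
      proof (rule finite_measure_mono)
        show "Q \<subseteq> {x. g x < m}" using s by (auto simp: Q_def)
        have "open {x. g x < m}" by (intro open_Collect_less cont continuous_intros)
        then show "{x. g x < m} \<in> sets M" using M(2) by auto
      qed
      then have le: "measure M Q \<le> 1/2" using med by simp
      have "ereal (I (1/4)) \<le> minkowski_content M (Q \<union> P)"
        using 2 le sets disj by (intro part) (auto simp: P_def Q_def)
      then show ?thesis unfolding eq unfolding PQ by (simp only: Un_commute)
    qed
  qed
qed

section \<open>Norm estimates for weighted rearrangements\<close>

text \<open>For \<open>E = {F > l}\<close> the integral over \<open>E\<close> is the excess over \<open>l\<close> plus \<open>l\<close> times the measure of \<open>E\<close>,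
  so bounds for integrals over sets imply majorization.\<close>

lemma ri_norm_le_of_set_integrals:
  assumes ri: "ri_space leb01 N"
    and F [measurable]: "F \<in> borel_measurable leb01" and G [measurable]: "G \<in> borel_measurable leb01"
    and F0: "\<And>t. 0 < t \<Longrightarrow> t < 1 \<Longrightarrow> 0 \<le> F t" and C: "0 < C"
    and le: "\<And>E l. E \<in> sets leb01 \<Longrightarrow> 0 \<le> l \<Longrightarrow> (\<integral>\<^sup>+t. ennreal (F t) * indicator E t \<partial>leb01)
      \<le> ennreal C * ((\<integral>\<^sup>+t. ennreal (G t - l) \<partial>leb01) + ennreal l * emeasure leb01 E)"
  shows "N F \<le> ennreal C * N G"
proof -
  interpret L: prob_space leb01 by (rule prob_space_leb01)
  have lq: "lattice_quasinorm leb01 1 N"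
    using ri by (auto simp: ri_space_def banach_function_space_def)
  have "N F \<le> N (\<lambda>t. C * G t)"
  proof (rule ri_norm_majorization[OF ri F])
    show "(\<lambda>t. C * G t) \<in> borel_measurable leb01" by measurable
    fix l :: real assume l: "0 \<le> l"
    define E where "E = {t \<in> space leb01. l < F t}"
    have E [measurable]: "E \<in> sets leb01" unfolding E_def by measurable
    have "(\<integral>\<^sup>+t. ennreal (\<bar>F t\<bar> - l) \<partial>leb01) + ennreal l * emeasure leb01 E
        = (\<integral>\<^sup>+t. ennreal (\<bar>F t\<bar> - l) \<partial>leb01) + (\<integral>\<^sup>+t. ennreal l * indicator E t \<partial>leb01)"
      by (simp add: nn_integral_cmult_indicator)
    also have "\<dots> = (\<integral>\<^sup>+t. ennreal (\<bar>F t\<bar> - l) + ennreal l * indicator E t \<partial>leb01)"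
      by (rule nn_integral_add[symmetric]) measurable
    also have "\<dots> = (\<integral>\<^sup>+t. ennreal (F t) * indicator E t \<partial>leb01)"
    proof (rule nn_integral_cong)
      fix t assume t: "t \<in> space leb01"
      then have "0 \<le> F t" using F0 by (simp add: space_restrict_space)
      then have abs: "\<bar>F t\<bar> = F t" by simp
      show "ennreal (\<bar>F t\<bar> - l) + ennreal l * indicator E t = ennreal (F t) * indicator E t"
      proof (cases "l < F t")
        case True
        have "ennreal (F t - l) + ennreal l = ennreal (F t - l + l)"
          by (rule ennreal_plus[symmetric]) (use True l in simp_all)
        then show ?thesis using True t by (simp add: abs E_def)
      next
        case False
        then show ?thesis by (simp add: abs E_def ennreal_neg)
      qed
    qed
    also have "\<dots> \<le> ennreal C * ((\<integral>\<^sup>+t. ennreal (G t - l / C) \<partial>leb01) + ennreal (l / C) * emeasure leb01 E)"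
      using l C by (intro le E) simp
    also have "\<dots> = (\<integral>\<^sup>+t. ennreal C * ennreal (G t - l / C) \<partial>leb01) + ennreal l * emeasure leb01 E"
      using l C by (simp add: distrib_left nn_integral_cmult mult.assoc[symmetric] ennreal_mult[symmetric])
    also have "(\<integral>\<^sup>+t. ennreal C * ennreal (G t - l / C) \<partial>leb01) = (\<integral>\<^sup>+t. ennreal (C * G t - l) \<partial>leb01)"
      using C by (intro nn_integral_cong) (simp add: ennreal_mult'[symmetric] right_diff_distrib)
    also have "\<dots> \<le> (\<integral>\<^sup>+t. ennreal (\<bar>C * G t\<bar> - l) \<partial>leb01)"
      by (intro nn_integral_mono ennreal_leI) simp
    finally have "(\<integral>\<^sup>+t. ennreal (\<bar>F t\<bar> - l) \<partial>leb01) + ennreal l * emeasure leb01 E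
        \<le> (\<integral>\<^sup>+t. ennreal (\<bar>C * G t\<bar> - l) \<partial>leb01) + ennreal l * emeasure leb01 E"
      by (simp add: add_right_mono)
    moreover have "ennreal l * emeasure leb01 E \<noteq> \<infinity>"
      by (simp add: L.emeasure_eq_measure ennreal_mult_eq_top_iff)
    ultimately show "(\<integral>\<^sup>+t. ennreal (\<bar>F t\<bar> - l) \<partial>leb01) \<le> (\<integral>\<^sup>+t. ennreal (\<bar>C * G t\<bar> - l) \<partial>leb01)"
      by (simp add: add.commute[of _ "ennreal l * emeasure leb01 E"] ennreal_add_left_cancel_le)
  qed
  also have "\<dots> = ennreal C * N G" using C by (simp add: lattice_quasinorm_cmult[OF lq G])
  finally show ?thesis .
qed

definition initial_mass :: "(real \<Rightarrow> real) \<Rightarrow> real set \<Rightarrow> real \<Rightarrow> ennreal" where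
  "initial_mass v E r = (\<integral>\<^sup>+t. (if t < r then ennreal (v t) * indicator E t else 0) \<partial>leb01)"

lemma initial_mass_measurable:
  assumes v: "v \<in> borel_measurable borel" and E [measurable]: "E \<in> sets leb01"
  shows "initial_mass v E \<in> borel_measurable borel"
proof -
  interpret L: prob_space leb01 by (rule prob_space_leb01)
  have [measurable]: "(\<lambda>t::real. t) \<in> borel_measurable leb01" by (rule id_measurable_leb01)
  have [measurable]: "v \<in> borel_measurable leb01" by (rule measurable_compose[OF id_measurable_leb01 v])
  show ?thesis unfolding initial_mass_def[abs_def] by measurable
qed

text \<open>By the layer cake formula, since a level \<open>s\<close> lies below \<open>w\<^sup>* t\<close> iff \<open>t\<close> lies below the measure
  of the superlevel set at \<open>s\<close>.\<close>

lemma (in prob_space) weighted_rearrangement_integral: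
  assumes w: "w \<in> borel_measurable M" and v [measurable]: "v \<in> borel_measurable borel"
    and v0: "\<And>t. 0 < t \<Longrightarrow> t < 1 \<Longrightarrow> 0 \<le> v t" and E [measurable]: "E \<in> sets leb01"
  shows "(\<integral>\<^sup>+t. ennreal (rearrangement M w t * v t) * indicator E t \<partial>leb01)
    = (\<integral>\<^sup>+s. initial_mass v E (dist_fun M w s) * indicator {0<..} s \<partial>lborel)"
proof -
  interpret L: prob_space leb01 by (rule prob_space_leb01)
  interpret P: pair_sigma_finite lborel leb01 ..
  have [measurable]: "(\<lambda>t::real. t) \<in> borel_measurable leb01" by (rule id_measurable_leb01)
  have [measurable]: "v \<in> borel_measurable leb01" by (rule measurable_compose[OF id_measurable_leb01 v])
  have \<nu> [measurable]: "dist_fun M w \<in> borel_measurable borel" by (rule dist_fun_measurable[OF w])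
  let ?\<nu> = "dist_fun M w"
  let ?K = "\<lambda>s t. (if 0 < s \<and> t < ?\<nu> s then ennreal (v t) * indicator E t else 0)"
  have "(\<integral>\<^sup>+t. ennreal (rearrangement M w t * v t) * indicator E t \<partial>leb01)
      = (\<integral>\<^sup>+t. (\<integral>\<^sup>+s. ?K s t \<partial>lborel) \<partial>leb01)"
  proof (rule nn_integral_cong)
    fix t assume "t \<in> space leb01"
    then have t: "0 < t" "t < 1" by (auto simp: space_restrict_space)
    have "?K s t = ennreal (v t) * indicator E t * indicator {0<..<rearrangement M w t} s" for s
      using less_rearrangement_iff[OF w t(1), of s] by (simp add: indicator_def)
    then have "(\<integral>\<^sup>+s. ?K s t \<partial>lborel) = ennreal (v t) * indicator E t * ennreal (rearrangement M w t)"
      using rearrangement_nonneg[OF w t(1)] by (simp add: nn_integral_cmult_indicator)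
    also have "\<dots> = ennreal (rearrangement M w t * v t) * indicator E t"
      using rearrangement_nonneg[OF w t(1)] v0[OF t] by (simp add: ennreal_mult ac_simps)
    finally show "ennreal (rearrangement M w t * v t) * indicator E t = (\<integral>\<^sup>+s. ?K s t \<partial>lborel)" ..
  qed
  also have "\<dots> = (\<integral>\<^sup>+s. (\<integral>\<^sup>+t. ?K s t \<partial>leb01) \<partial>lborel)"
    by (rule P.Fubini') measurable
  also have "\<dots> = (\<integral>\<^sup>+s. initial_mass v E (?\<nu> s) * indicator {0<..} s \<partial>lborel)"
    by (intro nn_integral_cong) (auto simp: initial_mass_def indicator_def)
  finally show ?thesis .
qed

lemma initial_mass_zero: "initial_mass v E 0 = 0"
proof -
  have "initial_mass v E 0 = (\<integral>\<^sup>+t. 0 \<partial>leb01)"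
    unfolding initial_mass_def by (intro nn_integral_cong) (auto simp: space_restrict_space)
  then show ?thesis by simp
qed

lemma emeasure_leb01_initial:
  assumes "0 \<le> r" "r \<le> 1"
  shows "(\<integral>\<^sup>+t. indicator {..<r} t \<partial>leb01) = ennreal r"
proof -
  have "(\<integral>\<^sup>+t. indicator {..<r} t \<partial>leb01) = (\<integral>\<^sup>+t. indicator {..<r} t * indicator {0<..<1} t \<partial>lborel)"
    by (rule nn_integral_leb01) simp
  also have "\<dots> = (\<integral>\<^sup>+t. indicator {0<..<r} t \<partial>lborel)"
    using assms by (intro nn_integral_cong) (auto simp: indicator_def)
  finally show ?thesis using assms by simp
qed

text \<open>To the left of \<open>r\<close> the weight is at most \<open>2 J r / r\<close>, and this part of \<open>E\<close> is neither longer than \<open>r\<close>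
  nor longer than \<open>E\<close>.\<close>

lemma initial_mass_le:
  assumes J: "\<And>t. 0 < t \<Longrightarrow> 0 < J t"
    and ratio: "\<And>t r. 0 < t \<Longrightarrow> t \<le> r \<Longrightarrow> r \<le> 1 \<Longrightarrow> J t / t \<le> 2 * (J r / r)"
    and E [measurable]: "E \<in> sets leb01" and r: "0 < r" "r \<le> 1"
  shows "initial_mass (\<lambda>t. J t / t) E r \<le> ennreal (2 * (J r / r)) * min (ennreal r) (emeasure leb01 E)"
proof -
  have J0: "0 \<le> 2 * (J r / r)" using J[of r] r by simp
  have [measurable]: "(\<lambda>t. indicator {..<r} t :: ennreal) \<in> borel_measurable leb01"
    by (rule measurable_compose[OF id_measurable_leb01]) simp
  have pt: "(if t < r then ennreal (J t / t) * indicator E t else 0) \<le> ennreal (2 * (J r / r)) * (indicator {..<r} t * indicator E t)"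
    if "t \<in> space leb01" for t
  proof (cases "t < r \<and> t \<in> E")
    case True
    have "ennreal (J t / t) \<le> ennreal (2 * (J r / r))"
      using True that r by (intro ennreal_leI ratio) (auto simp: space_restrict_space)
    then show ?thesis using True by simp
  qed auto
  have "initial_mass (\<lambda>t. J t / t) E r \<le> (\<integral>\<^sup>+t. ennreal (2 * (J r / r)) * (indicator {..<r} t * indicator E t) \<partial>leb01)"
    unfolding initial_mass_def by (rule nn_integral_mono) (rule pt)
  also have "\<dots> = ennreal (2 * (J r / r)) * (\<integral>\<^sup>+t. indicator {..<r} t * indicator E t \<partial>leb01)"
    by (rule nn_integral_cmult) measurable
  also have "(\<integral>\<^sup>+t. indicator {..<r} t * indicator E t \<partial>leb01) \<le> min (ennreal r) (emeasure leb01 E)"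
  proof (rule min.boundedI)
    have "(\<integral>\<^sup>+t. indicator {..<r} t * indicator E t \<partial>leb01) \<le> (\<integral>\<^sup>+t. indicator {..<r} t \<partial>leb01)"
      by (intro nn_integral_mono) (auto simp: indicator_def)
    then show "(\<integral>\<^sup>+t. indicator {..<r} t * indicator E t \<partial>leb01) \<le> ennreal r"
      using r by (simp add: emeasure_leb01_initial)
    have "(\<integral>\<^sup>+t. indicator {..<r} t * indicator E t \<partial>leb01) \<le> (\<integral>\<^sup>+t. indicator E t \<partial>leb01)"
      by (intro nn_integral_mono) (auto simp: indicator_def)
    then show "(\<integral>\<^sup>+t. indicator {..<r} t * indicator E t \<partial>leb01) \<le> emeasure leb01 E" by simp
  qed
  finally show ?thesis by (simp add: mult_left_mono)
qed

text \<open>The situation that the coarea inequality creates: \<open>\<phi>\<close> plays the role of \<open>\<bar>\<nabla>w\<bar>\<close>, and \<open>c\<^sub>0 J\<close> bounds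
  the perimeter of a superlevel set from below in terms of its measure.\<close>

locale level_gradient = prob_space M for M :: "'a measure" +
  fixes w \<phi> :: "'a \<Rightarrow> real" and J :: "real \<Rightarrow> real" and c\<^sub>0 :: real
  assumes w: "w \<in> borel_measurable M" and w0: "\<And>x. 0 \<le> w x"
    and \<phi>: "\<phi> \<in> borel_measurable M" and \<phi>0: "\<And>x. 0 \<le> \<phi> x" and fin: "(\<integral>\<^sup>+x. ennreal (\<phi> x) \<partial>M) < \<infinity>"
    and J: "J \<in> borel_measurable borel" and J_pos: "\<And>t. 0 < t \<Longrightarrow> 0 < J t" and J_nonneg: "\<And>t. 0 \<le> J t"
    and ratio: "\<And>t r. 0 < t \<Longrightarrow> t \<le> r \<Longrightarrow> r \<le> 1 \<Longrightarrow> J t / t \<le> 2 * (J r / r)"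
    and c\<^sub>0: "0 < c\<^sub>0"
    and strip: "\<And>a b. 0 \<le> a \<Longrightarrow> a < b \<Longrightarrow>
      (\<integral>\<^sup>+s. ennreal (c\<^sub>0 * J (dist_fun M w s)) * indicator {a<..<b} s \<partial>lborel)
      \<le> (\<integral>\<^sup>+x. ennreal (\<phi> x) * indicator {a<..<b} (w x) \<partial>M)"
begin

lemma J_level_measurable: "(\<lambda>s. J (dist_fun M w s)) \<in> borel_measurable borel"
  by (rule measurable_compose[OF dist_fun_measurable[OF w] J])

lemma weight_measurable: "(\<lambda>t. J t / t) \<in> borel_measurable borel"
  using J by measurable

lemma level_integral_le:
  assumes k: "k \<in> borel_measurable borel" and kK: "\<And>r. 0 \<le> r \<Longrightarrow> r \<le> 1 \<Longrightarrow> k r \<le> K" and l: "0 \<le> l"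
  shows "(\<integral>\<^sup>+s. k (dist_fun M w s) * ennreal (J (dist_fun M w s)) * indicator {0<..} s \<partial>lborel)
    \<le> ennreal (1 / c\<^sub>0) * (K * (\<integral>\<^sup>+t. ennreal (rearrangement M \<phi> t - l) \<partial>leb01) + ennreal l * (\<integral>\<^sup>+r. k r \<partial>leb01))"
proof -
  have [measurable]: "(\<lambda>s. J (dist_fun M w s)) \<in> borel_measurable borel" by (rule J_level_measurable)
  have [measurable]: "(\<lambda>s. k (dist_fun M w s)) \<in> borel_measurable borel"
    by (rule measurable_compose[OF dist_fun_measurable[OF w] k])
  have "(\<integral>\<^sup>+x. ennreal (\<phi> x - l) \<partial>M) = (\<integral>\<^sup>+t. ennreal (rearrangement M \<phi> t - l) \<partial>leb01)"
    using nn_integral_rearrangement[OF \<phi>, of "\<lambda>y. ennreal (y - l)"] \<phi>0 by simp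
  moreover have "(\<integral>\<^sup>+s. k (dist_fun M w s) * ennreal (c\<^sub>0 * J (dist_fun M w s)) * indicator {0<..} s \<partial>lborel)
      \<le> K * (\<integral>\<^sup>+x. ennreal (\<phi> x - l) \<partial>M) + ennreal l * (\<integral>\<^sup>+r. k r \<partial>leb01)"
    by (rule weighted_level_integral_le[OF w w0 \<phi> fin _ strip k kK l]) measurable
  ultimately have le: "(\<integral>\<^sup>+s. k (dist_fun M w s) * ennreal (c\<^sub>0 * J (dist_fun M w s)) * indicator {0<..} s \<partial>lborel)
      \<le> K * (\<integral>\<^sup>+t. ennreal (rearrangement M \<phi> t - l) \<partial>leb01) + ennreal l * (\<integral>\<^sup>+r. k r \<partial>leb01)" by simp
  have J_eq: "ennreal (J (dist_fun M w s)) = ennreal (1 / c\<^sub>0) * ennreal (c\<^sub>0 * J (dist_fun M w s))" for s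
    using c\<^sub>0 J_nonneg by (subst ennreal_mult[symmetric]) auto
  have "(\<integral>\<^sup>+s. k (dist_fun M w s) * ennreal (J (dist_fun M w s)) * indicator {0<..} s \<partial>lborel)
      = (\<integral>\<^sup>+s. ennreal (1 / c\<^sub>0) * (k (dist_fun M w s) * ennreal (c\<^sub>0 * J (dist_fun M w s)) * indicator {0<..} s) \<partial>lborel)"
    by (intro nn_integral_cong) (simp only: J_eq ac_simps)
  also have "\<dots> = ennreal (1 / c\<^sub>0) * (\<integral>\<^sup>+s. k (dist_fun M w s) * ennreal (c\<^sub>0 * J (dist_fun M w s)) * indicator {0<..} s \<partial>lborel)"
    by (rule nn_integral_cmult) measurable
  also have "\<dots> \<le> ennreal (1 / c\<^sub>0) * (K * (\<integral>\<^sup>+t. ennreal (rearrangement M \<phi> t - l) \<partial>leb01) + ennreal l * (\<integral>\<^sup>+r. k r \<partial>leb01))"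
    using le by (rule mult_left_mono) simp
  finally show ?thesis .
qed

lemma weighted_rearrangement_eq:
  assumes E: "E \<in> sets leb01"
  shows "(\<integral>\<^sup>+t. ennreal (rearrangement M w t * (J t / t)) * indicator E t \<partial>leb01)
    = (\<integral>\<^sup>+s. initial_mass (\<lambda>t. J t / t) E (dist_fun M w s) * indicator {0<..} s \<partial>lborel)"
  by (rule weighted_rearrangement_integral[OF w weight_measurable _ E]) (simp add: J_nonneg)

lemma weighted_rearrangement_measurable:
  "(\<lambda>t. rearrangement M w t * (J t / t)) \<in> borel_measurable leb01"
  by (intro borel_measurable_times rearrangement_measurable[OF w]
    measurable_compose[OF id_measurable_leb01 weight_measurable])

lemma weighted_rearrangement_nonneg:
  "0 < t \<Longrightarrow> 0 \<le> rearrangement M w t * (J t / t)"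
  by (intro mult_nonneg_nonneg divide_nonneg_nonneg rearrangement_nonneg[OF w] J_nonneg) auto

text \<open>Formally, the weighted rearrangement arises from \<open>f = - (w\<^sup>*)' J\<close>, which the coarea inequality
  controls by \<open>\<phi>\<close>, by the operator \<open>f \<mapsto> J t / t \<integral>\<^sub>t\<^sup>1 f / J\<close>. This operator is bounded on \<open>L\<^sup>1\<close>
  because \<open>J t / t\<close> is essentially increasing, and on \<open>L\<^sup>\<infinity>\<close> by the integral condition. Splitting at the level \<open>l\<close> interpolates between these two bounds.\<close>

lemma norm_bound_of_integral_condition:
  assumes ri: "ri_space leb01 N" and c1: "2 \<le> c1"
    and cond: "\<And>t. 0 < t \<Longrightarrow> t < 1 \<Longrightarrow> ennreal (J t / t) * (\<integral>\<^sup>+r. (if t < r then ennreal (1 / J r) else 0) \<partial>leb01) \<le> ennreal c1"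
  shows "N (\<lambda>t. rearrangement M w t * (J t / t)) \<le> ennreal (c1 / c\<^sub>0) * N (rearrangement M \<phi>)"
proof (rule ri_norm_le_of_set_integrals[OF ri weighted_rearrangement_measurable rearrangement_measurable[OF \<phi>]
      weighted_rearrangement_nonneg])
  show "0 < c1 / c\<^sub>0" using c1 c\<^sub>0 by simp
  fix E and l :: real assume E [measurable]: "E \<in> sets leb01" and l: "0 \<le> l"
  interpret L: prob_space leb01 by (rule prob_space_leb01)
  interpret P: pair_sigma_finite leb01 leb01 ..
  let ?v = "\<lambda>t. J t / t" and ?\<nu> = "dist_fun M w"
  note [measurable] = J weight_measurable
  have id [measurable]: "(\<lambda>t::real. t) \<in> borel_measurable leb01" by (rule id_measurable_leb01)
  have [measurable]: "?v \<in> borel_measurable leb01" by (rule measurable_compose[OF id weight_measurable])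
  have [measurable]: "J \<in> borel_measurable leb01" by (rule measurable_compose[OF id J])
  have im [measurable]: "initial_mass ?v E \<in> borel_measurable borel"
    by (rule initial_mass_measurable[OF weight_measurable E])
  define k where "k r = initial_mass ?v E r / ennreal (J r)" for r
  have k [measurable]: "k \<in> borel_measurable borel" unfolding k_def[abs_def] by measurable
  have k_J: "k r * ennreal (J r) = initial_mass ?v E r" if "0 \<le> r" for r
  proof (cases "r = 0")
    case False
    then have "0 < J r" using J_pos that by simp
    then show ?thesis unfolding k_def by (simp add: ennreal_divide_times ennreal_divide_self)
  qed (simp add: k_def initial_mass_zero)
  have k2: "k r \<le> 2" if r: "0 \<le> r" "r \<le> 1" for r
  proof (cases "r = 0")
    case False
    then have r0: "0 < r" using r by simp
    have "initial_mass ?v E r \<le> ennreal (2 * (J r / r)) * ennreal r"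
      using initial_mass_le[OF J_pos ratio E r0 r(2)] by (rule order_trans[OF _ mult_left_mono[OF min.cobounded1 zero_le]])
    also have "\<dots> = ennreal (2 * J r)"
      using r0 J_nonneg[of r] by (simp add: ennreal_mult[symmetric])
    also have "\<dots> = 2 * ennreal (J r)" using J_nonneg[of r] by (simp add: ennreal_mult)
    finally have "k r \<le> 2 * ennreal (J r) / ennreal (J r)"
      unfolding k_def by (rule divide_right_mono_ennreal)
    also have "\<dots> = 2" using J_pos[OF r0] by (simp add: ennreal_mult_divide_eq)
    finally show ?thesis .
  qed (simp add: k_def initial_mass_zero)
  have "(\<integral>\<^sup>+r. k r \<partial>leb01)
      = (\<integral>\<^sup>+r. (\<integral>\<^sup>+t. ennreal (?v t) * indicator E t * (if t < r then ennreal (1 / J r) else 0) \<partial>leb01) \<partial>leb01)"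
  proof (rule nn_integral_cong)
    fix r assume "r \<in> space leb01"
    then have "0 < J r" by (intro J_pos) (simp add: space_restrict_space)
    then have inv: "x / ennreal (J r) = x * ennreal (1 / J r)" for x
      by (simp add: divide_ennreal_def inverse_ennreal inverse_eq_divide)
    have "k r = (\<integral>\<^sup>+t. (if t < r then ennreal (?v t) * indicator E t else 0) * ennreal (1 / J r) \<partial>leb01)"
      unfolding k_def inv initial_mass_def by (rule nn_integral_multc[symmetric]) measurable
    also have "\<dots> = (\<integral>\<^sup>+t. ennreal (?v t) * indicator E t * (if t < r then ennreal (1 / J r) else 0) \<partial>leb01)"
      by (intro nn_integral_cong) simp
    finally show "k r = (\<integral>\<^sup>+t. ennreal (?v t) * indicator E t * (if t < r then ennreal (1 / J r) else 0) \<partial>leb01)" .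
  qed
  also have "\<dots> = (\<integral>\<^sup>+t. (\<integral>\<^sup>+r. ennreal (?v t) * indicator E t * (if t < r then ennreal (1 / J r) else 0) \<partial>leb01) \<partial>leb01)"
    by (rule P.Fubini') measurable
  also have "\<dots> \<le> (\<integral>\<^sup>+t. ennreal c1 * indicator E t \<partial>leb01)"
  proof (rule nn_integral_mono)
    fix t assume "t \<in> space leb01"
    then have t: "0 < t" "t < 1" by (auto simp: space_restrict_space)
    have "(\<integral>\<^sup>+r. ennreal (?v t) * indicator E t * (if t < r then ennreal (1 / J r) else 0) \<partial>leb01)
        = ennreal (?v t) * indicator E t * (\<integral>\<^sup>+r. (if t < r then ennreal (1 / J r) else 0) \<partial>leb01)"
      by (rule nn_integral_cmult) measurable
    also have "\<dots> = (ennreal (?v t) * (\<integral>\<^sup>+r. (if t < r then ennreal (1 / J r) else 0) \<partial>leb01)) * indicator E t"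
      by (simp only: ac_simps)
    also have "\<dots> \<le> ennreal c1 * indicator E t" by (rule mult_right_mono[OF cond[OF t]]) simp
    finally show "(\<integral>\<^sup>+r. ennreal (?v t) * indicator E t * (if t < r then ennreal (1 / J r) else 0) \<partial>leb01)
        \<le> ennreal c1 * indicator E t" .
  qed
  also have "\<dots> = ennreal c1 * emeasure leb01 E" by (rule nn_integral_cmult_indicator[OF E])
  finally have k_int: "(\<integral>\<^sup>+r. k r \<partial>leb01) \<le> ennreal c1 * emeasure leb01 E" .
  let ?A = "\<integral>\<^sup>+t. ennreal (rearrangement M \<phi> t - l) \<partial>leb01"
  have "(\<integral>\<^sup>+t. ennreal (rearrangement M w t * (J t / t)) * indicator E t \<partial>leb01)
      = (\<integral>\<^sup>+s. k (?\<nu> s) * ennreal (J (?\<nu> s)) * indicator {0<..} s \<partial>lborel)"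
    unfolding weighted_rearrangement_eq[OF E]
    by (intro nn_integral_cong) (simp only: k_J[OF dist_fun_bounds(1)])
  also have "\<dots> \<le> ennreal (1 / c\<^sub>0) * (2 * ?A + ennreal l * (\<integral>\<^sup>+r. k r \<partial>leb01))"
    by (rule level_integral_le[OF k k2 l])
  also have "\<dots> \<le> ennreal (1 / c\<^sub>0) * (ennreal c1 * ?A + ennreal l * (ennreal c1 * emeasure leb01 E))"
  proof (intro mult_left_mono add_mono mult_right_mono k_int)
    show "2 \<le> ennreal c1" using c1 by (metis ennreal_leI ennreal_numeral)
  qed simp_all
  also have "\<dots> = ennreal (1 / c\<^sub>0) * ennreal c1 * (?A + ennreal l * emeasure leb01 E)"
    by (simp add: distrib_left ac_simps)
  also have "ennreal (1 / c\<^sub>0) * ennreal c1 = ennreal (c1 / c\<^sub>0)"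
    using c\<^sub>0 c1 by (simp add: ennreal_mult[symmetric])
  finally show "(\<integral>\<^sup>+t. ennreal (rearrangement M w t * (J t / t)) * indicator E t \<partial>leb01)
      \<le> ennreal (c1 / c\<^sub>0) * (?A + ennreal l * emeasure leb01 E)" .
qed auto

end

context prob_space
begin

lemma rearrangement_dilated_measurable:
  assumes u: "u \<in> borel_measurable M" and a: "0 < a"
  shows "(\<lambda>t. rearrangement M u (t / a)) \<in> borel_measurable leb01"
proof (rule antimono_measurable_leb01)
  fix x y :: real assume "0 < x" "x \<le> y"
  then show "rearrangement M u (y / a) \<le> rearrangement M u (x / a)"
    using a by (intro rearrangement_antimono[OF u]) (simp_all add: divide_right_mono)
qed

lemma rearrangement_borel_extension:
  assumes u: "u \<in> borel_measurable M"
  shows "(\<lambda>x. if 0 < x then rearrangement M u x else 0) \<in> borel_measurable borel"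
proof -
  have "mono_on {0<..} (\<lambda>x. - rearrangement M u x)"
    by (rule mono_onI) (use rearrangement_antimono[OF u] in simp)
  then have "(\<lambda>x. - rearrangement M u x) \<in> borel_measurable (restrict_space borel {0<..})"
    by (rule borel_measurable_mono_on_fnc)
  from borel_measurable_uminus[OF this]
  have "rearrangement M u \<in> borel_measurable (restrict_space borel {0<..})" by simp
  then show ?thesis
    by (subst (asm) measurable_restrict_space_iff[where c=0]) auto
qed

text \<open>A change of variables. Since rearrangements vanish from \<open>1\<close> on, the integral on the left does not
  see the part of the unit interval beyond \<open>a\<close>.\<close>

lemma integral_rearrangement_dilated:
  assumes u: "u \<in> borel_measurable M" and a: "0 < a" "a \<le> 1"
  shows "(\<integral>\<^sup>+t. ennreal (rearrangement M u (t / a)) * indicator {..<e} t \<partial>leb01)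
    = ennreal a * (\<integral>\<^sup>+r. ennreal (rearrangement M u r) * indicator {..<e / a} r \<partial>leb01)"
proof -
  define \<psi> where "\<psi> x = (if 0 < x then rearrangement M u x else 0)" for x
  have \<psi> [measurable]: "\<psi> \<in> borel_measurable borel"
    unfolding \<psi>_def[abs_def] by (rule rearrangement_borel_extension[OF u])
  define h where "h r = ennreal (\<psi> r) * indicator {..<e / a} r * indicator {0<..<1} r" for r
  have h [measurable]: "h \<in> borel_measurable borel" unfolding h_def[abs_def] by measurable
  have "(\<integral>\<^sup>+r. ennreal (rearrangement M u r) * indicator {..<e / a} r \<partial>leb01)
      = (\<integral>\<^sup>+r. ennreal (\<psi> r) * indicator {..<e / a} r \<partial>leb01)"
    by (intro nn_integral_cong) (simp add: \<psi>_def space_restrict_space)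
  also have "\<dots> = (\<integral>\<^sup>+r. h r \<partial>lborel)"
    unfolding h_def by (rule nn_integral_leb01) measurable
  also have "\<dots> = \<bar>1 / a\<bar> * (\<integral>\<^sup>+x. h (0 + (1 / a) * x) \<partial>lborel)"
    by (rule nn_integral_real_affine[OF h]) (use a in simp)
  also have "(\<integral>\<^sup>+x. h (0 + (1 / a) * x) \<partial>lborel)
      = (\<integral>\<^sup>+t. ennreal (\<psi> (t / a)) * indicator {..<e} t * indicator {0<..<1} t \<partial>lborel)"
  proof (rule nn_integral_cong)
    fix x :: real
    show "h (0 + (1 / a) * x) = ennreal (\<psi> (x / a)) * indicator {..<e} x * indicator {0<..<1} x"
    proof (cases "0 < x \<and> x < a")
      case True
      then show ?thesis using a by (simp add: h_def indicator_def divide_less_cancel)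
    next
      case False
      have "\<psi> (x / a) = 0"
      proof (cases "0 < x")
        case True
        then have "1 \<le> x / a" using False a by simp
        then show ?thesis using True a by (simp add: \<psi>_def rearrangement_ge_1[OF u])
      next
        case False
        then have "\<not> 0 < x / a" using a by (simp add: zero_less_divide_iff)
        then show ?thesis by (simp add: \<psi>_def)
      qed
      then show ?thesis by (simp add: h_def)
    qed
  qed
  also have "\<dots> = (\<integral>\<^sup>+t. ennreal (\<psi> (t / a)) * indicator {..<e} t \<partial>leb01)"
    by (rule nn_integral_leb01[symmetric]) measurable
  also have "\<dots> = (\<integral>\<^sup>+t. ennreal (rearrangement M u (t / a)) * indicator {..<e} t \<partial>leb01)"
    using a by (intro nn_integral_cong) (simp add: \<psi>_def space_restrict_space)
  finally have eq: "(\<integral>\<^sup>+r. ennreal (rearrangement M u r) * indicator {..<e / a} r \<partial>leb01)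
      = ennreal (1 / a) * (\<integral>\<^sup>+t. ennreal (rearrangement M u (t / a)) * indicator {..<e} t \<partial>leb01)"
    using a by simp
  have "ennreal a * ennreal (1 / a) = 1" using a by (simp add: ennreal_mult[symmetric])
  then show ?thesis unfolding eq by (simp add: mult.assoc[symmetric])
qed

lemma rearrangement_of_dilated:
  assumes u: "u \<in> borel_measurable M" and a: "0 < a" "a \<le> 1" and s: "0 < s"
  shows "rearrangement leb01 (\<lambda>t. rearrangement M u (t / a)) s = rearrangement M u (s / a)"
proof (rule prob_space.rearrangement_eqI[OF prob_space_leb01 rearrangement_dilated_measurable[OF u a(1)] s])
  have sa: "0 < s / a" using s a by simp
  show "0 \<le> rearrangement M u (s / a)" by (rule rearrangement_nonneg[OF u sa])
  fix \<tau> :: real assume \<tau>: "0 \<le> \<tau>"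
  let ?d = "dist_fun M u \<tau>"
  have "(x \<in> space leb01 \<and> \<tau> < \<bar>rearrangement M u (x / a)\<bar>) \<longleftrightarrow> (0 < x \<and> x < 1 \<and> x < a * ?d)" for x
  proof (cases "0 < x")
    case True
    then have xa: "0 < x / a" using a by simp
    have "\<bar>rearrangement M u (x / a)\<bar> = rearrangement M u (x / a)"
      using rearrangement_nonneg[OF u xa] by (rule abs_of_nonneg)
    moreover have "x \<in> space leb01 \<longleftrightarrow> x < 1"
      using True by (simp add: space_restrict_space)
    moreover have "x / a < ?d \<longleftrightarrow> x < a * ?d" using a by (simp add: pos_divide_less_eq mult.commute)
    ultimately show ?thesis
      using less_rearrangement_iff[OF u xa \<tau>] True by metis
  qed (simp add: space_restrict_space)
  then have "dist_fun leb01 (\<lambda>t. rearrangement M u (t / a)) \<tau> = measure leb01 {x. 0 < x \<and> x < 1 \<and> x < a * ?d}"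
    unfolding dist_fun_def[of leb01] by presburger
  also have "\<dots> = min (a * ?d) 1"
    by (rule measure_leb01_lessThan) (use a dist_fun_bounds(1)[of u \<tau>] in simp)
  also have "\<dots> = a * ?d"
    by (rule min_absorb1) (use a dist_fun_bounds[of u \<tau>] in \<open>simp add: mult_le_one\<close>)
  finally have d: "dist_fun leb01 (\<lambda>t. rearrangement M u (t / a)) \<tau> = a * ?d" .
  have "s < a * ?d \<longleftrightarrow> s / a < ?d" using a by (simp add: pos_divide_less_eq mult.commute)
  then show "(s < dist_fun leb01 (\<lambda>t. rearrangement M u (t / a)) \<tau>) = (\<tau> < rearrangement M u (s / a))"
    unfolding d less_rearrangement_iff[OF u sa \<tau>] .
qed

lemma finitely_many_dilates:
  assumes u: "u \<in> borel_measurable M" and q: "0 < q" "q < 1" and t: "0 < t"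
  obtains n where "\<And>j. n \<le> j \<Longrightarrow> rearrangement M u (t / q ^ j) = 0"
proof -
  obtain n where n: "q ^ n < t" using real_arch_pow_inv[OF t q(2)] by blast
  show ?thesis
  proof (rule that[of n])
    fix j assume "n \<le> j"
    then have "q ^ j \<le> q ^ n" using q by (intro power_decreasing) auto
    then have "q ^ j \<le> t" using n by linarith
    then have "1 \<le> t / q ^ j" using q by simp
    then show "rearrangement M u (t / q ^ j) = 0" by (rule rearrangement_ge_1[OF u])
  qed
qed

lemma summable_dilates:
  assumes u: "u \<in> borel_measurable M" and q: "0 < q" "q < 1" and t: "0 < t"
  shows "summable (\<lambda>j. rearrangement M u (t / q ^ j))"
proof -
  obtain n where n: "\<And>j. n \<le> j \<Longrightarrow> rearrangement M u (t / q ^ j) = 0"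
    using finitely_many_dilates[OF assms] by blast
  show ?thesis by (rule summable_finite[of "{..<n}"]) (use n in \<open>auto simp: not_less\<close>)
qed

end

lemma dilation_measurable:
  assumes g: "g \<in> borel_measurable leb01" and q: "0 < q"
  shows "dilation q g \<in> borel_measurable leb01"
proof (rule antimono_measurable_leb01)
  interpret L: prob_space leb01 by (rule prob_space_leb01)
  fix x y :: real assume xy: "0 < x" "x \<le> y" "y < 1"
  have "rearrangement leb01 g (y / q) \<le> rearrangement leb01 g (x / q)"
    using xy q by (intro L.rearrangement_antimono[OF g]) (simp_all add: divide_right_mono)
  moreover have "0 \<le> rearrangement leb01 g (x / q)"
    using xy q by (intro L.rearrangement_nonneg[OF g]) simp
  ultimately show "dilation q g y \<le> dilation q g x"
    using xy by (auto simp: dilation_def)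
qed

lemma norm_dilation_le:
  assumes lq: "lattice_quasinorm leb01 C N" and g: "g \<in> fspace leb01 N" and q: "0 < q"
  shows "N (dilation q g) \<le> dilation_norm N q * N g"
proof -
  have gm [measurable]: "g \<in> borel_measurable leb01" and fin: "N g < \<infinity>" using g by (auto simp: fspace_def)
  have dm: "dilation q g \<in> borel_measurable leb01" by (rule dilation_measurable[OF gm q])
  interpret L: prob_space leb01 by (rule prob_space_leb01)
  obtain r where r: "N g = ennreal r" "0 \<le> r" using fin by (cases "N g") auto
  show ?thesis
  proof (cases "r = 0")
    case True
    then have "AE x in leb01. g x = 0"
      using r lq gm unfolding lattice_quasinorm_def by auto
    then have d0: "dist_fun leb01 g \<tau> = 0" if "0 \<le> \<tau>" for \<tau>
    proof -
      have "AE x in leb01. \<not> \<tau> < \<bar>g x\<bar>"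
        using \<open>AE x in leb01. g x = 0\<close> by (rule eventually_mono) (use that in simp)
      moreover have "{x \<in> space leb01. \<tau> < \<bar>g x\<bar>} \<in> sets leb01" by measurable
      ultimately show ?thesis
        unfolding dist_fun_def using L.prob_Collect_eq_0[of "\<lambda>x. \<tau> < \<bar>g x\<bar>"] by blast
    qed
    have "rearrangement leb01 g s = 0" if "0 < s" for s
      using that d0 by (intro L.rearrangement_eqI[OF gm that]) auto
    then have "dilation q g x = 0 * dilation q g x" for x using q by (simp add: dilation_def)
    then have "N (dilation q g) = N (\<lambda>x. 0 * dilation q g x)" by presburger
    also have "\<dots> = 0" by (subst lattice_quasinorm_cmult[OF lq dm]) simp
    finally show ?thesis by simp
  next
    case False
    then have r0: "0 < r" using r by simp
    let ?g = "\<lambda>x. (1 / r) * g x"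
    have "N ?g = ennreal (1 / r) * ennreal r"
      using r0 r by (subst lattice_quasinorm_cmult[OF lq gm]) simp
    also have "\<dots> = 1" using r0 by (simp add: ennreal_mult[symmetric])
    finally have "?g \<in> {f \<in> fspace leb01 N. N f \<le> 1}" using gm by (simp add: fspace_def)
    then have "N (dilation q ?g) \<le> dilation_norm N q" unfolding dilation_norm_def by (rule SUP_upper)
    moreover have "dilation q ?g = (\<lambda>t. (1 / r) * dilation q g t)"
    proof
      fix t
      show "dilation q ?g t = (1 / r) * dilation q g t"
      proof (cases "0 < t \<and> t < min q 1")
        case True
        then have "0 < t / q" using q by simp
        then show ?thesis
          using rearrangement_cmult[OF prob_space_leb01 gm, of "t / q" "1 / r"] r0 True by (simp add: dilation_def)
      next
        case False
        have "dilation q u t = 0" for u unfolding dilation_def by (rule if_not_P[OF False])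
        then show ?thesis by simp
      qed
    qed
    moreover have "N (\<lambda>t. (1 / r) * dilation q g t) = ennreal (1 / r) * N (dilation q g)"
      using r0 by (subst lattice_quasinorm_cmult[OF lq dm]) simp
    ultimately have le: "ennreal (1 / r) * N (dilation q g) \<le> dilation_norm N q" by simp
    have "N (dilation q g) = ennreal r * (ennreal (1 / r) * N (dilation q g))"
      using r0 by (simp add: mult.assoc[symmetric] ennreal_mult[symmetric])
    also have "\<dots> \<le> ennreal r * dilation_norm N q" by (rule mult_left_mono[OF le]) simp
    finally show ?thesis by (simp add: r(1) mult.commute)
  qed
qed

text \<open>Iterated dilations compose to dilations by powers, so if one dilation is a strict
  contraction, then the norms of these form a geometric series.\<close>

lemma (in prob_space) norm_sum_dilates_le:
  assumes ri: "ri_space leb01 N" and u: "u \<in> borel_measurable M"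
    and q: "0 < q" "q < 1" and h: "dilation_norm N q = ennreal h" "0 \<le> h" "h < 1"
  shows "N (\<lambda>t. \<Sum>j. rearrangement M u (t / q ^ j)) \<le> ennreal (1 / (1 - h)) * N (rearrangement M u)"
proof (cases "N (rearrangement M u) = \<infinity>")
  case True
  have "ennreal (1 / (1 - h)) \<noteq> 0" using h by simp
  then show ?thesis unfolding True by (simp add: ennreal_mult_top)
next
  case False
  have lq: "lattice_quasinorm leb01 1 N"
    using ri by (auto simp: ri_space_def banach_function_space_def)
  define D where "D j t = rearrangement M u (t / q ^ j)" for j t
  have qj: "0 < q ^ j" "q ^ j \<le> 1" for j using q by (auto intro: power_le_one)
  have Dm: "D j \<in> borel_measurable leb01" for j
    unfolding D_def[abs_def] by (rule rearrangement_dilated_measurable[OF u qj(1)])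
  have D0: "0 \<le> D j t" if "0 < t" for j t
    unfolding D_def using that qj by (intro rearrangement_nonneg[OF u]) simp
  have D_norm: "N (D j) \<le> ennreal (h ^ j) * N (rearrangement M u)" for j
  proof (induction j)
    case 0
    have "D 0 = rearrangement M u" by (simp add: D_def fun_eq_iff)
    then show ?case by simp
  next
    case (Suc j)
    have "N (D j) < \<infinity>"
    proof (rule le_less_trans[OF Suc.IH])
      show "ennreal (h ^ j) * N (rearrangement M u) < \<infinity>"
        using False by (simp add: ennreal_mult_less_top less_top)
    qed
    then have fs: "D j \<in> fspace leb01 N" using Dm by (simp add: fspace_def)
    have "N (D (Suc j)) = N (dilation q (D j))"
    proof (rule lattice_quasinorm_cong[OF lq Dm dilation_measurable[OF Dm q(1)]])
      fix t :: real assume t: "0 < t" "t < 1"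
      have tq: "0 < t / q" using t q by simp
      have "D (Suc j) t = rearrangement M u ((t / q) / q ^ j)" by (simp add: D_def)
      also have "\<dots> = rearrangement leb01 (D j) (t / q)"
        unfolding D_def[abs_def] by (rule rearrangement_of_dilated[OF u qj tq, symmetric])
      also have "\<dots> = dilation q (D j) t"
      proof (cases "t < q")
        case True
        then show ?thesis using t by (simp add: dilation_def)
      next
        case False
        then have "1 \<le> t / q" using q by simp
        then have "rearrangement leb01 (D j) (t / q) = 0"
          by (rule prob_space.rearrangement_ge_1[OF prob_space_leb01 Dm])
        then show ?thesis using False by (simp add: dilation_def)
      qed
      finally show "D (Suc j) t = dilation q (D j) t" .
    qed
    also have "\<dots> \<le> ennreal h * N (D j)"
      using norm_dilation_le[OF lq fs q(1)] h(1) by simp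
    also have "\<dots> \<le> ennreal h * (ennreal (h ^ j) * N (rearrangement M u))"
      by (rule mult_left_mono[OF Suc.IH]) simp
    also have "\<dots> = ennreal (h ^ Suc j) * N (rearrangement M u)"
      using h by (simp add: mult.assoc[symmetric] ennreal_mult[symmetric])
    finally show ?case .
  qed
  have sum_meas: "(\<lambda>t. \<Sum>j<n. D j t) \<in> borel_measurable leb01" for n
    using Dm by (rule borel_measurable_sum)
  have sum_norm: "N (\<lambda>t. \<Sum>j<n. D j t) \<le> ennreal (\<Sum>j<n. h ^ j) * N (rearrangement M u)" for n
  proof (induction n)
    case 0
    have "N (\<lambda>t. 0 * D 0 t) = 0" by (subst lattice_quasinorm_cmult[OF lq Dm]) simp
    then show ?case by simp
  next
    case (Suc n)
    have "N (\<lambda>t. \<Sum>j<Suc n. D j t) = N (\<lambda>t. (\<Sum>j<n. D j t) + D n t)" by simp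
    also have "\<dots> \<le> ennreal 1 * (N (\<lambda>t. \<Sum>j<n. D j t) + N (D n))"
      by (rule lattice_quasinorm_add[OF lq sum_meas Dm])
    also have "\<dots> \<le> ennreal (\<Sum>j<n. h ^ j) * N (rearrangement M u) + ennreal (h ^ n) * N (rearrangement M u)"
      using add_mono[OF Suc.IH D_norm[of n]] by simp
    also have "\<dots> = (ennreal (\<Sum>j<n. h ^ j) + ennreal (h ^ n)) * N (rearrangement M u)"
      by (simp only: distrib_right)
    also have "ennreal (\<Sum>j<n. h ^ j) + ennreal (h ^ n) = ennreal (\<Sum>j<Suc n. h ^ j)"
      using h by (simp add: sum_nonneg)
    finally show ?case .
  qed
  have geo: "(\<Sum>j<n. h ^ j) \<le> 1 / (1 - h)" for n
  proof -
    have "(\<Sum>j<n. h ^ j) = (1 - h ^ n) / (1 - h)" using h by (subst sum_gp_strict) auto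
    also have "\<dots> \<le> 1 / (1 - h)" using h by (intro divide_right_mono) auto
    finally show ?thesis .
  qed
  have le: "N (\<lambda>t. \<Sum>j<n. D j t) \<le> ennreal (1 / (1 - h)) * N (rearrangement M u)" for n
    by (rule order_trans[OF sum_norm mult_right_mono[OF ennreal_leI[OF geo]]]) simp
  have Sm: "(\<lambda>t. \<Sum>j. D j t) \<in> borel_measurable leb01" using Dm by (rule borel_measurable_suminf)
  have "(\<lambda>n. N (\<lambda>t. \<Sum>j<n. D j t)) \<longlonglongrightarrow> N (\<lambda>t. \<Sum>j. D j t)"
  proof (rule ri_norm_increasing_limit[OF ri sum_meas Sm])
    fix t :: real and n :: nat assume t: "0 < t"
    show "0 \<le> (\<Sum>j<n. D j t)" by (intro sum_nonneg D0 t)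
    show "(\<Sum>j<n. D j t) \<le> (\<Sum>j<Suc n. D j t)" using D0[OF t, of n] by simp
    show "(\<lambda>n. \<Sum>j<n. D j t) \<longlonglongrightarrow> (\<Sum>j. D j t)"
      unfolding D_def by (rule summable_LIMSEQ[OF summable_dilates[OF u q t]])
  qed
  then have "N (\<lambda>t. \<Sum>j. D j t) \<le> ennreal (1 / (1 - h)) * N (rearrangement M u)"
    by (rule LIMSEQ_le_const2) (use le in auto)
  then show ?thesis unfolding D_def .
qed

text \<open>The integral over \<open>(0, e)\<close> of \<open>t \<mapsto> \<integral>\<^sub>t\<^sup>1 f r dr / r\<close> is the integral of \<open>f r\<close> against \<open>min 1 (e / r)\<close>.
  One term of the geometric series of the functions \<open>q ^ j / q\<close> on \<open>{..<e / q ^ j}\<close>, and hence its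
  sum, bounds this kernel.\<close>

lemma geometric_step_below:
  fixes q e r :: real
  assumes q: "0 < q" "q < 1" and e: "0 < e" and r: "0 < r"
  obtains j :: nat where "r < e / q ^ j" "min r e / r \<le> q ^ j / q"
proof (cases "r < e")
  case True
  show ?thesis by (rule that[of 0]) (use True q r in simp_all)
next
  case False
  define j where "j = (LEAST j. q ^ j < e / r)"
  have ex: "\<exists>j. q ^ j < e / r" using real_arch_pow_inv[of "e / r" q] q e r by simp
  have j: "q ^ j < e / r" unfolding j_def by (rule LeastI_ex[OF ex])
  have "j \<noteq> 0"
  proof
    assume "j = 0"
    then have "1 < e / r" using j by simp
    then show False using False r by simp
  qed
  then obtain i where i: "j = Suc i" using not0_implies_Suc by blast
  have "\<not> q ^ i < e / r" using not_less_Least[of i "\<lambda>j. q ^ j < e / r"] i by (simp add: j_def)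
  then have "e / r \<le> q ^ j / q" using i q by simp
  moreover have "r < e / q ^ j" using j q r by (simp add: field_simps)
  ultimately show ?thesis using False by (intro that[of j]) simp_all
qed

context level_gradient
begin

lemma initial_mass_le_geometric:
  assumes q: "0 < q" "q < 1" and E: "E \<in> sets leb01" and e: "emeasure leb01 E = ennreal e" "0 < e"
    and r: "0 \<le> r" "r \<le> 1"
  shows "initial_mass (\<lambda>t. J t / t) E r \<le> (\<Sum>j. ennreal (2 / q * q ^ j) * (indicator {..<e / q ^ j} r * ennreal (J r)))"
proof (cases "r = 0")
  case False
  then have r0: "0 < r" using r by simp
  obtain j where j: "r < e / q ^ j" "min r e / r \<le> q ^ j / q"
    using geometric_step_below[OF q e(2) r0] by blast
  have "initial_mass (\<lambda>t. J t / t) E r \<le> ennreal (2 * (J r / r)) * min (ennreal r) (emeasure leb01 E)"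
    by (rule initial_mass_le[OF J_pos ratio E r0 r(2)])
  also have "min (ennreal r) (emeasure leb01 E) = ennreal (min r e)"
    using r e by (auto simp: min_def)
  also have "ennreal (2 * (J r / r)) * ennreal (min r e) = ennreal (2 * J r * (min r e / r))"
    using r0 J_nonneg[of r] e by (simp add: ennreal_mult[symmetric])
  also have "\<dots> \<le> ennreal (2 * J r * (q ^ j / q))"
    using J_nonneg[of r] by (intro ennreal_leI mult_left_mono j(2)) simp
  also have "\<dots> = ennreal (2 / q * q ^ j) * (indicator {..<e / q ^ j} r * ennreal (J r))"
    using j(1) q J_nonneg[of r] by (simp add: ennreal_mult[symmetric] ac_simps)
  also have "\<dots> \<le> (\<Sum>j. ennreal (2 / q * q ^ j) * (indicator {..<e / q ^ j} r * ennreal (J r)))"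
    using sum_le_suminf[of "\<lambda>j. ennreal (2 / q * q ^ j) * (indicator {..<e / q ^ j} r * ennreal (J r))" "{j}"] by simp
  finally show ?thesis .
qed (simp add: initial_mass_zero)

text \<open>As \<open>J t / t\<close> is essentially increasing, the operator \<open>f \<mapsto> J t / t \<integral>\<^sub>t\<^sup>1 f / J\<close> is dominated by
  \<open>f \<mapsto> \<integral>\<^sub>t\<^sup>1 f r dr / r\<close>, which in turn is dominated, in the sense of majorization, by a sum of dilations.
  For the \<open>j\<close>-th term of the geometric series the level \<open>\<phi>\<^sup>*(e / q ^ j)\<close> is optimal; it yields the integral
  of \<open>\<phi>\<^sup>*\<close> over \<open>(0, e / q ^ j)\<close>, which is that of a dilation over \<open>(0, e)\<close>, scaled.\<close>

lemma norm_bound_of_dilations: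
  assumes ri: "ri_space leb01 N" and q: "0 < q" "q < 1"
  shows "N (\<lambda>t. rearrangement M w t * (J t / t))
    \<le> ennreal (2 / (q * c\<^sub>0)) * N (\<lambda>t. \<Sum>j. rearrangement M \<phi> (t / q ^ j))"
proof -
  interpret L: prob_space leb01 by (rule prob_space_leb01)
  let ?f = "rearrangement M \<phi>" and ?\<nu> = "dist_fun M w"
  have qj: "0 < q ^ j" "q ^ j \<le> 1" for j using q by (auto intro: power_le_one)
  have Dm [measurable]: "(\<lambda>t. ?f (t / q ^ j)) \<in> borel_measurable leb01" for j
    by (rule rearrangement_dilated_measurable[OF \<phi> qj(1)])
  have fm [measurable]: "?f \<in> borel_measurable leb01" by (rule rearrangement_measurable[OF \<phi>])
  have D0: "0 \<le> ?f (t / q ^ j)" if "0 < t" for j t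
    using that qj by (intro rearrangement_nonneg[OF \<phi>]) simp
  let ?S = "\<lambda>t. \<Sum>j. ?f (t / q ^ j)"
  have Sm [measurable]: "?S \<in> borel_measurable leb01" using Dm by (rule borel_measurable_suminf)
  have C: "0 < 2 / (q * c\<^sub>0)" using q c\<^sub>0 by simp
  show ?thesis
  proof (rule ri_norm_le_of_set_integrals[OF ri weighted_rearrangement_measurable Sm weighted_rearrangement_nonneg C])
    fix E and l :: real assume E [measurable]: "E \<in> sets leb01" and l: "0 \<le> l"
    define e where "e = measure leb01 E"
    have e: "emeasure leb01 E = ennreal e" "0 \<le> e" "e \<le> 1" by (simp_all add: e_def L.emeasure_eq_measure)
    show "(\<integral>\<^sup>+t. ennreal (rearrangement M w t * (J t / t)) * indicator E t \<partial>leb01)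
        \<le> ennreal (2 / (q * c\<^sub>0)) * ((\<integral>\<^sup>+t. ennreal (?S t - l) \<partial>leb01) + ennreal l * emeasure leb01 E)"
    proof (cases "e = 0")
      case True
      then have "E \<in> null_sets leb01" using e E by auto
      then have "AE t in leb01. ennreal (rearrangement M w t * (J t / t)) * indicator E t = 0"
        by (rule eventually_mono[OF AE_not_in]) simp
      then have "(\<integral>\<^sup>+t. ennreal (rearrangement M w t * (J t / t)) * indicator E t \<partial>leb01) = (\<integral>\<^sup>+t. 0 \<partial>leb01)"
        by (rule nn_integral_cong_AE)
      then show ?thesis by simp
    next
      case False
      then have e0: "0 < e" using e by simp
      have ind [measurable]: "(\<lambda>t. indicator {..<x} t :: ennreal) \<in> borel_measurable leb01" for x :: real
        by (rule measurable_compose[OF id_measurable_leb01]) simp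
      have \<nu> [measurable]: "?\<nu> \<in> borel_measurable borel" by (rule dist_fun_measurable[OF w])
      have J\<nu> [measurable]: "(\<lambda>s. J (?\<nu> s)) \<in> borel_measurable borel" by (rule J_level_measurable)
      let ?k = "\<lambda>j r. indicator {..<e / q ^ j} r :: ennreal"
      have "(\<integral>\<^sup>+t. ennreal (rearrangement M w t * (J t / t)) * indicator E t \<partial>leb01)
          = (\<integral>\<^sup>+s. initial_mass (\<lambda>t. J t / t) E (?\<nu> s) * indicator {0<..} s \<partial>lborel)"
        by (rule weighted_rearrangement_eq[OF E])
      also have "\<dots> \<le> (\<integral>\<^sup>+s. (\<Sum>j. ennreal (2 / q * q ^ j) * (?k j (?\<nu> s) * ennreal (J (?\<nu> s)))) * indicator {0<..} s \<partial>lborel)"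
        by (intro nn_integral_mono mult_right_mono initial_mass_le_geometric[OF q E e(1) e0] dist_fun_bounds) simp
      also have "\<dots> = (\<integral>\<^sup>+s. (\<Sum>j. ennreal (2 / q * q ^ j) * (?k j (?\<nu> s) * ennreal (J (?\<nu> s)) * indicator {0<..} s)) \<partial>lborel)"
        by (intro nn_integral_cong) (simp add: ennreal_suminf_multc[symmetric] mult.assoc)
      also have "\<dots> = (\<Sum>j. \<integral>\<^sup>+s. ennreal (2 / q * q ^ j) * (?k j (?\<nu> s) * ennreal (J (?\<nu> s)) * indicator {0<..} s) \<partial>lborel)"
        by (rule nn_integral_suminf) measurable
      also have "\<dots> = (\<Sum>j. ennreal (2 / q * q ^ j) * (\<integral>\<^sup>+s. ?k j (?\<nu> s) * ennreal (J (?\<nu> s)) * indicator {0<..} s \<partial>lborel))"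
        by (intro suminf_cong nn_integral_cmult) measurable
      also have "\<dots> \<le> (\<Sum>j. ennreal (2 / (q * c\<^sub>0)) * (\<integral>\<^sup>+t. ennreal (?f (t / q ^ j)) * indicator {..<e} t \<partial>leb01))"
      proof (rule suminf_le)
        fix j
        have x: "0 < e / q ^ j" using e0 qj by simp
        let ?l = "?f (e / q ^ j)"
        have l0: "0 \<le> ?l" by (rule rearrangement_nonneg[OF \<phi> x])
        have "(\<integral>\<^sup>+s. ?k j (?\<nu> s) * ennreal (J (?\<nu> s)) * indicator {0<..} s \<partial>lborel)
            \<le> ennreal (1 / c\<^sub>0) * (1 * (\<integral>\<^sup>+t. ennreal (?f t - ?l) \<partial>leb01) + ennreal ?l * (\<integral>\<^sup>+r. ?k j r \<partial>leb01))"
          by (rule level_integral_le[OF _ _ l0]) (simp_all add: indicator_def)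
        also have "1 * (\<integral>\<^sup>+t. ennreal (?f t - ?l) \<partial>leb01) + ennreal ?l * (\<integral>\<^sup>+r. ?k j r \<partial>leb01)
            = (\<integral>\<^sup>+r. ennreal (?f r) * ?k j r \<partial>leb01)"
          unfolding mult_1
          by (rule prefix_integral_eq_excess[OF fm l0]) (use rearrangement_antimono[OF \<phi>] x in auto)
        finally have "ennreal (2 / q * q ^ j) * (\<integral>\<^sup>+s. ?k j (?\<nu> s) * ennreal (J (?\<nu> s)) * indicator {0<..} s \<partial>lborel)
            \<le> ennreal (2 / q * q ^ j) * (ennreal (1 / c\<^sub>0) * (\<integral>\<^sup>+r. ennreal (?f r) * ?k j r \<partial>leb01))"
          by (rule mult_left_mono) simp
        also have "\<dots> = ennreal (2 / (q * c\<^sub>0)) * (ennreal (q ^ j) * (\<integral>\<^sup>+r. ennreal (?f r) * ?k j r \<partial>leb01))"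
          using q c\<^sub>0 by (simp add: mult.assoc[symmetric] ennreal_mult[symmetric] mult.commute)
        also have "ennreal (q ^ j) * (\<integral>\<^sup>+r. ennreal (?f r) * ?k j r \<partial>leb01)
            = (\<integral>\<^sup>+t. ennreal (?f (t / q ^ j)) * indicator {..<e} t \<partial>leb01)"
          by (rule integral_rearrangement_dilated[OF \<phi> qj, symmetric])
        finally show "ennreal (2 / q * q ^ j) * (\<integral>\<^sup>+s. ?k j (?\<nu> s) * ennreal (J (?\<nu> s)) * indicator {0<..} s \<partial>lborel)
            \<le> ennreal (2 / (q * c\<^sub>0)) * (\<integral>\<^sup>+t. ennreal (?f (t / q ^ j)) * indicator {..<e} t \<partial>leb01)" .
      qed simp_all
      also have "\<dots> = ennreal (2 / (q * c\<^sub>0)) * (\<Sum>j. \<integral>\<^sup>+t. ennreal (?f (t / q ^ j)) * indicator {..<e} t \<partial>leb01)"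
        by (rule ennreal_suminf_cmult)
      also have "(\<Sum>j. \<integral>\<^sup>+t. ennreal (?f (t / q ^ j)) * indicator {..<e} t \<partial>leb01)
          = (\<integral>\<^sup>+t. (\<Sum>j. ennreal (?f (t / q ^ j)) * indicator {..<e} t) \<partial>leb01)"
        by (rule nn_integral_suminf[symmetric]) measurable
      also have "\<dots> \<le> (\<integral>\<^sup>+t. ennreal (?S t - l) + ennreal l * indicator {..<e} t \<partial>leb01)"
      proof (rule nn_integral_mono)
        fix t assume "t \<in> space leb01"
        then have t: "0 < t" by (simp add: space_restrict_space)
        have "(\<Sum>j. ennreal (?f (t / q ^ j)) * indicator {..<e} t) = (\<Sum>j. ennreal (?f (t / q ^ j))) * indicator {..<e} t"
          by (rule ennreal_suminf_multc)
        also have "(\<Sum>j. ennreal (?f (t / q ^ j))) = ennreal (?S t)"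
          by (rule suminf_ennreal2[OF D0[OF t] summable_dilates[OF \<phi> q t]])
        also have "ennreal (?S t) * indicator {..<e} t \<le> ennreal (?S t - l) + ennreal l * indicator {..<e} t"
        proof (cases "t < e")
          case True
          have "ennreal (?S t) \<le> ennreal (?S t - l) + ennreal l" by (rule le_excess_plus_level[OF l])
          then show ?thesis using True by simp
        qed simp
        finally show "(\<Sum>j. ennreal (?f (t / q ^ j)) * indicator {..<e} t) \<le> ennreal (?S t - l) + ennreal l * indicator {..<e} t" .
      qed
      also have "\<dots> = (\<integral>\<^sup>+t. ennreal (?S t - l) \<partial>leb01) + (\<integral>\<^sup>+t. ennreal l * indicator {..<e} t \<partial>leb01)"
        by (rule nn_integral_add) measurable
      also have "(\<integral>\<^sup>+t. ennreal l * indicator {..<e} t \<partial>leb01) = ennreal l * (\<integral>\<^sup>+t. indicator {..<e} t \<partial>leb01)"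
        by (rule nn_integral_cmult) measurable
      also have "(\<integral>\<^sup>+t. indicator {..<e} t \<partial>leb01) = emeasure leb01 E"
        unfolding e(1) by (rule emeasure_leb01_initial[OF e(2,3)])
      finally show ?thesis by (simp add: mult_left_mono)
    qed
  qed auto
qed

end

section \<open>Lipschitz functions relative to their median\<close>

text \<open>The integral condition concerns \<open>(0, 1/2)\<close>. On \<open>(1/2, 1)\<close> the flat estimator is the constant
  \<open>I (1/2)\<close>, and as \<open>I t / t \<le> 2 I (1/2)\<close>, this part contributes at most \<open>2\<close>.\<close>

lemma integral_condition_flat:
  fixes M :: "'a::metric_space measure"
  assumes est: "convex_isoperimetric_estimator M I"
    and c: "0 < c" and cond: "\<forall>t\<in>{0<..<1/2}. (LINT s:{t..1/2}|lebesgue. 1 / I s) \<le> c * (t / I t)"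
    and t: "0 < t" "t < 1"
  shows "ennreal (flat_estimator I t / t) * (\<integral>\<^sup>+r. (if t < r then ennreal (1 / flat_estimator I r) else 0) \<partial>leb01)
    \<le> ennreal (c + 2)"
proof -
  interpret L: prob_space leb01 by (rule prob_space_leb01)
  let ?J = "flat_estimator I"
  have Jm [measurable]: "?J \<in> borel_measurable borel" by (rule flat_estimator_measurable[OF est])
  have half: "0 < I (1/2)" by (rule estimator_pos[OF est]) auto
  show ?thesis
  proof (cases "t < 1/2")
    case False
    have "(\<integral>\<^sup>+r. (if t < r then ennreal (1 / ?J r) else 0) \<partial>leb01) \<le> (\<integral>\<^sup>+r. ennreal (1 / I (1/2)) \<partial>leb01)"
      using False by (intro nn_integral_mono) (simp add: flat_estimator_eq_half)
    also have "\<dots> = ennreal (1 / I (1/2))"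
      unfolding nn_integral_const L.emeasure_space_1 by (rule mult_1_right)
    finally have "ennreal (?J t / t) * (\<integral>\<^sup>+r. (if t < r then ennreal (1 / ?J r) else 0) \<partial>leb01)
        \<le> ennreal (I (1/2) / t) * ennreal (1 / I (1/2))"
      using False by (simp add: flat_estimator_eq_half mult_left_mono)
    also have "\<dots> = ennreal (1 / t)" using half t by (simp add: ennreal_mult[symmetric])
    also have "\<dots> \<le> ennreal (c + 2)"
    proof (rule ennreal_leI)
      have "1 / t \<le> 2" using False t by (simp add: pos_divide_le_eq)
      then show "1 / t \<le> c + 2" using c by linarith
    qed
    finally show ?thesis .
  next
    case True
    have It: "0 < I t" by (rule estimator_pos[OF est]) (use t in auto)
    have le_It: "1 / ?J r \<le> 1 / I t" if "t \<le> r" "r \<le> 1/2" for r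
    proof -
      have "I t \<le> I r" using t that by (intro estimator_mono[OF est]) auto
      then show ?thesis using It that t by (simp add: flat_estimator_eq frac_le)
    qed
    have Jl [measurable]: "(\<lambda>r. 1 / ?J r) \<in> borel_measurable lebesgue"
      by (rule measurable_completion) simp
    have int: "integrable lebesgue (\<lambda>r. indicator {t..1/2} r *\<^sub>R (1 / ?J r))"
    proof (rule integrableI_bounded_set_indicator[where B="1 / I t"])
      show "AE r in lebesgue. r \<in> {t..1/2} \<longrightarrow> norm (1 / ?J r) \<le> 1 / I t"
        using le_It flat_estimator_nonneg[OF est] by (intro AE_I2) auto
      show "{t..1/2} \<in> sets lebesgue" by simp
      show "emeasure lebesgue {t..1/2} < \<infinity>" by (simp add: emeasure_lborel_Icc_eq)
      show "(\<lambda>r. 1 / ?J r) \<in> borel_measurable lebesgue" by (rule Jl)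
    qed
    have "(LINT s:{t..1/2}|lebesgue. 1 / I s) = (LINT s:{t..1/2}|lebesgue. 1 / ?J s)"
      by (rule set_lebesgue_integral_cong) (use t in \<open>auto simp: flat_estimator_eq\<close>)
    moreover have "(LINT s:{t..1/2}|lebesgue. 1 / I s) \<le> c * (t / I t)"
      by (rule bspec[OF cond]) (use t True in simp)
    ultimately have LI: "integral\<^sup>L lebesgue (\<lambda>r. indicator {t..1/2} r *\<^sub>R (1 / ?J r)) \<le> c * (t / I t)"
      by (simp only: set_lebesgue_integral_def)
    have "(\<integral>\<^sup>+r. (if t < r then ennreal (1 / ?J r) else 0) \<partial>leb01)
        = (\<integral>\<^sup>+r. (if t < r then ennreal (1 / ?J r) else 0) * indicator {0<..<1} r \<partial>lebesgue)"
      by (rule nn_integral_restrict_space) simp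
    also have "\<dots> \<le> (\<integral>\<^sup>+r. ennreal (indicator {t..1/2} r *\<^sub>R (1 / ?J r)) + ennreal (1 / I (1/2)) * indicator {1/2..1::real} r \<partial>lebesgue)"
    proof (rule nn_integral_mono)
      fix r :: real
      consider "r \<le> t \<or> 1 \<le> r" | "t < r" "r \<le> 1/2" "r < 1" | "t < r" "1/2 < r" "r < 1" by linarith
      then show "(if t < r then ennreal (1 / ?J r) else 0) * indicator {0<..<1} r
          \<le> ennreal (indicator {t..1/2} r *\<^sub>R (1 / ?J r)) + ennreal (1 / I (1/2)) * indicator {1/2..1} r"
      proof cases
        case 1
        then show ?thesis by (auto simp: indicator_def)
      next
        case 2
        then show ?thesis using t by (simp add: indicator_def)
      next
        case 3
        then show ?thesis using t by (simp add: indicator_def flat_estimator_eq_half)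
      qed
    qed
    also have "\<dots> = (\<integral>\<^sup>+r. ennreal (indicator {t..1/2} r *\<^sub>R (1 / ?J r)) \<partial>lebesgue) + (\<integral>\<^sup>+r. ennreal (1 / I (1/2)) * indicator {1/2..1::real} r \<partial>lebesgue)"
    proof (rule nn_integral_add)
      show "(\<lambda>r. ennreal (indicator {t..1/2} r *\<^sub>R (1 / ?J r))) \<in> borel_measurable lebesgue"
        by (rule measurable_compose_rev[OF measurable_ennreal borel_measurable_integrable[OF int]])
      have "(\<lambda>r::real. ennreal (1 / I (1/2)) * indicator {1/2..1} r) \<in> borel_measurable borel" by measurable
      then show "(\<lambda>r::real. ennreal (1 / I (1/2)) * indicator {1/2..1} r) \<in> borel_measurable lebesgue"
        by (intro measurable_completion) simp
    qed
    also have "(\<integral>\<^sup>+r. ennreal (indicator {t..1/2} r *\<^sub>R (1 / ?J r)) \<partial>lebesgue)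
        = ennreal (integral\<^sup>L lebesgue (\<lambda>r. indicator {t..1/2} r *\<^sub>R (1 / ?J r)))"
      by (rule nn_integral_eq_integral[OF int]) (use flat_estimator_nonneg[OF est] in auto)
    also have "\<dots> \<le> ennreal (c * (t / I t))" by (rule ennreal_leI[OF LI])
    also have "(\<integral>\<^sup>+r. ennreal (1 / I (1/2)) * indicator {1/2..1::real} r \<partial>lebesgue) = ennreal (1 / I (1/2)) * ennreal (1/2)"
      by (subst nn_integral_cmult_indicator) (simp_all add: emeasure_lborel_Icc_eq)
    also have "\<dots> = ennreal (1 / (2 * I (1/2)))"
      using half by (subst ennreal_mult[symmetric]) (auto simp: mult.commute)
    finally have "(\<integral>\<^sup>+r. (if t < r then ennreal (1 / ?J r) else 0) \<partial>leb01)
        \<le> ennreal (c * (t / I t)) + ennreal (1 / (2 * I (1/2)))" by (simp add: add_right_mono)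
    also have "\<dots> = ennreal (c * (t / I t) + 1 / (2 * I (1/2)))"
      by (rule ennreal_plus[symmetric]) (use c t It half in auto)
    finally have "ennreal (?J t / t) * (\<integral>\<^sup>+r. (if t < r then ennreal (1 / ?J r) else 0) \<partial>leb01)
        \<le> ennreal (?J t / t) * ennreal (c * (t / I t) + 1 / (2 * I (1/2)))"
      by (rule mult_left_mono) simp
    also have "\<dots> = ennreal (?J t / t * (c * (t / I t) + 1 / (2 * I (1/2))))"
      by (rule ennreal_mult[symmetric]) (use c t It half flat_estimator_nonneg[OF est] in auto)
    also have "\<dots> \<le> ennreal (c + 2)"
    proof (rule ennreal_leI)
      have "I t / t \<le> I (1/2) / (1/2)" using True t by (intro estimator_scaling[OF est]) auto
      then have "I t / t \<le> 2 * I (1/2)" by simp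
      then have "I t / t * (1 / (2 * I (1/2))) \<le> 2 * I (1/2) * (1 / (2 * I (1/2)))"
        using half by (intro mult_right_mono) auto
      also have "\<dots> = 1" using half by simp
      finally have "I t / t * (1 / (2 * I (1/2))) \<le> 1" .
      moreover have "I t / t * (c * (t / I t)) = c" using It t by simp
      moreover have "?J t = I t" using True t by (simp add: flat_estimator_eq)
      ultimately show "?J t / t * (c * (t / I t) + 1 / (2 * I (1/2))) \<le> c + 2"
        by (simp only: distrib_left)
    qed
    finally show ?thesis .
  qed
qed

text \<open>A positive quotient with \<open>ln q < 0\<close> forces the logarithm of the dilation norm to be negative. As
  \<open>enn2real\<close> maps \<open>\<infinity>\<close> to \<open>0\<close>, where \<open>ln\<close> is \<open>0\<close>, this excludes the values \<open>0\<close> and \<open>\<infinity>\<close> as well.\<close>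

lemma positive_lower_boyd_indexD:
  assumes "lower_boyd_index N > 0"
  obtains q h where "0 < q" "q < 1" "dilation_norm N q = ennreal h" "0 \<le> h" "h < 1"
proof -
  obtain q where q: "0 < q" "q < 1" and pos: "0 < ln (enn2real (dilation_norm N q)) / ln q"
    using assms unfolding lower_boyd_index_def less_SUP_iff by auto
  let ?h = "enn2real (dilation_norm N q)"
  have "ln q < 0" using q by simp
  then have neg: "ln ?h < 0" using pos by (simp add: zero_less_divide_iff)
  have h0: "?h \<noteq> 0" using neg by auto
  then have h: "0 < ?h" using enn2real_nonneg[of "dilation_norm N q"] by linarith
  have "?h < 1" using neg h by simp
  moreover have "dilation_norm N q = ennreal ?h"
  proof -
    have "dilation_norm N q \<noteq> top" using h0 by auto
    then show ?thesis by (simp add: ennreal_enn2real less_top)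
  qed
  ultimately show ?thesis using q h by (intro that[of q ?h]) auto
qed

lemma rearrangement_abs: "rearrangement M (\<lambda>x. \<bar>u x\<bar>) = rearrangement M u"
  by (simp add: rearrangement_def fun_eq_iff)

text \<open>The coarea inequality on strips, with the lower bound for the contents of the superlevel sets,
  provides the hypothesis that relates levels and gradient.\<close>

lemma level_gradient_of_median:
  fixes M :: "'a::metric_space measure" and g :: "'a \<Rightarrow> real"
  assumes M: "prob_space M" "sets M = sets borel"
    and level: "\<forall>f\<in>Lip. \<forall>c. AE x in M. f x = c \<longrightarrow> grad_modulus f x = 0"
    and est: "convex_isoperimetric_estimator M I" and g: "g \<in> Lip"
    and med: "measure M {x. m < g x} \<le> 1/2" "measure M {x. g x < m} \<le> 1/2"
  shows "level_gradient M (\<lambda>x. \<bar>g x - m\<bar>) (grad_modulus g) (flat_estimator I) (I (1/4) / I (1/2))"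
proof -
  interpret prob_space M by (rule M(1))
  have spM: "space M = UNIV" using sets_eq_imp_space_eq[OF M(2)] by simp
  let ?w = "\<lambda>x. \<bar>g x - m\<bar>" and ?c = "I (1/4) / I (1/2)"
  obtain L where L: "L-lipschitz_on UNIV g" using g by (auto simp: Lip_def)
  have w_le: "\<bar>?w x - ?w y\<bar> \<le> \<bar>g x - g y\<bar>" for x y by linarith
  have w_Lip: "?w \<in> Lip" using lipschitz_on_mono_dist[OF L w_le] by (auto simp: Lip_def)
  have w: "?w \<in> borel_measurable M" by (rule Lip_measurable[OF M(2) w_Lip])
  have \<phi>: "grad_modulus g \<in> borel_measurable M" by (rule Lip_measurable[OF M(2) g])
  have \<nu>: "dist_fun M ?w s = measure M {x. s < ?w x}" for s
    by (simp add: dist_fun_def spM)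
  have J: "(\<lambda>s. ?c * flat_estimator I (dist_fun M ?w s)) \<in> borel_measurable borel"
    by (intro borel_measurable_times borel_measurable_const
      measurable_compose[OF dist_fun_measurable[OF w] flat_estimator_measurable[OF est]])
  have c: "0 < ?c"
    by (intro divide_pos_pos estimator_pos[OF est]) auto
  show ?thesis
  proof
    show "?w \<in> borel_measurable M" by (rule w)
    show "grad_modulus g \<in> borel_measurable M" by (rule \<phi>)
    show "0 \<le> grad_modulus g x" for x by (rule grad_modulus_nonneg)
    have "(\<integral>\<^sup>+x. ennreal (grad_modulus g x) \<partial>M) \<le> (\<integral>\<^sup>+x. ennreal L \<partial>M)"
      by (intro nn_integral_mono ennreal_leI grad_modulus_le_lipschitz[OF L])
    also have "\<dots> < \<infinity>" by (simp add: emeasure_space_1)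
    finally show "(\<integral>\<^sup>+x. ennreal (grad_modulus g x) \<partial>M) < \<infinity>" .
    show "flat_estimator I \<in> borel_measurable borel" by (rule flat_estimator_measurable[OF est])
    show "0 < flat_estimator I t" if "0 < t" for t by (rule flat_estimator_pos[OF est that])
    show "0 \<le> flat_estimator I t" for t by (rule flat_estimator_nonneg[OF est])
    show "flat_estimator I t / t \<le> 2 * (flat_estimator I r / r)" if "0 < t" "t \<le> r" "r \<le> 1" for t r
      by (rule flat_estimator_ratio[OF est that])
    show "0 < ?c" by (rule c)
    fix a b :: real assume ab: "0 \<le> a" "a < b"
    have "(\<integral>\<^sup>+s. ennreal (?c * flat_estimator I (dist_fun M ?w s)) * indicator {a<..<b} s \<partial>lborel)
        \<le> (\<integral>\<^sup>+x. ennreal (grad_modulus ?w x) * indicator {a<..<b} (?w x) \<partial>M)"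
    proof (rule coarea_strip[OF M level w_Lip J _ _ ab])
      show "0 \<le> ?c * flat_estimator I (dist_fun M ?w s)" for s
        using c flat_estimator_nonneg[OF est] by (intro mult_nonneg_nonneg) auto
      show "ereal (?c * flat_estimator I (dist_fun M ?w s)) \<le> minkowski_content M {x. s < ?w x}" if "0 < s" for s
        unfolding \<nu> by (rule median_content_lower_bound[OF M est g med that])
    qed
    also have "\<dots> \<le> (\<integral>\<^sup>+x. ennreal (grad_modulus g x) * indicator {a<..<b} (?w x) \<partial>M)"
      by (intro nn_integral_mono mult_right_mono ennreal_leI grad_modulus_mono[OF g w_le]) simp
    finally show "(\<integral>\<^sup>+s. ennreal (?c * flat_estimator I (dist_fun M ?w s)) * indicator {a<..<b} s \<partial>lborel)
        \<le> (\<integral>\<^sup>+x. ennreal (grad_modulus g x) * indicator {a<..<b} (?w x) \<partial>M)" .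
  qed auto
qed

lemma estimator_weight_measurable:
  assumes est: "convex_isoperimetric_estimator M I"
  shows "(\<lambda>t. I t / t) \<in> borel_measurable leb01"
proof -
  have "continuous_on {0..1} I" using est by (simp add: convex_isoperimetric_estimator_def)
  then have "continuous_on {0<..<1} I" by (rule continuous_on_subset) auto
  then have "continuous_on {0<..<1} (\<lambda>t. I t / t)" by (intro continuous_on_divide continuous_on_id) auto
  then show ?thesis by (intro borel_measurable_leb01I borel_measurable_continuous_on_restrict)
qed

lemma lipschitz_weighted_bound:
  fixes M :: "'a::metric_space measure"
  assumes M: "prob_space M" "sets M = sets borel"
    and level: "\<forall>f\<in>Lip. \<forall>c. AE x in M. f x = c \<longrightarrow> grad_modulus f x = 0"
    and est: "convex_isoperimetric_estimator M I"
    and ri: "ri_space leb01 N"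
    and cond: "lower_boyd_index N > 0 \<or>
         (\<exists>c>0. \<forall>t\<in>{0<..<1/2}. (LINT s:{t..1/2}|lebesgue. 1 / I s) \<le> c * (t / I t))"
  obtains C where "0 < C"
    "\<And>g. g \<in> Lip \<Longrightarrow> \<exists>m. N (\<lambda>t. rearrangement M (\<lambda>x. g x - m) t * (I t / t)) \<le> ennreal C * N (rearrangement M (grad_modulus g))"
proof -
  interpret prob_space M by (rule M(1))
  have spM: "space M = UNIV" using sets_eq_imp_space_eq[OF M(2)] by simp
  have lq: "lattice_quasinorm leb01 1 N"
    using ri by (auto simp: ri_space_def banach_function_space_def)
  let ?c = "I (1/4) / I (1/2)"
  have c: "0 < ?c" by (intro divide_pos_pos estimator_pos[OF est]) auto
  have "\<exists>C>0. \<forall>w \<phi>. level_gradient M w \<phi> (flat_estimator I) ?c \<longrightarrow>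
      N (\<lambda>t. rearrangement M w t * (flat_estimator I t / t)) \<le> ennreal C * N (rearrangement M \<phi>)"
    using cond
  proof
    assume "lower_boyd_index N > 0"
    then obtain q h where q: "0 < q" "q < 1" and h: "dilation_norm N q = ennreal h" "0 \<le> h" "h < 1"
      by (rule positive_lower_boyd_indexD)
    let ?C = "2 / (q * ?c) * (1 / (1 - h))"
    have "N (\<lambda>t. rearrangement M w t * (flat_estimator I t / t)) \<le> ennreal ?C * N (rearrangement M \<phi>)"
      if lg: "level_gradient M w \<phi> (flat_estimator I) ?c" for w \<phi>
    proof -
      have "N (\<lambda>t. rearrangement M w t * (flat_estimator I t / t))
          \<le> ennreal (2 / (q * ?c)) * N (\<lambda>t. \<Sum>j. rearrangement M \<phi> (t / q ^ j))"
        by (rule level_gradient.norm_bound_of_dilations[OF lg ri q])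
      also have "\<dots> \<le> ennreal (2 / (q * ?c)) * (ennreal (1 / (1 - h)) * N (rearrangement M \<phi>))"
        by (rule mult_left_mono[OF norm_sum_dilates_le[OF ri level_gradient.\<phi>[OF lg] q h]]) simp
      also have "\<dots> = ennreal ?C * N (rearrangement M \<phi>)"
        using q c h by (simp only: mult.assoc[symmetric] ennreal_mult'[symmetric] divide_nonneg_nonneg
          mult_nonneg_nonneg less_imp_le zero_le_one zero_le_numeral diff_ge_0_iff_ge)
      finally show ?thesis .
    qed
    moreover have "0 < ?C"
    proof (rule mult_pos_pos)
      show "0 < 2 / (q * ?c)" by (rule divide_pos_pos[OF _ mult_pos_pos[OF q(1) c]]) simp
      show "0 < 1 / (1 - h)" using h by simp
    qed
    ultimately show ?thesis by blast
  next
    assume "\<exists>c>0. \<forall>t\<in>{0<..<1/2}. (LINT s:{t..1/2}|lebesgue. 1 / I s) \<le> c * (t / I t)"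
    then obtain c' where c': "0 < c'" "\<forall>t\<in>{0<..<1/2}. (LINT s:{t..1/2}|lebesgue. 1 / I s) \<le> c' * (t / I t)"
      by blast
    have "N (\<lambda>t. rearrangement M w t * (flat_estimator I t / t)) \<le> ennreal ((c' + 2) / ?c) * N (rearrangement M \<phi>)"
      if lg: "level_gradient M w \<phi> (flat_estimator I) ?c" for w \<phi>
      by (rule level_gradient.norm_bound_of_integral_condition[OF lg ri _ integral_condition_flat[OF est c']])
         (use c' in simp)
    moreover have "0 < (c' + 2) / ?c" by (rule divide_pos_pos[OF _ c]) (use c'(1) in simp)
    ultimately show ?thesis by blast
  qed
  then obtain C where C: "0 < C" "\<And>w \<phi>. level_gradient M w \<phi> (flat_estimator I) ?c \<Longrightarrow>
      N (\<lambda>t. rearrangement M w t * (flat_estimator I t / t)) \<le> ennreal C * N (rearrangement M \<phi>)"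
    by blast
  show ?thesis
  proof (rule that[OF C(1)])
    fix g :: "'a \<Rightarrow> real" assume g: "g \<in> Lip"
    obtain m where m: "measure M {x. m < g x} \<le> 1/2" "measure M {x. g x < m} \<le> 1/2"
      using median_exists[OF Lip_measurable(1)[OF M(2) g]] by (auto simp: spM)
    let ?w = "\<lambda>x. \<bar>g x - m\<bar>"
    have lg: "level_gradient M ?w (grad_modulus g) (flat_estimator I) ?c"
      by (rule level_gradient_of_median[OF M level est g m])
    have w: "?w \<in> borel_measurable M" by (rule level_gradient.w[OF lg])
    have "N (\<lambda>t. rearrangement M ?w t * (I t / t)) \<le> N (\<lambda>t. rearrangement M ?w t * (flat_estimator I t / t))"
    proof (rule lattice_quasinorm_mono[OF lq _ level_gradient.weighted_rearrangement_measurable[OF lg]])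
      show "(\<lambda>t. rearrangement M ?w t * (I t / t)) \<in> borel_measurable leb01"
        by (rule borel_measurable_times[OF rearrangement_measurable[OF w] estimator_weight_measurable[OF est]])
      fix t :: real assume t: "0 < t" "t < 1"
      have r0: "0 \<le> rearrangement M ?w t" by (rule rearrangement_nonneg[OF w t(1)])
      have I0: "0 \<le> I t / t" using estimator_pos[OF est t] t by simp
      have "I t / t \<le> flat_estimator I t / t"
        using t by (intro divide_right_mono estimator_le_flat[OF est]) auto
      then have "rearrangement M ?w t * (I t / t) \<le> rearrangement M ?w t * (flat_estimator I t / t)"
        by (rule mult_left_mono[OF _ r0])
      moreover have "0 \<le> rearrangement M ?w t * (I t / t)" by (rule mult_nonneg_nonneg[OF r0 I0])
      ultimately show "\<bar>rearrangement M ?w t * (I t / t)\<bar> \<le> \<bar>rearrangement M ?w t * (flat_estimator I t / t)\<bar>"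
        by linarith
    qed
    also have "\<dots> \<le> ennreal C * N (rearrangement M (grad_modulus g))" by (rule C(2)[OF lg])
    finally show "\<exists>m. N (\<lambda>t. rearrangement M (\<lambda>x. g x - m) t * (I t / t)) \<le> ennreal C * N (rearrangement M (grad_modulus g))"
      unfolding rearrangement_abs by blast
  qed
qed

section \<open>The isoperimetric Hardy operator\<close>

text \<open>Dividing by \<open>I\<close> in the operator leaves \<open>u\<^sup>* s / s\<close>, whose integral over \<open>[t, 2 t]\<close> alone is at least
  \<open>u\<^sup>*(2 t) / 2\<close>.\<close>

lemma hardy_op_weighted_rearrangement:
  assumes M: "prob_space M" and u: "u \<in> borel_measurable M" and I: "\<And>t. 0 < t \<Longrightarrow> t < 1 \<Longrightarrow> 0 < I t"
  defines "H \<equiv> hardy_op I (\<lambda>t. rearrangement M u t * (I t / t))"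
  shows "H \<in> borel_measurable leb01" and "\<And>t. 0 \<le> H t"
    and "\<And>t. 0 < t \<Longrightarrow> t < 1/4 \<Longrightarrow> rearrangement M u (2 * t) / 2 \<le> H t"
proof -
  interpret prob_space M by (rule M)
  define h where "h s = (if 0 < s then rearrangement M u s else 0) / s" for s
  have h0: "0 \<le> h s" for s
    using rearrangement_nonneg[OF u, of s] by (simp add: h_def)
  have hm: "h \<in> borel_measurable lebesgue"
    unfolding h_def[abs_def]
    by (intro measurable_completion borel_measurable_divide)
       (use rearrangement_borel_extension[OF u] in simp_all)
  have H_eq: "H t = integral\<^sup>L lebesgue (\<lambda>s. indicator {t..1/2} s *\<^sub>R h s)" if t: "0 < t" "t < 1/2" for t
  proof -
    have "H t = (LINT s:{t..1/2}|lebesgue. rearrangement M u s * (I s / s) / I s)"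
      using t by (simp add: H_def hardy_op_def)
    also have "\<dots> = (LINT s:{t..1/2}|lebesgue. h s)"
    proof (rule set_lebesgue_integral_cong)
      show "\<forall>s. s \<in> {t..1/2} \<longrightarrow> rearrangement M u s * (I s / s) / I s = h s"
      proof (intro allI impI)
        fix s assume "s \<in> {t..1/2}"
        then have s: "0 < s" "s < 1" using t by auto
        show "rearrangement M u s * (I s / s) / I s = h s" using I[OF s] s by (simp add: h_def)
      qed
    qed simp
    finally show ?thesis by (simp only: set_lebesgue_integral_def)
  qed
  have H_0: "H t = 0" if "\<not> (0 < t \<and> t < 1/2)" for t using that by (auto simp: H_def hardy_op_def)
  have int: "integrable lebesgue (\<lambda>s. indicator {t..b} s *\<^sub>R h s)" if t: "0 < t" for t b
  proof (rule integrableI_bounded_set_indicator[where B="h t", OF _ hm])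
    show "AE s in lebesgue. s \<in> {t..b} \<longrightarrow> norm (h s) \<le> h t"
    proof (intro AE_I2 impI)
      fix s assume "s \<in> {t..b}"
      then have s: "t \<le> s" by simp
      have "h s \<le> h t"
        unfolding h_def using s t rearrangement_antimono[OF u t s] rearrangement_nonneg[OF u t]
        by (simp add: frac_le)
      then show "norm (h s) \<le> h t" using h0 by simp
    qed
    show "{t..b} \<in> sets lebesgue" by simp
    show "emeasure lebesgue {t..b} < \<infinity>" by (simp add: emeasure_lborel_Icc_eq)
  qed
  show H0: "0 \<le> H t" for t
  proof (cases "0 < t \<and> t < 1/2")
    case True
    then show ?thesis by (simp add: H_eq) (intro Bochner_Integration.integral_nonneg mult_nonneg_nonneg h0; simp)
  qed (simp add: H_0)
  show "H \<in> borel_measurable leb01"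
  proof (rule antimono_measurable_leb01)
    fix x y :: real assume xy: "0 < x" "x \<le> y" "y < 1"
    show "H y \<le> H x"
    proof (cases "y < 1/2")
      case True
      have "integral\<^sup>L lebesgue (\<lambda>s. indicator {y..1/2} s *\<^sub>R h s) \<le> integral\<^sup>L lebesgue (\<lambda>s. indicator {x..1/2} s *\<^sub>R h s)"
        using xy h0 by (intro integral_mono int) (auto simp: indicator_def)
      then show ?thesis using xy True by (simp add: H_eq)
    next
      case False
      then show ?thesis using H_0[of y] H0[of x] by simp
    qed
  qed
  fix t :: real assume t: "0 < t" "t < 1/4"
  have t2: "0 < 2 * t" using t by simp
  let ?r = "rearrangement M u (2 * t) / (2 * t)"
  have r0: "0 \<le> ?r" using rearrangement_nonneg[OF u t2] t by simp
  have int': "integrable lebesgue (\<lambda>s. indicator {t..2 * t} s *\<^sub>R ?r)"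
    by (rule integrableI_bounded_set_indicator[where B="?r"]) (use r0 in \<open>auto simp: emeasure_lborel_Icc_eq\<close>)
  have "measure lebesgue {t..2 * t} = t" using t by simp
  then have "rearrangement M u (2 * t) / 2 = integral\<^sup>L lebesgue (\<lambda>s. indicator {t..2 * t} s *\<^sub>R ?r)"
    using t by simp
  also have "\<dots> \<le> integral\<^sup>L lebesgue (\<lambda>s. indicator {t..1/2} s *\<^sub>R h s)"
  proof (rule integral_mono[OF int' int[OF t(1)]])
    fix s :: real
    show "indicator {t..2 * t} s *\<^sub>R ?r \<le> indicator {t..1/2} s *\<^sub>R h s"
    proof (cases "s \<in> {t..2 * t}")
      case True
      then have s: "0 < s" "s \<le> 2 * t" "t \<le> s" using t by auto
      have "?r \<le> rearrangement M u s / s"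
        using rearrangement_antimono[OF u s(1,2)] rearrangement_nonneg[OF u s(1)] s t by (simp add: frac_le)
      then have "?r \<le> h s" using s by (simp add: h_def)
      then show ?thesis using True s t by simp
    next
      case False
      then have "indicator {t..2 * t} s *\<^sub>R ?r = 0" by simp
      moreover have "0 \<le> indicator {t..1/2} s *\<^sub>R h s" using h0[of s] by (simp add: indicator_def)
      ultimately show ?thesis by linarith
    qed
  qed
  also have "\<dots> = H t" using t by (simp add: H_eq)
  finally show "rearrangement M u (2 * t) / 2 \<le> H t" .
qed

lemma lattice_quasinorm_weaken:
  assumes "lattice_quasinorm M C N" "C \<le> D"
  shows "lattice_quasinorm M D N"
proof -
  have "ennreal C * x \<le> ennreal D * x" for x :: ennreal
    using assms(2) by (intro mult_right_mono ennreal_leI) simp_all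
  then show ?thesis using assms(1) unfolding lattice_quasinorm_def by (meson order_trans)
qed

text \<open>The function that equals \<open>u\<^sup>*(2 t)\<close> on \<open>(0, 1/4)\<close> and vanishes elsewhere is at most \<open>2 H\<close>. It has
  half the distribution function of \<open>u\<close>, cut off at \<open>1/4\<close>, so the sum of four disjoint translates of
  it has at least the distribution function of \<open>u\<close>.\<close>

lemma norm_rearrangement_le_quarter:
  assumes M: "prob_space M" and u: "u \<in> borel_measurable M"
    and lq: "lattice_quasinorm leb01 K N" and inv: "rearrangement_invariant leb01 N" and K: "0 \<le> K"
    and H: "H \<in> borel_measurable leb01" and H0: "\<And>t. 0 \<le> H t"
    and le: "\<And>t. 0 < t \<Longrightarrow> t < 1/4 \<Longrightarrow> rearrangement M u (2 * t) / 2 \<le> H t"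
  shows "N (rearrangement M u) \<le> ennreal (8 * K\<^sup>2) * N H"
proof -
  interpret prob_space M by (rule M)
  interpret L: prob_space leb01 by (rule prob_space_leb01)
  define \<psi> where "\<psi> x = (if 0 < x then rearrangement M u x else 0)" for x
  have \<psi> [measurable]: "\<psi> \<in> borel_measurable borel"
    unfolding \<psi>_def[abs_def] by (rule rearrangement_borel_extension[OF u])
  have \<psi>0: "0 \<le> \<psi> x" for x using rearrangement_nonneg[OF u, of x] by (simp add: \<psi>_def)
  define D where "D j t = (if real j / 4 < t \<and> t < (real j + 1) / 4 then \<psi> (2 * (t - real j / 4)) else 0)" for j t
  have Db: "D j \<in> borel_measurable borel" for j unfolding D_def[abs_def] by measurable
  have Dm [measurable]: "D j \<in> borel_measurable leb01" for j
    by (rule measurable_compose[OF id_measurable_leb01 Db])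
  have D0: "0 \<le> D j t" for j t by (simp add: D_def \<psi>0)
  define \<delta> where "\<delta> \<tau> = min (dist_fun M u \<tau> / 2) (1/4)" for \<tau>
  have \<delta>: "0 \<le> \<delta> \<tau>" "\<delta> \<tau> \<le> 1/4" for \<tau> using dist_fun_bounds(1)[of u \<tau>] by (auto simp: \<delta>_def)
  have D_iff: "\<tau> < D j t \<longleftrightarrow> real j / 4 < t \<and> t < real j / 4 + \<delta> \<tau>" if \<tau>: "0 \<le> \<tau>" for j t \<tau>
  proof (cases "real j / 4 < t \<and> t < (real j + 1) / 4")
    case True
    then have x: "0 < 2 * (t - real j / 4)" by simp
    have "\<tau> < D j t \<longleftrightarrow> 2 * (t - real j / 4) < dist_fun M u \<tau>"
      using True x less_rearrangement_iff[OF u x \<tau>] by (simp add: D_def \<psi>_def)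
    also have "\<dots> \<longleftrightarrow> t < real j / 4 + \<delta> \<tau>"
      using True by (auto simp: \<delta>_def add_divide_distrib)
    finally show ?thesis using True by simp
  next
    case False
    have "(real j + 1) / 4 = real j / 4 + 1/4" by (simp add: add_divide_distrib)
    then show ?thesis using False \<tau> \<delta>(2)[of \<tau>] by (simp add: D_def) linarith
  qed
  have D_set: "{t \<in> space leb01. \<tau> < \<bar>D j t\<bar>} = {real j / 4<..<real j / 4 + \<delta> \<tau>}" if \<tau>: "0 \<le> \<tau>" and j: "j < 4" for j \<tau>
  proof (rule set_eqI)
    fix t
    have "real j / 4 + \<delta> \<tau> \<le> 1" using \<delta>(2)[of \<tau>] j by linarith
    moreover have "0 \<le> real j / 4" by simp
    moreover have "t \<in> space leb01 \<longleftrightarrow> 0 < t \<and> t < 1" by (auto simp: space_restrict_space)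
    moreover have "\<bar>D j t\<bar> = D j t" using D0 by simp
    ultimately show "t \<in> {t \<in> space leb01. \<tau> < \<bar>D j t\<bar>} \<longleftrightarrow> t \<in> {real j / 4<..<real j / 4 + \<delta> \<tau>}"
      unfolding mem_Collect_eq greaterThanLessThan_iff using D_iff[OF \<tau>, of j t] by linarith
  qed
  have D_meas: "measure leb01 {t \<in> space leb01. \<tau> < \<bar>D j t\<bar>} = \<delta> \<tau>" if \<tau>: "0 \<le> \<tau>" and j: "j < 4" for j \<tau>
  proof -
    have "{real j / 4<..<real j / 4 + \<delta> \<tau>} \<subseteq> {0<..<1}"
    proof
      fix x assume "x \<in> {real j / 4<..<real j / 4 + \<delta> \<tau>}"
      moreover have "0 \<le> real j / 4" "real j / 4 + \<delta> \<tau> \<le> 1" using \<delta>(2)[of \<tau>] j by auto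
      ultimately show "x \<in> {0<..<1}" unfolding greaterThanLessThan_iff by linarith
    qed
    then have "measure leb01 {real j / 4<..<real j / 4 + \<delta> \<tau>} = measure lborel {real j / 4<..<real j / 4 + \<delta> \<tau>}"
      by (intro measure_leb01) simp_all
    then show ?thesis unfolding D_set[OF that] using \<delta>(1)[of \<tau>] by simp
  qed
  define T where "T t = (D 0 t + D 1 t) + (D 2 t + D 3 t)" for t
  have T_sum: "T t = (\<Sum>j<4. D j t)" for t by (simp add: T_def eval_nat_numeral)
  have Tm [measurable]: "T \<in> borel_measurable leb01" unfolding T_def[abs_def] by measurable
  have "N (rearrangement M u) \<le> N T"
  proof (rule norm_mono_dist_fun[OF lq inv rearrangement_measurable[OF u] Tm])
    fix \<tau> :: real assume \<tau>: "0 \<le> \<tau>"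
    let ?A = "\<lambda>j. {t \<in> space leb01. \<tau> < \<bar>D j t\<bar>}"
    have A: "?A j \<in> sets leb01" for j by measurable
    have disj: "disjoint_family_on ?A {..<4}"
      unfolding disjoint_family_on_def
    proof (intro ballI impI)
      fix i j :: nat assume ij: "i \<in> {..<4}" "j \<in> {..<4}" "i \<noteq> j"
      have "real i + 1 \<le> real j \<or> real j + 1 \<le> real i" using ij(3) by linarith
      then show "?A i \<inter> ?A j = {}"
        using ij D_set[OF \<tau>, of i] D_set[OF \<tau>, of j] \<delta>(2)[of \<tau>] by auto
    qed
    have "dist_fun M u \<tau> \<le> 4 * \<delta> \<tau>"
      using dist_fun_bounds[of u \<tau>] by (simp add: \<delta>_def min_def)
    also have "4 * \<delta> \<tau> = (\<Sum>j<4. measure leb01 (?A j))"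
      using D_meas[OF \<tau>] by simp
    also have "\<dots> = measure leb01 (\<Union>j<4. ?A j)"
      by (rule L.finite_measure_finite_Union[symmetric, OF finite_lessThan _ disj]) (use A in blast)
    also have "\<dots> \<le> measure leb01 {t \<in> space leb01. \<tau> < \<bar>T t\<bar>}"
    proof (rule L.finite_measure_mono)
      show "(\<Union>j<4. ?A j) \<subseteq> {t \<in> space leb01. \<tau> < \<bar>T t\<bar>}"
      proof safe
        fix t j assume j: "j < (4::nat)" and "\<tau> < \<bar>D j t\<bar>"
        then have "\<tau> < D j t" using D0 by simp
        also have "\<dots> \<le> T t" unfolding T_sum using j D0 by (intro member_le_sum) auto
        finally show "\<tau> < \<bar>T t\<bar>" by simp
      qed
      show "{t \<in> space leb01. \<tau> < \<bar>T t\<bar>} \<in> sets leb01" by measurable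
    qed
    finally show "dist_fun leb01 (rearrangement M u) \<tau> \<le> dist_fun leb01 T \<tau>"
      unfolding dist_fun_rearrangement[OF u \<tau>] by (simp only: dist_fun_def)
  qed
  also have "N T \<le> ennreal K * (N (\<lambda>t. D 0 t + D 1 t) + N (\<lambda>t. D 2 t + D 3 t))"
    unfolding T_def by (rule lattice_quasinorm_add[OF lq]) measurable
  also have "\<dots> \<le> ennreal K * (ennreal K * (N (D 0) + N (D 1)) + ennreal K * (N (D 2) + N (D 3)))"
    by (intro mult_left_mono add_mono lattice_quasinorm_add[OF lq] Dm) simp
  also have "\<dots> \<le> ennreal K * (ennreal K * (N (D 0) + N (D 0)) + ennreal K * (N (D 0) + N (D 0)))"
  proof -
    have "N (D j) \<le> N (D 0)" if "j < 4" for j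
    proof (rule norm_mono_dist_fun[OF lq inv Dm Dm])
      fix \<tau> :: real assume \<tau>: "0 \<le> \<tau>"
      show "dist_fun leb01 (D j) \<tau> \<le> dist_fun leb01 (D 0) \<tau>"
        unfolding dist_fun_def D_meas[OF \<tau> that] using D_meas[OF \<tau>, of 0] by simp
    qed
    then show ?thesis by (intro mult_left_mono add_mono) auto
  qed
  also have "\<dots> = ennreal K * ennreal K * 4 * N (D 0)"
  proof -
    have "k * (k * (x + x) + k * (x + x)) = k * k * 4 * x" for k x :: ennreal
    proof -
      have "k * (k * (x + x) + k * (x + x)) = k * k * ((x + x) + (x + x))"
        by (simp only: distrib_left[symmetric] mult.assoc)
      also have "(x + x) + (x + x) = 4 * x"
        by (simp only: mult_2[symmetric] mult.assoc[symmetric]) simp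
      finally show ?thesis by (simp only: mult.assoc)
    qed
    then show ?thesis .
  qed
  also have "N (D 0) \<le> N (\<lambda>t. 2 * H t)"
  proof (rule lattice_quasinorm_mono[OF lq Dm])
    show "(\<lambda>t. 2 * H t) \<in> borel_measurable leb01" using H by measurable
    fix t :: real assume t: "0 < t" "t < 1"
    have "D 0 t \<le> 2 * H t"
    proof (cases "t < 1/4")
      case True
      then show ?thesis using le[OF t(1) True] t by (simp add: D_def \<psi>_def)
    next
      case False
      then show ?thesis using H0[of t] by (simp add: D_def)
    qed
    then show "\<bar>D 0 t\<bar> \<le> \<bar>2 * H t\<bar>" using D0[of 0 t] by linarith
  qed
  also have "N (\<lambda>t. 2 * H t) = 2 * N H" by (simp add: lattice_quasinorm_cmult[OF lq H])
  finally have "N (rearrangement M u) \<le> ennreal K * ennreal K * 4 * (2 * N H)"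
    by (simp add: mult_left_mono)
  also have "\<dots> = ennreal (8 * K\<^sup>2) * N H"
  proof -
    have "ennreal (8 * K\<^sup>2) = 8 * (ennreal K * ennreal K)"
      using K by (simp add: power2_eq_square ennreal_mult)
    then show ?thesis by (simp add: ac_simps)
  qed
  finally show ?thesis .
qed

lemma qri_norm_rearrangement_le:
  assumes M: "prob_space M" and u: "u \<in> borel_measurable M"
    and est: "convex_isoperimetric_estimator \<Omega> I"
    and lq: "lattice_quasinorm leb01 K Y" and inv: "rearrangement_invariant leb01 Y" and K: "1 \<le> K"
    and C\<^sub>0: "0 < C\<^sub>0" and hardy: "\<forall>f\<in>fspace leb01 N. Y (hardy_op I f) \<le> ennreal C\<^sub>0 * N f"
  shows "Y (rearrangement M u) \<le> ennreal (8 * K\<^sup>2 * C\<^sub>0) * N (\<lambda>t. rearrangement M u t * (I t / t))"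
proof -
  let ?f = "\<lambda>t. rearrangement M u t * (I t / t)"
  have fm: "?f \<in> borel_measurable leb01"
    by (rule borel_measurable_times[OF prob_space.rearrangement_measurable[OF M u] estimator_weight_measurable[OF est]])
  have pos: "0 < 8 * K\<^sup>2 * C\<^sub>0" using K C\<^sub>0 by simp
  show ?thesis
  proof (cases "N ?f < \<infinity>")
    case False
    then have top: "N ?f = top" by (simp add: less_top[symmetric])
    have "ennreal (8 * K\<^sup>2 * C\<^sub>0) \<noteq> 0" using pos by (simp only: ennreal_eq_0_iff not_le)
    then show ?thesis unfolding top by (simp only: ennreal_mult_top if_False top_greatest)
  next
    case True
    then have f: "?f \<in> fspace leb01 N" using fm by (simp add: fspace_def)
    note H = hardy_op_weighted_rearrangement[OF M u estimator_pos[OF est]]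
    have "Y (rearrangement M u) \<le> ennreal (8 * K\<^sup>2) * Y (hardy_op I ?f)"
      by (rule norm_rearrangement_le_quarter[OF M u lq inv _ H]) (use K in simp)
    also have "\<dots> \<le> ennreal (8 * K\<^sup>2) * (ennreal C\<^sub>0 * N ?f)"
      using hardy f by (intro mult_left_mono) auto
    also have "\<dots> = ennreal (8 * K\<^sup>2 * C\<^sub>0) * N ?f"
      using C\<^sub>0 by (simp add: mult.assoc[symmetric] ennreal_mult[symmetric])
    finally show ?thesis .
  qed
qed

lemma INF_le_cmult_INF:
  fixes f g :: "'i \<Rightarrow> ennreal"
  assumes C: "0 < C" and le: "\<And>c. f c \<le> ennreal C * g c"
  shows "(INF c. f c) \<le> ennreal C * (INF c. g c)"
proof -
  have inv: "ennreal C * ennreal (1 / C) = 1" "ennreal (1 / C) * ennreal C = 1"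
    using C by (simp_all add: ennreal_mult[symmetric])
  have "ennreal (1 / C) * (INF c. f c) \<le> (INF c. g c)"
  proof (rule INF_greatest)
    fix c
    have "ennreal (1 / C) * (INF c. f c) \<le> ennreal (1 / C) * (ennreal C * g c)"
    proof (rule mult_left_mono)
      have "(INF c. f c) \<le> f c" by (rule INF_lower) simp
      then show "(INF c. f c) \<le> ennreal C * g c" using le[of c] by (rule order_trans)
    qed simp
    then show "ennreal (1 / C) * (INF c. f c) \<le> g c" using inv by (simp add: mult.assoc[symmetric])
  qed
  then have "ennreal C * (ennreal (1 / C) * (INF c. f c)) \<le> ennreal C * (INF c. g c)"
    by (rule mult_left_mono) simp
  then show ?thesis using inv by (simp add: mult.assoc[symmetric])
qed

theorem theorem11:
  fixes M :: "'a::metric_space measure"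
    and I :: "real \<Rightarrow> real"
    and X :: "('a \<Rightarrow> real) \<Rightarrow> ennreal"
    and Xbar :: "(real \<Rightarrow> real) \<Rightarrow> ennreal"
  assumes "connected (UNIV :: 'a set)"
    and "sets M = sets borel"
    and "prob_space M"
    and "separable_measure M"
    and "nonatomic_measure M"
    and "\<forall>f\<in>Lip. \<forall>c. AE x in M. f x = c \<longrightarrow> grad_modulus f x = 0"
    and "convex_isoperimetric_estimator M I"
    and "ri_space M X"
    and "representation_space M X Xbar"
    and "lower_boyd_index Xbar > 0 \<or>
         (\<exists>c>0. \<forall>t\<in>{0<..<1/2}. (LINT s:{t..1/2}|lebesgue. 1 / I s) \<le> c * (t / I t))"
  shows
    "(\<exists>C>0. \<forall>g\<in>Lip.
        (INF c. Xbar (\<lambda>t. rearrangement M (\<lambda>x. g x - c) t * (I t / t)))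
          \<le> ennreal C * X (grad_modulus g))
     \<and>
     (\<forall>Y. qri_space leb01 Y \<and>
        (\<exists>C0>0. \<forall>f\<in>fspace leb01 Xbar. Y (hardy_op I f) \<le> ennreal C0 * Xbar f) \<longrightarrow>
        (\<exists>C'>0. \<forall>g\<in>borel_measurable (completion M).
           Y (rearrangement (completion M) g)
             \<le> ennreal C' * Xbar (\<lambda>t. rearrangement (completion M) g t * (I t / t)))
        \<and>
        (\<exists>C'>0. \<exists>C''>0. \<forall>g\<in>Lip.
           (INF c. Y (rearrangement M (\<lambda>x. g x - c)))
             \<le> ennreal C' * (INF c. Xbar (\<lambda>t. rearrangement M (\<lambda>x. g x - c) t * (I t / t)))
           \<and>
           ennreal C' * (INF c. Xbar (\<lambda>t. rearrangement M (\<lambda>x. g x - c) t * (I t / t)))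
             \<le> ennreal C'' * X (grad_modulus g)))"
proof -
  note M = assms(3) assms(2) and est = assms(7)
  interpret prob_space M by (rule assms(3))
  have ri: "ri_space leb01 Xbar" and rep: "\<And>f. f \<in> fspace M X \<Longrightarrow> X f = Xbar (rearrangement M f)"
    using assms(9) by (auto simp: representation_space_def)
  let ?W = "\<lambda>g c. Xbar (\<lambda>t. rearrangement M (\<lambda>x. g x - c) t * (I t / t))"
  obtain C where C: "0 < C" "\<And>g. g \<in> Lip \<Longrightarrow> \<exists>m. ?W g m \<le> ennreal C * Xbar (rearrangement M (grad_modulus g))"
    using lipschitz_weighted_bound[OF M assms(6) est ri assms(10)] by blast
  have first: "(INF c. ?W g c) \<le> ennreal C * X (grad_modulus g)" if g: "g \<in> Lip" for g
  proof (cases "X (grad_modulus g) < \<infinity>")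
    case True
    have "grad_modulus g \<in> borel_measurable M" by (rule Lip_measurable[OF M(2) g])
    then have "X (grad_modulus g) = Xbar (rearrangement M (grad_modulus g))"
      using True by (intro rep) (simp add: fspace_def)
    then obtain m where "?W g m \<le> ennreal C * X (grad_modulus g)" using C(2)[OF g] by auto
    then show ?thesis by (rule INF_lower2[OF UNIV_I])
  next
    case False
    then have "X (grad_modulus g) = top" by (simp add: less_top[symmetric])
    then show ?thesis using C(1) by (simp add: ennreal_mult_top)
  qed
  show ?thesis
  proof (intro conjI allI impI)
    show "\<exists>C>0. \<forall>g\<in>Lip. (INF c. ?W g c) \<le> ennreal C * X (grad_modulus g)"
      using C(1) first by blast
  next
    fix Y assume Y: "qri_space leb01 Y \<and>
        (\<exists>C0>0. \<forall>f\<in>fspace leb01 Xbar. Y (hardy_op I f) \<le> ennreal C0 * Xbar f)"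
    then obtain K' where K': "lattice_quasinorm leb01 K' Y"
      by (auto simp: qri_space_def quasi_banach_function_space_def)
    define K where "K = max 1 K'"
    have K: "1 \<le> K" and lq: "lattice_quasinorm leb01 K Y"
      using lattice_quasinorm_weaken[OF K', of K] by (simp_all add: K_def)
    have inv: "rearrangement_invariant leb01 Y" using Y by (simp add: qri_space_def)
    obtain C0 where C0: "0 < C0" "\<forall>f\<in>fspace leb01 Xbar. Y (hardy_op I f) \<le> ennreal C0 * Xbar f"
      using Y by blast
    let ?C' = "8 * K\<^sup>2 * C0"
    have C': "0 < ?C'" using K C0(1) by simp
    have compl: "prob_space (completion M)"
      by (rule prob_spaceI) (simp add: emeasure_space_1)
    show "\<exists>C'>0. \<forall>g\<in>borel_measurable (completion M). Y (rearrangement (completion M) g)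
             \<le> ennreal C' * Xbar (\<lambda>t. rearrangement (completion M) g t * (I t / t))"
      using C' qri_norm_rearrangement_le[OF compl _ est lq inv K C0] by blast
    have second: "(INF c. Y (rearrangement M (\<lambda>x. g x - c))) \<le> ennreal ?C' * (INF c. ?W g c)" if g: "g \<in> Lip" for g
      using Lip_measurable(1)[OF M(2) g]
      by (intro INF_le_cmult_INF[OF C'] qri_norm_rearrangement_le[OF assms(3) _ est lq inv K C0]) simp
    have third: "ennreal ?C' * (INF c. ?W g c) \<le> ennreal (?C' * C) * X (grad_modulus g)" if g: "g \<in> Lip" for g
    proof -
      have "ennreal ?C' * (INF c. ?W g c) \<le> ennreal ?C' * (ennreal C * X (grad_modulus g))"
        by (rule mult_left_mono[OF first[OF g]]) simp
      then show ?thesis using C' C(1) by (simp add: mult.assoc[symmetric] ennreal_mult[symmetric])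
    qed
    have "0 < ?C' * C" using C' C(1) by (rule mult_pos_pos)
    then show "\<exists>C'>0. \<exists>C''>0. \<forall>g\<in>Lip. (INF c. Y (rearrangement M (\<lambda>x. g x - c))) \<le> ennreal C' * (INF c. ?W g c)
        \<and> ennreal C' * (INF c. ?W g c) \<le> ennreal C'' * X (grad_modulus g)"
      using C' second third by blast
  qed
qed

end
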